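(* Let $d\ge 1$, $0<\alpha\le 2$, $\sigma>0$, $\nu\in[-1,1]$, with $\nu=0$ if $\alpha=1$. Let $\xi=(\xi_k)_{k\in\mathbb{Z}^d}$ be i.i.d. real random variables in the normal domain of attraction of the stable distribution $\mathcal{S}_\alpha(\sigma,\nu)$. For $h>0$ let $\mu_h$ be the random signed measure on $\mathbb{R}^d$ with density $$\frac{d\mu_h}{dx}(x)=\sigma^{-1}h^{(\frac1\alpha-1)d}\sum_{k\in\mathbb{Z}^d}\xi_k\,\mathbf{1}_{h(k+[0,1)^d)}(x).$$ Let $W_\alpha$ be the independently scattered $\alpha$-stable random noise on $\mathbb{R}^d$ with Lebesgue control measure and constant skewness $\nu$. Let $\mathcal{F}^\alpha=L^\alpha(\mathbb{R}^d)$ if $1\le\alpha\le2$ and $\mathcal{F}^\alpha=\mathcal{D}^\alpha(\mathbb{R}^d)$ if $0<\alpha<1$. Then, as $h\to0$, $\mu_h$ converges weakly to $W_\alpha$ on $\mathcal{F}^\alpha$.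
   Context: $\mathcal{S}_\alpha(\sigma,\nu)$ is the law with characteristic function $\bar\lambda(\theta)=\exp\left(-\sigma^\alpha|\theta|^\alpha\left(1-i\nu\varepsilon(\theta)\tan\frac{\pi\alpha}{2}\right)\right)$, where $\varepsilon$ is the sign function ($\varepsilon(0)=0$) and $\nu=0$ if $\alpha=1$ (the term with $\tan$ is then absent). A random variable $Y$ is in the normal domain of attraction of $\mathcal{S}_\alpha(\sigma,\nu)$ if $n^{-1/\alpha}\sum_{i=1}^nY_i$ converges in law to $\mathcal{S}_\alpha(\sigma,\nu)$ for i.i.d. copies $Y_i$ of $Y$ (no centering). A random noise is a family $(W[f])_{f\in\mathcal{F}}$ of real random variables indexed by a linear space $\mathcal{F}$ of measurable functions with $W[a_1f_1+a_2f_2]=a_1W[f_1]+a_2W[f_2]$ a.s. $W_\alpha$ is the random noise indexed by $L^\alpha(\mathbb{R}^d)$ with $W_\alpha[f]\sim\mathcal{S}_\alpha(\sigma_f,\nu_f)$, where $\sigma_f=\left(\int|f|^\alpha dx\right)^{1/\alpha}$ and $\sigma_f^\alpha\nu_f=\int\nu\,\varepsilon(f)|f|^\alpha dx$. $\mathcal{D}^\alpha(\mathbb{R}^d)$ is the space of $f\in L^1_{loc}(\mathbb{R}^d)$ such that $f(x)=o(|x|^{-\eta})$ as $|x|\to\infty$ for some $\eta>d/\alpha$. $\mu_h[f]=\int f\,d\mu_h$ is understood as the sum of the series $\sigma^{-1}h^{(\frac1\alpha-1)d}\sum_{k\in\mathbb{Z}^d}\xi_k\int_{h(k+[0,1)^d)}f(x)dx$,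 required only to converge almost surely (semi-convergence along a fixed enumeration of $\mathbb{Z}^d$; absolute convergence is not required); this a.s. convergence holds for all $f\in\mathcal{F}^\alpha$. "$\mu_h$ converges weakly to $W$ on $\mathcal{F}$ as $h\to0$" means that the finite-dimensional distributions of $(\mu_h[f])_{f\in\mathcal{F}}$ converge weakly to those of $(W[f])_{f\in\mathcal{F}}$. *)

theory Defs
  imports "HOL-Probability.Probability" "HOL-Library.Landau_Symbols"
begin

text \<open>The law \<open>S\<^sub>\<alpha>(\<sigma>, \<nu>)\<close> is specified by its characteristic function. For \<open>\<alpha> = 1\<close> the
  convention is \<open>\<nu> = 0\<close>, and then the term with the tangent vanishes. The value \<open>\<sigma> = 0\<close> gives
  the point mass at \<open>0\<close>.\<close>

definition stable_law :: "real \<Rightarrow> real \<Rightarrow> real \<Rightarrow> real measure \<Rightarrow> bool" where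
  "stable_law \<alpha> \<sigma> \<nu> S \<longleftrightarrow>
     real_distribution S \<and>
     (\<forall>\<theta>. char S \<theta> =
        exp (- (of_real (\<sigma> powr \<alpha> * \<bar>\<theta>\<bar> powr \<alpha>)
               * (1 - \<i> * of_real (\<nu> * sgn \<theta> * tan (pi * \<alpha> / 2))))))"

text \<open>The i.i.d. copies of a random variable with law \<open>P\<close> are the coordinates of the infinite
  product space. There is no centering.\<close>

definition normal_domain_of_attraction :: "real \<Rightarrow> real \<Rightarrow> real \<Rightarrow> real measure \<Rightarrow> bool" where
  "normal_domain_of_attraction \<alpha> \<sigma> \<nu> P \<longleftrightarrow>
     (\<exists>S. stable_law \<alpha> \<sigma> \<nu> S \<and>
          weak_conv_m
            (\<lambda>n. distr (Pi\<^sub>M UNIV (\<lambda>_::nat. P)) borel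
                   (\<lambda>y. real n powr (- 1 / \<alpha>) * (\<Sum>i<n. y i)))
            S)"

text \<open>Functions stand for their classes modulo null sets.\<close>

definition L_space :: "real \<Rightarrow> ('a::euclidean_space \<Rightarrow> real) set" where
  "L_space \<alpha> =
     {f. f \<in> borel_measurable lebesgue \<and> integrable lebesgue (\<lambda>x. \<bar>f x\<bar> powr \<alpha>)}"

definition L1_loc :: "('a::euclidean_space \<Rightarrow> real) set" where
  "L1_loc =
     {f. f \<in> borel_measurable lebesgue \<and> (\<forall>K. compact K \<longrightarrow> set_integrable lebesgue K f)}"

definition D_space :: "real \<Rightarrow> ('a::euclidean_space \<Rightarrow> real) set" where
  "D_space \<alpha> =
     {f \<in> L1_loc. \<exists>\<eta> > real DIM('a) / \<alpha>. f \<in> o[at_infinity](\<lambda>x. norm x powr (- \<eta>))}"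

definition F_space :: "real \<Rightarrow> ('a::euclidean_space \<Rightarrow> real) set" where
  "F_space \<alpha> = (if 1 \<le> \<alpha> then L_space \<alpha> else D_space \<alpha>)"

definition random_noise ::
  "'w measure \<Rightarrow> ('a \<Rightarrow> real) set \<Rightarrow> (('a \<Rightarrow> real) \<Rightarrow> 'w \<Rightarrow> real) \<Rightarrow> bool" where
  "random_noise N F W \<longleftrightarrow>
     prob_space N \<and>
     (\<forall>f\<in>F. W f \<in> borel_measurable N) \<and>
     (\<forall>f\<in>F. \<forall>g\<in>F. \<forall>a b. AE \<omega> in N. W (\<lambda>x. a * f x + b * g x) \<omega> = a * W f \<omega> + b * W g \<omega>)"

definition noise_scale :: "real \<Rightarrow> ('a::euclidean_space \<Rightarrow> real) \<Rightarrow> real" where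
  "noise_scale \<alpha> f = (LINT x|lebesgue. \<bar>f x\<bar> powr \<alpha>) powr (1 / \<alpha>)"

text \<open>The skewness \<open>\<nu>\<^sub>f\<close> is determined by \<open>\<sigma>\<^sub>f\<^sup>\<alpha> \<nu>\<^sub>f = \<integral> \<nu> sgn(f) |f|\<^sup>\<alpha>\<close>, except
  when \<open>\<sigma>\<^sub>f = 0\<close>, where its value (here \<open>0\<close>) does not affect the law.\<close>

definition noise_skewness :: "real \<Rightarrow> real \<Rightarrow> ('a::euclidean_space \<Rightarrow> real) \<Rightarrow> real" where
  "noise_skewness \<alpha> \<nu> f =
     (LINT x|lebesgue. \<nu> * sgn (f x) * \<bar>f x\<bar> powr \<alpha>) / noise_scale \<alpha> f powr \<alpha>"

text \<open>Independence of \<open>W\<close> on disjoint sets follows from linearity and the one-dimensional laws: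
  these two determine all finite-dimensional characteristic functions.\<close>

definition stable_noise ::
  "'w measure \<Rightarrow> real \<Rightarrow> real \<Rightarrow> (('a::euclidean_space \<Rightarrow> real) \<Rightarrow> 'w \<Rightarrow> real) \<Rightarrow> bool" where
  "stable_noise N \<alpha> \<nu> W \<longleftrightarrow>
     random_noise N (L_space \<alpha>) W \<and>
     (\<forall>f \<in> L_space \<alpha>. stable_law \<alpha> (noise_scale \<alpha> f) (noise_skewness \<alpha> \<nu> f) (distr N borel (W f)))"

text \<open>The cell \<open>h(k + [0,1)\<^sup>d)\<close>.\<close>

definition cell :: "real \<Rightarrow> int ^ 'd::finite \<Rightarrow> (real ^ 'd) set" where
  "cell h k = {h *\<^sub>R ((\<chi> i. of_int (k $ i)) + u) | u. \<forall>i. 0 \<le> u $ i \<and> u $ i < 1}"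

text \<open>The terms of the series for \<open>\<mu>\<^sub>h[f]\<close> and its sum along the enumeration \<open>e\<close> of
  \<open>\<int>\<^sup>d\<close>. Since \<open>suminf\<close> is unspecified for divergent series, \<open>mu\<close> is meaningful only where
  the series converges.\<close>

definition mu_term ::
  "real \<Rightarrow> real \<Rightarrow> (int ^ 'd \<Rightarrow> 'w \<Rightarrow> real) \<Rightarrow> real \<Rightarrow> (real ^ 'd::finite \<Rightarrow> real) \<Rightarrow> int ^ 'd \<Rightarrow> 'w \<Rightarrow> real"
  where
  "mu_term \<alpha> \<sigma> \<xi> h f k \<omega> =
     inverse \<sigma> * h powr ((1 / \<alpha> - 1) * real CARD('d))
       * (\<xi> k \<omega> * (LINT x:cell h k|lebesgue. f x))"

definition mu ::
  "real \<Rightarrow> real \<Rightarrow> (int ^ 'd \<Rightarrow> 'w \<Rightarrow> real) \<Rightarrow> (nat \<Rightarrow> int ^ 'd) \<Rightarrow> real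
    \<Rightarrow> (real ^ 'd::finite \<Rightarrow> real) \<Rightarrow> 'w \<Rightarrow> real"
  where
  "mu \<alpha> \<sigma> \<xi> e h f \<omega> = (\<Sum>n. mu_term \<alpha> \<sigma> \<xi> h f (e n) \<omega>)"

text \<open>Weak convergence of Borel probability measures along a filter; the \<open>weak_conv_m\<close> of the
  library covers only sequences of measures on the real line.\<close>

definition weak_conv_along ::
  "('b \<Rightarrow> 'a::topological_space measure) \<Rightarrow> 'a measure \<Rightarrow> 'b filter \<Rightarrow> bool" where
  "weak_conv_along \<mu> P F \<longleftrightarrow>
     (\<forall>g :: 'a \<Rightarrow> real. continuous_on UNIV g \<and> bounded (range g) \<longrightarrow>
        ((\<lambda>b. LINT x|\<mu> b. g x) \<longlongrightarrow> (LINT x|P. g x)) F)"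

end

theory Submission
  imports Defs
begin

text \<open>Everything is read off characteristic functions. Let
\<open>G y = |y|\<^sup>\<alpha> (1 - i \<nu> sgn y tan (\<pi>\<alpha>/2))\<close> (\<open>stable_exponent\<close>) and let \<open>\<phi>\<close> be the characteristic
function of the variables \<open>\<xi>\<^sub>k\<close>. The attraction hypothesis amounts to the expansion
\<open>\<phi> t = exp (- G (\<sigma> t) + o(|t|\<^sup>\<alpha>))\<close> at \<open>0\<close> (\<open>normal_domain_of_attraction_char\<close>). If \<open>a\<^sub>k\<close> is the
coefficient of \<open>\<xi>\<^sub>k\<close> in the series for \<open>\<mu>\<^sub>h[f]\<close>, then \<open>\<sigma> a\<^sub>k\<close> is \<open>h\<close> to the power \<open>d/\<alpha>\<close> times the
mean of \<open>f\<close> over the cell of index \<open>k\<close>, so that by homogeneity \<open>\<Sum>\<^sub>k G (\<sigma> a\<^sub>k) = \<integral> G (f\<^sub>h)\<close>, where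
\<open>f\<^sub>h\<close> is the step function of the cell means (\<open>mu_coef_sums\<close>). The coefficients are uniformly small
(\<open>mu_coef_uniformly_small\<close>), so the error terms contribute \<open>o(1)\<close> and
\<open>E exp (i \<mu>\<^sub>h[f]) = exp (- \<integral> G (f\<^sub>h) + o(1))\<close>. Since \<open>\<integral> |f\<^sub>h - f|\<^sup>\<alpha> \<rightarrow> 0\<close>, this tends to
\<open>exp (- \<integral> G f) = E exp (i W[f])\<close> (\<open>mu_char_tendsto\<close>, \<open>stable_noise_char\<close>).

The convergence \<open>f\<^sub>h \<rightarrow> f\<close> has two regimes. For \<open>\<alpha> \<ge> 1\<close> averaging is a contraction by Jensen's
inequality, and for continuous functions of bounded support the claim is uniform continuity
(\<open>cell_step_L_space_tendsto\<close>). For \<open>\<alpha> < 1\<close> averaging is not controlled by the integral of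
\<open>|f|\<^sup>\<alpha>\<close>; there \<open>f\<close> is integrable, the case of exponent \<open>1\<close> controls bounded regions, and the decay
of \<open>f\<close> survives averaging and controls the tails (\<open>cell_step_D_space_tendsto\<close>).

The series converges almost surely although it need not converge absolutely: the expansion gives
\<open>|1 - \<phi> t| \<le> C |t|\<^sup>\<alpha>\<close>, hence partial sums are Cauchy in probability as soon as
\<open>\<Sum>\<^sub>k |a\<^sub>k|\<^sup>\<alpha>\<close> converges, and Ottaviani's inequality upgrades this to almost sure convergence.

Finally both \<open>\<mu>\<^sub>h\<close> and \<open>W\<close> are linear in \<open>f\<close>, so that the characteristic function of a vector of
values is that of a single value at a linear combination, and the continuity theorem for
characteristic functions on Euclidean spaces (\<open>levy_continuity_euclidean\<close>) finishes the proof.\<close>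

section \<open>Integrals of powers and continuous approximation\<close>

text \<open>The integral of \<open>|f|\<^sup>\<alpha>\<close>, without the root: for \<open>\<alpha> < 1\<close> there is no norm, and the
  quasi-triangle inequality \<open>powr_mass_add_le\<close>, valid for all \<open>\<alpha> \<ge> 0\<close>, takes its place. Values in the extended reals avoid integrability side conditions.\<close>

definition powr_mass :: "real \<Rightarrow> ('a::euclidean_space \<Rightarrow> real) \<Rightarrow> ennreal" where
  "powr_mass \<alpha> f = (\<integral>\<^sup>+x. ennreal (\<bar>f x\<bar> powr \<alpha>) \<partial>lebesgue)"

lemma powr_add_le:
  fixes x y :: real
  assumes "0 \<le> x" "0 \<le> y" "0 \<le> \<alpha>"
  shows "(x + y) powr \<alpha> \<le> 2 powr \<alpha> * (x powr \<alpha> + y powr \<alpha>)"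
proof -
  have "(x + y) powr \<alpha> \<le> (2 * max x y) powr \<alpha>"
    using assms by (intro powr_mono2) auto
  also have "\<dots> = 2 powr \<alpha> * max x y powr \<alpha>" using assms by (simp add: powr_mult)
  also have "\<dots> \<le> 2 powr \<alpha> * (x powr \<alpha> + y powr \<alpha>)"
    by (intro mult_left_mono) (auto simp: max_def)
  finally show ?thesis .
qed

lemma abs_add_powr_le:
  fixes x y :: real
  assumes "0 \<le> \<alpha>"
  shows "\<bar>x + y\<bar> powr \<alpha> \<le> 2 powr \<alpha> * (\<bar>x\<bar> powr \<alpha> + \<bar>y\<bar> powr \<alpha>)"
proof -
  have "\<bar>x + y\<bar> powr \<alpha> \<le> (\<bar>x\<bar> + \<bar>y\<bar>) powr \<alpha>" using assms by (intro powr_mono2) auto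
  then show ?thesis using powr_add_le[of "\<bar>x\<bar>" "\<bar>y\<bar>" \<alpha>] assms by simp
qed

lemma powr_mass_add_le:
  assumes [measurable]: "f \<in> borel_measurable lebesgue" "g \<in> borel_measurable lebesgue" and "0 \<le> \<alpha>"
  shows "powr_mass \<alpha> (\<lambda>x. f x + g x) \<le> ennreal (2 powr \<alpha>) * (powr_mass \<alpha> f + powr_mass \<alpha> g)"
proof -
  have "powr_mass \<alpha> (\<lambda>x. f x + g x)
      \<le> (\<integral>\<^sup>+x. ennreal (2 powr \<alpha>) * (ennreal (\<bar>f x\<bar> powr \<alpha>) + ennreal (\<bar>g x\<bar> powr \<alpha>)) \<partial>lebesgue)"
    unfolding powr_mass_def
  proof (rule nn_integral_mono)
    fix x
    show "ennreal (\<bar>f x + g x\<bar> powr \<alpha>) \<le> ennreal (2 powr \<alpha>) * (ennreal (\<bar>f x\<bar> powr \<alpha>) + ennreal (\<bar>g x\<bar> powr \<alpha>))"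
      using abs_add_powr_le[OF assms(3), of "f x" "g x"]
      by (simp flip: ennreal_plus ennreal_mult)
  qed
  also have "\<dots> = ennreal (2 powr \<alpha>) * (powr_mass \<alpha> f + powr_mass \<alpha> g)"
    by (simp add: powr_mass_def nn_integral_cmult nn_integral_add)
  finally show ?thesis .
qed

lemma powr_mass_cmult:
  assumes [measurable]: "f \<in> borel_measurable lebesgue"
  shows "powr_mass \<alpha> (\<lambda>x. c * f x) = ennreal (\<bar>c\<bar> powr \<alpha>) * powr_mass \<alpha> f"
  unfolding powr_mass_def by (simp add: abs_mult powr_mult ennreal_mult nn_integral_cmult)

lemma powr_mass_minus: "powr_mass \<alpha> (\<lambda>x. f x - g x) = powr_mass \<alpha> (\<lambda>x. g x - f x)"
  by (simp add: powr_mass_def abs_minus_commute)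

lemma L_space_iff:
  "f \<in> L_space \<alpha> \<longleftrightarrow> f \<in> borel_measurable lebesgue \<and> powr_mass \<alpha> f < \<infinity>"
  by (auto simp: L_space_def powr_mass_def integrable_iff_bounded)

lemma ex_powr_mult_le:
  fixes V e :: real
  assumes "0 \<le> V" "0 < e" "0 < \<alpha>"
  obtains \<eta> where "0 < \<eta>" "\<eta> powr \<alpha> * V \<le> e"
proof
  let ?\<eta> = "(e / (V + 1)) powr (1 / \<alpha>)"
  show "0 < ?\<eta>" using assms by simp
  have eq: "?\<eta> powr \<alpha> = e / (V + 1)" using assms by (simp add: powr_powr)
  have "e / (V + 1) * V \<le> e / (V + 1) * (V + 1)" using assms by (intro mult_left_mono) auto
  also have "\<dots> = e" using assms by simp
  finally show "?\<eta> powr \<alpha> * V \<le> e" unfolding eq .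
qed

lemma tendsto_ennreal_0I:
  assumes "\<And>e. 0 < e \<Longrightarrow> eventually (\<lambda>x. F x \<le> ennreal e) G"
  shows "(F \<longlongrightarrow> (0::ennreal)) G"
proof (rule order_tendstoI)
  fix a :: ennreal assume "0 < a"
  then obtain b where b: "0 < b" "b < a" using dense by blast
  then obtain r where r: "b = ennreal r" "0 \<le> r" by (cases b) auto
  with b have "0 < r" by auto
  from assms[OF this] show "eventually (\<lambda>x. F x < a) G"
    by eventually_elim (use b r in auto)
qed auto

lemma tendsto_ennreal_0D:
  assumes "(F \<longlongrightarrow> (0::ennreal)) G" "0 < e"
  shows "eventually (\<lambda>x. F x \<le> ennreal e) G"
  using order_tendstoD(2)[OF assms(1), of "ennreal e"] assms(2)
  by (auto elim: eventually_mono)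

lemma powr_mass_approx_bounded:
  fixes f :: "'a::euclidean_space \<Rightarrow> real"
  assumes f [measurable]: "f \<in> borel_measurable lebesgue" and fin: "powr_mass \<alpha> f < \<infinity>"
    and \<alpha>: "0 < \<alpha>" and e: "0 < e"
  shows "\<exists>n::nat. powr_mass \<alpha> (\<lambda>x. f x - (if norm x \<le> n then max (- real n) (min n (f x)) else 0)) \<le> ennreal e"
proof -
  define F where "F n x = (if norm x \<le> real n then max (- real n) (min n (f x)) else 0)" for n :: nat and x
  have [measurable]: "F n \<in> borel_measurable lebesgue" for n
  proof -
    have [measurable]: "{x::'a. norm x \<le> real n} \<in> sets lebesgue"
      using lmeasurable_cball[of "0::'a" "real n"] by (simp add: cball_def fmeasurableD)
    have "F n = (\<lambda>x. if x \<in> {x. norm x \<le> real n} then max (- real n) (min n (f x)) else 0)"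
      by (simp add: F_def fun_eq_iff)
    also have "\<dots> \<in> borel_measurable lebesgue" by measurable
    finally show ?thesis .
  qed
  have "(\<lambda>n. \<integral>\<^sup>+x. ennreal (\<bar>f x - F n x\<bar> powr \<alpha>) \<partial>lebesgue) \<longlonglongrightarrow> (\<integral>\<^sup>+(x::'a). 0 \<partial>lebesgue)"
  proof (rule nn_integral_dominated_convergence[where w = "\<lambda>x. ennreal (\<bar>f x\<bar> powr \<alpha>)"])
    show "AE x in lebesgue. ennreal (\<bar>f x - F n x\<bar> powr \<alpha>) \<le> ennreal (\<bar>f x\<bar> powr \<alpha>)" for n
      using \<alpha> by (intro AE_I2 ennreal_leI powr_mono2) (auto simp: F_def)
    show "AE x in lebesgue. (\<lambda>n. ennreal (\<bar>f x - F n x\<bar> powr \<alpha>)) \<longlonglongrightarrow> 0"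
    proof (rule AE_I2, rule tendsto_eventually)
      fix x
      obtain m :: nat where m: "norm x + \<bar>f x\<bar> \<le> real m" using real_arch_simple by blast
      show "\<forall>\<^sub>F n in sequentially. ennreal (\<bar>f x - F n x\<bar> powr \<alpha>) = 0"
        using eventually_ge_at_top[of m]
      proof eventually_elim
        case (elim n)
        then have "norm x \<le> real n" "\<bar>f x\<bar> \<le> real n" using m norm_ge_zero[of x] by linarith+
        then have "F n x = f x" by (auto simp: F_def)
        then show ?case by simp
      qed
    qed
  qed (use fin in \<open>auto simp: powr_mass_def\<close>)
  then have "(\<lambda>n. powr_mass \<alpha> (\<lambda>x. f x - F n x)) \<longlonglongrightarrow> 0"
    by (simp add: powr_mass_def)
  from eventually_happens[OF tendsto_ennreal_0D[OF this e]] show ?thesis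
    by (auto simp: F_def)
qed

lemma sets_lebesgue_cball [measurable]: "cball (c::'a::euclidean_space) r \<in> sets lebesgue"
  by (rule fmeasurableD[OF lmeasurable_cball])

lemma sets_lebesgue_norm_ge [measurable]: "{x::'a::euclidean_space. r \<le> norm x} \<in> sets lebesgue"
proof -
  have "{x::'a. r \<le> norm x} = - ball 0 r" by (auto simp: not_less)
  then show ?thesis using fmeasurableD[OF lmeasurable_ball, of "0::'a" r]
    by (metis Compl_in_sets_lebesgue)
qed

lemma borel_measurable_norm_powr [measurable]:
  "(\<lambda>x::'a::euclidean_space. norm x powr s) \<in> borel_measurable lebesgue"
  by (rule measurable_completion) simp

lemma emeasure_lebesgue_cball_finite: "emeasure lebesgue (cball (c::'a::euclidean_space) r) < \<infinity>"
  using lmeasurable_cball[of c r] by (simp add: fmeasurable_def)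

text \<open>Density of continuous functions of bounded support. After truncation \<open>f\<close> is bounded and vanishes
  outside a ball. A Lebesgue measurable function is almost everywhere a limit of continuous
  functions; clipping these and multiplying them by a continuous cutoff keeps the limit and makes
  dominated convergence applicable.\<close>

lemma powr_mass_approx_continuous:
  fixes f :: "'a::euclidean_space \<Rightarrow> real"
  assumes f [measurable]: "f \<in> borel_measurable lebesgue" and fin: "powr_mass \<alpha> f < \<infinity>"
    and \<alpha>: "0 < \<alpha>" and e: "0 < e"
  shows "\<exists>g B R. continuous_on UNIV g \<and> (\<forall>x. \<bar>g x\<bar> \<le> B) \<and> (\<forall>x. R < norm x \<longrightarrow> g x = 0) \<and> 0 < R \<and> 0 < B \<and>
    powr_mass \<alpha> (\<lambda>x. f x - g x) \<le> ennreal e"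
proof -
  define e' where "e' = e / (2 * 2 powr \<alpha>)"
  have e': "0 < e'" using e by (simp add: e'_def)
  from powr_mass_approx_bounded[OF f fin \<alpha> e'] obtain n :: nat where
    n: "powr_mass \<alpha> (\<lambda>x. f x - (if norm x \<le> n then max (- real n) (min n (f x)) else 0)) \<le> ennreal e'" by blast
  define F where "F x = (if norm x \<le> real n then max (- real n) (min n (f x)) else 0)" for x
  have [measurable]: "F \<in> borel_measurable lebesgue"
  proof -
    have [measurable]: "{x::'a. norm x \<le> real n} \<in> sets lebesgue"
      using lmeasurable_cball[of "0::'a" "real n"] by (simp add: cball_def fmeasurableD)
    have "F = (\<lambda>x. if x \<in> {x. norm x \<le> real n} then max (- real n) (min n (f x)) else 0)"
      by (simp add: F_def fun_eq_iff)
    also have "\<dots> \<in> borel_measurable lebesgue" by measurable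
    finally show ?thesis .
  qed
  have Fn: "\<bar>F x\<bar> \<le> real n" for x by (auto simp: F_def)
  have "F measurable_on UNIV" by (rule lebesgue_measurable_imp_measurable_on_real) auto
  then obtain N0 g where N0: "negligible N0" and gc: "\<And>m. continuous_on UNIV (g m)"
    and gl: "\<And>x. x \<notin> N0 \<Longrightarrow> (\<lambda>m. g m x) \<longlonglongrightarrow> F x"
    by (auto simp: measurable_on_def)
  define ct where "ct x = max 0 (min 1 (real n + 1 - norm x))" for x :: 'a
  define G where "G m x = max (- real n) (min n (g m x)) * ct x" for m :: nat and x
  have Gc: "continuous_on UNIV (G m)" for m
    unfolding G_def ct_def by (intro continuous_intros gc)
  have [measurable]: "G m \<in> borel_measurable lebesgue" for m
    using borel_measurable_continuous_onI[OF Gc] by (simp add: measurable_completion)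
  have ct01: "0 \<le> ct x" "ct x \<le> 1" for x by (auto simp: ct_def)
  have Gn: "\<bar>G m x\<bar> \<le> real n" for m x
  proof -
    have "\<bar>G m x\<bar> \<le> real n * 1"
      unfolding G_def abs_mult using ct01[of x] by (intro mult_mono) auto
    then show ?thesis by simp
  qed
  have G0: "G m x = 0" "F x = 0" if "real n + 1 < norm x" for m x
    using that by (auto simp: G_def ct_def F_def)
  have "(\<lambda>m. \<integral>\<^sup>+x. ennreal (\<bar>F x - G m x\<bar> powr \<alpha>) \<partial>lebesgue) \<longlonglongrightarrow> (\<integral>\<^sup>+(x::'a). 0 \<partial>lebesgue)"
  proof (rule nn_integral_dominated_convergence[where
      w = "\<lambda>x. ennreal ((2 * real n) powr \<alpha>) * indicator (cball 0 (real n + 1)) x"])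
    show "AE x in lebesgue. ennreal (\<bar>F x - G m x\<bar> powr \<alpha>)
        \<le> ennreal ((2 * real n) powr \<alpha>) * indicator (cball 0 (real n + 1)) x" for m
    proof (rule AE_I2)
      fix x
      have "\<bar>F x - G m x\<bar> \<le> 2 * real n" using Fn[of x] Gn[of m x] by linarith
      then have "\<bar>F x - G m x\<bar> powr \<alpha> \<le> (2 * real n) powr \<alpha>" using \<alpha> by (intro powr_mono2) auto
      then show "ennreal (\<bar>F x - G m x\<bar> powr \<alpha>)
          \<le> ennreal ((2 * real n) powr \<alpha>) * indicator (cball 0 (real n + 1)) x"
        using G0(1)[of x m] G0(2)[of x] by (auto split: split_indicator intro!: ennreal_leI)
    qed
    show "(\<integral>\<^sup>+x. ennreal ((2 * real n) powr \<alpha>) * indicator (cball (0::'a) (real n + 1)) x \<partial>lebesgue) < \<infinity>"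
      using emeasure_lebesgue_cball_finite[of "0::'a" "real n + 1"]
      by (subst nn_integral_cmult_indicator) (auto simp: ennreal_mult_less_top)
    show "AE x in lebesgue. (\<lambda>m. ennreal (\<bar>F x - G m x\<bar> powr \<alpha>)) \<longlonglongrightarrow> 0"
    proof -
      have "AE x in lebesgue. x \<notin> N0"
        using N0 by (intro AE_not_in) (simp add: negligible_iff_null_sets)
      then show ?thesis
      proof eventually_elim
        case (elim x)
        have "(\<lambda>m. G m x) \<longlonglongrightarrow> max (- real n) (min n (F x)) * ct x"
          unfolding G_def by (intro tendsto_intros gl elim)
        also have "max (- real n) (min n (F x)) * ct x = F x"
          using Fn[of x] by (auto simp: F_def ct_def)
        finally have "(\<lambda>m. \<bar>F x - G m x\<bar> powr \<alpha>) \<longlonglongrightarrow> \<bar>F x - F x\<bar> powr \<alpha>"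
          using \<alpha> by (intro tendsto_powr' tendsto_intros) auto
        from tendsto_ennrealI[OF this] show ?case by simp
      qed
    qed
    show "(\<lambda>x. ennreal ((2 * real n) powr \<alpha>) * indicator (cball (0::'a) (real n + 1)) x) \<in> borel_measurable lebesgue"
      by measurable
    show "(\<lambda>x. ennreal (\<bar>F x - G m x\<bar> powr \<alpha>)) \<in> borel_measurable lebesgue" for m
      by measurable
  qed simp
  then have "(\<lambda>m. powr_mass \<alpha> (\<lambda>x. F x - G m x)) \<longlonglongrightarrow> 0"
    by (simp add: powr_mass_def)
  from eventually_happens[OF tendsto_ennreal_0D[OF this e']] obtain m where
    m: "powr_mass \<alpha> (\<lambda>x. F x - G m x) \<le> ennreal e'" by auto
  have "powr_mass \<alpha> (\<lambda>x. f x - G m x) = powr_mass \<alpha> (\<lambda>x. (f x - F x) + (F x - G m x))" by simp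
  also have "\<dots> \<le> ennreal (2 powr \<alpha>) * (powr_mass \<alpha> (\<lambda>x. f x - F x) + powr_mass \<alpha> (\<lambda>x. F x - G m x))"
    by (rule powr_mass_add_le) (use \<alpha> in auto)
  also have "\<dots> \<le> ennreal (2 powr \<alpha>) * (ennreal e' + ennreal e')"
    using n m by (intro mult_left_mono add_mono) (auto simp: F_def)
  also have "\<dots> = ennreal e"
    using e e' by (simp add: e'_def flip: ennreal_plus ennreal_mult)
  finally show ?thesis
    using Gc[of m] Gn[of m] G0(1)[of _ m]
    by (intro exI[of _ "G m"] exI[of _ "real n + 1"] exI[of _ "real n + 1"]) (auto intro: order_trans add_increasing2)
qed

section \<open>The cells of the grid\<close>

definition cell_index :: "real \<Rightarrow> real ^ 'd::finite \<Rightarrow> int ^ 'd" where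
  "cell_index h x = (\<chi> i. \<lfloor>x $ i / h\<rfloor>)"

definition cell_avg :: "real \<Rightarrow> (real ^ 'd::finite \<Rightarrow> real) \<Rightarrow> int ^ 'd \<Rightarrow> real" where
  "cell_avg h f k = (LINT y:cell h k|lebesgue. f y) / h ^ CARD('d)"

lemma mem_cell_iff:
  fixes h :: real
  assumes "0 < h"
  shows "x \<in> cell h k \<longleftrightarrow> (\<forall>i. h * k $ i \<le> x $ i \<and> x $ i < h * (k $ i + 1))"
proof
  assume "x \<in> cell h k"
  then show "\<forall>i. h * k $ i \<le> x $ i \<and> x $ i < h * (k $ i + 1)"
    using assms by (auto simp: cell_def)
next
  assume *: "\<forall>i. h * k $ i \<le> x $ i \<and> x $ i < h * (k $ i + 1)"
  define u where "u = (\<chi> i. x $ i / h - of_int (k $ i))"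
  have "x = h *\<^sub>R ((\<chi> i. of_int (k $ i)) + u)"
    using assms by (simp add: vec_eq_iff u_def)
  moreover have "0 \<le> u $ i \<and> u $ i < 1" for i
    using *[rule_format, of i] assms by (simp add: u_def field_simps)
  ultimately show "x \<in> cell h k" unfolding cell_def by blast
qed

lemma mem_cell_iff_index:
  assumes "0 < h"
  shows "x \<in> cell h k \<longleftrightarrow> cell_index h x = k"
proof -
  have "(h * k $ i \<le> x $ i \<and> x $ i < h * (k $ i + 1)) \<longleftrightarrow> \<lfloor>x $ i / h\<rfloor> = k $ i" for i
    using assms by (simp add: floor_eq_iff field_simps)
  then show ?thesis by (simp add: mem_cell_iff[OF assms] cell_index_def vec_eq_iff)
qed

lemma cell_subset_cbox:
  fixes h :: real
  assumes "0 < h"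
  shows "cell h k \<subseteq> cbox (\<chi> i. h * k $ i) (\<chi> i. h * (k $ i + 1))"
  unfolding subset_eq Ball_def mem_cell_iff[OF assms] by (auto simp: mem_box_cart less_imp_le)

lemma box_subset_cell:
  fixes h :: real
  assumes "0 < h"
  shows "box (\<chi> i. h * k $ i) (\<chi> i. h * (k $ i + 1)) \<subseteq> cell h k"
  unfolding subset_eq Ball_def mem_cell_iff[OF assms] by (auto simp: mem_box_cart less_imp_le)

lemma cell_borel:
  fixes h :: real
  assumes "0 < h"
  shows "cell h k \<in> sets borel"
proof -
  have "cell h k = {x. \<forall>i. h * k $ i \<le> x $ i \<and> x $ i < h * (k $ i + 1)}"
    using mem_cell_iff[OF assms, of _ k] by auto
  also have "\<dots> = {x\<in>space borel. \<forall>i. h * k $ i \<le> x $ i \<and> x $ i < h * (k $ i + 1)}" by simp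
  also have "\<dots> \<in> sets borel" by measurable
  finally show ?thesis .
qed

lemma cell_sets [simp, measurable]: "0 < h \<Longrightarrow> cell h k \<in> sets lebesgue"
  using cell_borel[of h k] by (simp add: sets_completionI_sets)

lemma emeasure_cell:
  fixes k :: "int ^ 'd::finite" and h :: real
  assumes "0 < h"
  shows "emeasure lebesgue (cell h k) = ennreal (h ^ CARD('d))"
proof -
  let ?a = "\<chi> i. h * k $ i" and ?b = "\<chi> i. h * (k $ i + 1)"
  have le: "?a \<bullet> b \<le> ?b \<bullet> b" if "b \<in> Basis" for b :: "real ^ 'd"
    using that assms by (auto simp: Basis_vec_def inner_axis algebra_simps)
  have pr: "(\<Prod>b\<in>Basis. (?b - ?a) \<bullet> b) = h ^ CARD('d)"
  proof -
    have "(?b - ?a) \<bullet> b = h" if "b \<in> Basis" for b :: "real ^ 'd"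
      using that by (auto simp: Basis_vec_def inner_axis algebra_simps)
    then have "(\<Prod>b\<in>Basis. (?b - ?a) \<bullet> b) = (\<Prod>b\<in>(Basis :: (real ^ 'd) set). h)"
      by (intro prod.cong) auto
    then show ?thesis by simp
  qed
  have "emeasure lborel (cell h k) \<le> emeasure lborel (cbox ?a ?b)"
    by (intro emeasure_mono cell_subset_cbox assms) auto
  moreover have "emeasure lborel (box ?a ?b) \<le> emeasure lborel (cell h k)"
    by (intro emeasure_mono box_subset_cell assms) (use cell_borel[OF assms] in auto)
  moreover have "emeasure lborel (box ?a ?b) = ennreal (h ^ CARD('d))"
    "emeasure lborel (cbox ?a ?b) = ennreal (h ^ CARD('d))"
    using le pr by (simp_all add: emeasure_lborel_cbox_eq emeasure_lborel_box_eq)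
  ultimately have "emeasure lborel (cell h k) = ennreal (h ^ CARD('d))" by simp
  then show ?thesis using cell_borel[OF assms, of k] assms by simp
qed

lemma norm_cell_diff:
  fixes x y :: "real ^ 'd::finite" and h :: real
  assumes h: "0 < h" and "x \<in> cell h k" "y \<in> cell h k"
  shows "norm (x - y) \<le> CARD('d) * h"
proof -
  have "norm (x - y) \<le> (\<Sum>i\<in>UNIV. \<bar>(x - y) $ i\<bar>)" by (rule norm_le_l1_cart)
  also have "(\<Sum>i\<in>UNIV. \<bar>(x - y) $ i\<bar>) \<le> (\<Sum>i\<in>(UNIV::'d set). h)"
  proof (rule sum_mono)
    fix i
    show "\<bar>(x - y) $ i\<bar> \<le> h"
      using assms(2,3)[unfolded mem_cell_iff[OF h], rule_format, of i]
      by (simp add: abs_le_iff algebra_simps)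
  qed
  finally show ?thesis by simp
qed

lemma measurable_cell_index:
  assumes "0 < h"
  shows "cell_index h \<in> lebesgue \<rightarrow>\<^sub>M count_space UNIV"
proof (subst measurable_count_space_eq_countable)
  have "cell_index h -` {k} \<inter> space lebesgue \<in> sets lebesgue" for k
  proof -
    have "cell_index h -` {k} \<inter> space lebesgue = cell h k"
      using mem_cell_iff_index[OF assms, of _ k] by auto
    then show ?thesis using cell_sets[OF assms, of k] by (simp only:)
  qed
  then show "cell_index h \<in> space lebesgue \<rightarrow> UNIV \<and>
      (\<forall>a\<in>UNIV. cell_index h -` {a} \<inter> space lebesgue \<in> sets lebesgue)" by blast
qed auto

lemma measurable_cell_step [measurable]:
  assumes "0 < h"
  shows "(\<lambda>x. c (cell_index h x)) \<in> borel_measurable lebesgue"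
  by (rule measurable_compose[OF measurable_cell_index[OF assms]]) simp

lemma nn_integral_cells:
  fixes e :: "nat \<Rightarrow> int ^ 'd::finite"
  assumes h: "0 < h" and e: "bij e" and [measurable]: "u \<in> borel_measurable lebesgue"
  shows "(\<integral>\<^sup>+x. u x \<partial>lebesgue) = (\<Sum>n. \<integral>\<^sup>+x\<in>cell h (e n). u x \<partial>lebesgue)"
proof -
  have "u x = (\<Sum>n. u x * indicator (cell h (e n)) x)" for x
  proof -
    obtain m where m: "e m = cell_index h x" using e by (metis bij_pointE)
    have "x \<in> cell h (e n) \<longleftrightarrow> n = m" for n
      unfolding mem_cell_iff_index[OF h] m[symmetric] using bij_is_inj[OF e] by (auto dest: injD)
    then have "(\<lambda>n. u x * indicator (cell h (e n)) x) = (\<lambda>n. if n = m then u x else 0)"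
      by (auto split: split_indicator)
    also have "\<dots> sums u x" by (rule sums_single)
    finally show ?thesis by (rule sums_unique)
  qed
  then have "(\<integral>\<^sup>+x. u x \<partial>lebesgue) = (\<integral>\<^sup>+x. (\<Sum>n. u x * indicator (cell h (e n)) x) \<partial>lebesgue)" by simp
  also have "\<dots> = (\<Sum>n. \<integral>\<^sup>+x. u x * indicator (cell h (e n)) x \<partial>lebesgue)"
    using h by (intro nn_integral_suminf) auto
  finally show ?thesis .
qed

lemma nn_integral_step_cell:
  fixes k :: "int ^ 'd::finite" and h :: real
  assumes h: "0 < h"
  shows "(\<integral>\<^sup>+x\<in>cell h k. c (cell_index h x) \<partial>lebesgue) = c k * ennreal (h ^ CARD('d))"
proof -
  have "(\<integral>\<^sup>+x\<in>cell h k. c (cell_index h x) \<partial>lebesgue) = (\<integral>\<^sup>+x. c k * indicator (cell h k) x \<partial>lebesgue)"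
    by (intro nn_integral_cong) (auto split: split_indicator simp: mem_cell_iff_index[OF h])
  also have "\<dots> = c k * ennreal (h ^ CARD('d))"
    using h by (simp add: nn_integral_cmult_indicator emeasure_cell del: emeasure_completion)
  finally show ?thesis .
qed

text \<open>The bridge between series over the grid and integrals of step functions.\<close>

lemma nn_integral_step:
  fixes e :: "nat \<Rightarrow> int ^ 'd::finite"
  assumes h: "0 < h" and e: "bij e"
  shows "(\<integral>\<^sup>+x. c (cell_index h x) \<partial>lebesgue) = (\<Sum>n. c (e n) * ennreal (h ^ CARD('d)))"
  by (simp only: nn_integral_cells[OF h e measurable_cell_step[OF h]] nn_integral_step_cell[OF h])

lemma integral_step_sums:
  fixes e :: "nat \<Rightarrow> int ^ 'd::finite" and c :: "int ^ 'd \<Rightarrow> 'b::{banach, second_countable_topology}"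
  assumes h: "0 < h" and e: "bij e" and int: "integrable lebesgue (\<lambda>x. c (cell_index h x))"
  shows "summable (\<lambda>n. h ^ CARD('d) * norm (c (e n)))"
    and "(\<lambda>n. h ^ CARD('d) *\<^sub>R c (e n)) sums (LINT x|lebesgue. c (cell_index h x))"
proof -
  let ?V = "h ^ CARD('d)"
  have "(\<integral>\<^sup>+x. ennreal (norm (c (cell_index h x))) \<partial>lebesgue) < \<infinity>"
    using int by (simp add: integrable_iff_bounded)
  then have "(\<Sum>n. ennreal (?V * norm (c (e n)))) \<noteq> top"
    using h by (simp add: nn_integral_step[OF h e, of "\<lambda>k. ennreal (norm (c k))"] mult.commute flip: ennreal_mult)
  then show sm: "summable (\<lambda>n. ?V * norm (c (e n)))"
    using h by (intro summable_suminf_not_top) auto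
  have U: "(\<Union>n. cell h (e n)) = UNIV"
  proof -
    have "x \<in> (\<Union>n. cell h (e n))" for x
      using mem_cell_iff_index[OF h, of x] bij_pointE[OF e, of "cell_index h x"] by (metis UN_I UNIV_I)
    then show ?thesis by blast
  qed
  have disj: "cell h (e i) \<inter> cell h (e j) = {}" if "i \<noteq> j" for i j
    using that mem_cell_iff_index[OF h] bij_is_inj[OF e] by (metis disjoint_iff injD)
  have "(LINT x:(\<Union>n. cell h (e n))|lebesgue. c (cell_index h x))
      = (\<Sum>n. (LINT x:cell h (e n)|lebesgue. c (cell_index h x)))"
    by (rule lebesgue_integral_countable_add) (use h disj U int in \<open>auto simp: set_integrable_def\<close>)
  moreover have "(LINT x:cell h (e n)|lebesgue. c (cell_index h x)) = ?V *\<^sub>R c (e n)" for n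
  proof -
    have "(LINT x:cell h (e n)|lebesgue. c (cell_index h x)) = (LINT x:cell h (e n)|lebesgue. c (e n))"
      by (rule set_lebesgue_integral_cong) (use h in \<open>auto simp: mem_cell_iff_index[OF h]\<close>)
    also have "\<dots> = ?V *\<^sub>R c (e n)"
      using h emeasure_cell[OF h, of "e n"] by (subst set_integral_const) (auto simp: measure_def)
    finally show ?thesis .
  qed
  moreover have "summable (\<lambda>n. ?V *\<^sub>R c (e n))"
    by (rule summable_norm_cancel) (use sm h in \<open>simp add: abs_mult\<close>)
  ultimately show "(\<lambda>n. ?V *\<^sub>R c (e n)) sums (LINT x|lebesgue. c (cell_index h x))"
    using U by (simp add: summable_sums set_lebesgue_integral_def)
qed

section \<open>Cell averages in spaces of exponent at least one\<close>

text \<open>Without integrability on cells the average is the default value \<open>0\<close> of a divergent integral, and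
  averaging is not linear.\<close>

definition cell_integrable :: "(real ^ 'd::finite \<Rightarrow> real) \<Rightarrow> bool" where
  "cell_integrable f \<longleftrightarrow> (\<forall>h>0. \<forall>k. set_integrable lebesgue (cell h k) f)"

definition cell_step :: "real \<Rightarrow> (real ^ 'd::finite \<Rightarrow> real) \<Rightarrow> real ^ 'd \<Rightarrow> real" where
  "cell_step h f x = cell_avg h f (cell_index h x)"

lemma cell_step_measurable [measurable]: "0 < h \<Longrightarrow> cell_step h f \<in> borel_measurable lebesgue"
  unfolding cell_step_def[abs_def] by (rule measurable_cell_step)

lemma cell_avg_diff:
  assumes "0 < h" "cell_integrable f" "cell_integrable g"
  shows "cell_avg h (\<lambda>x. f x - g x) k = cell_avg h f k - cell_avg h g k"
  using assms by (simp add: cell_avg_def cell_integrable_def set_integral_diff diff_divide_distrib)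

lemma cell_integrable_diff:
  "cell_integrable f \<Longrightarrow> cell_integrable g \<Longrightarrow> cell_integrable (\<lambda>x. f x - g x)"
  by (simp add: cell_integrable_def set_integral_diff)

lemma set_integrable_cell_bounded:
  fixes f :: "real ^ 'd::finite \<Rightarrow> real"
  assumes "0 < h" "f \<in> borel_measurable lebesgue" "\<And>x. x \<in> cell h k \<Longrightarrow> \<bar>f x\<bar> \<le> B"
  shows "set_integrable lebesgue (cell h k) f"
  unfolding set_integrable_def
  by (rule integrableI_bounded_set_indicator[where B = B])
    (use assms in \<open>auto simp: emeasure_cell simp del: emeasure_completion\<close>)

lemma cell_integrable_bounded:
  assumes "f \<in> borel_measurable lebesgue" "\<And>x. \<bar>f x\<bar> \<le> B"
  shows "cell_integrable f"
  unfolding cell_integrable_def using set_integrable_cell_bounded assms by blast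

lemma measure_cell:
  fixes k :: "int ^ 'd::finite"
  assumes "0 < h"
  shows "measure lebesgue (cell h k) = h ^ CARD('d)"
  using emeasure_cell[OF assms, of k] assms by (simp add: measure_def del: emeasure_completion)

lemma set_integral_cell_const:
  fixes k :: "int ^ 'd::finite"
  assumes "0 < h"
  shows "(LINT x:cell h k|lebesgue. c) = h ^ CARD('d) * (c::real)"
  using assms emeasure_cell[OF assms, of k]
  by (subst set_integral_const) (auto simp: measure_cell simp del: emeasure_completion)

lemma cell_avg_const:
  assumes "0 < h"
  shows "cell_avg h (\<lambda>_. c) k = c"
  using assms by (simp add: cell_avg_def set_integral_cell_const)

lemma abs_cell_avg_le_avg:
  fixes f :: "real ^ 'd::finite \<Rightarrow> real"
  assumes "0 < h" "set_integrable lebesgue (cell h k) f"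
  shows "\<bar>cell_avg h f k\<bar> \<le> cell_avg h (\<lambda>x. \<bar>f x\<bar>) k"
  using set_integral_norm_bound[OF assms(2)] assms(1)
  by (simp add: cell_avg_def divide_right_mono)

lemma cell_avg_le:
  fixes f :: "real ^ 'd::finite \<Rightarrow> real"
  assumes h: "0 < h" and "set_integrable lebesgue (cell h k) f" and "\<And>x. x \<in> cell h k \<Longrightarrow> f x \<le> B"
  shows "cell_avg h f k \<le> B"
proof -
  have "(LINT x:cell h k|lebesgue. f x) \<le> (LINT x:cell h k|lebesgue. B)"
    by (intro set_integral_mono assms(2,3) set_integrable_cell_bounded[where B = "\<bar>B\<bar>"] h) auto
  then show ?thesis using h by (simp add: cell_avg_def set_integral_cell_const field_simps)
qed

lemma abs_cell_avg_le:
  fixes f :: "real ^ 'd::finite \<Rightarrow> real"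
  assumes h: "0 < h" and f: "set_integrable lebesgue (cell h k) f" and B: "\<And>x. x \<in> cell h k \<Longrightarrow> \<bar>f x\<bar> \<le> B"
  shows "\<bar>cell_avg h f k\<bar> \<le> B"
  using abs_cell_avg_le_avg[OF h f] cell_avg_le[OF h set_integrable_abs[OF f] B] by simp

text \<open>The convex function \<open>y\<^sup>\<alpha>\<close> lies above its tangent at \<open>m\<close>, in the form of Young's inequality.\<close>

lemma powr_tangent_le:
  fixes y m \<alpha> :: real
  assumes "1 \<le> \<alpha>" "0 \<le> y" "0 < m"
  shows "y * m powr (\<alpha> - 1) \<le> y powr \<alpha> / \<alpha> + (1 - 1 / \<alpha>) * m powr \<alpha>"
proof (cases "y = 0")
  case True
  then show ?thesis using assms by simp
next
  case False
  have "(y powr \<alpha>) powr (1 / \<alpha>) * (m powr \<alpha>) powr (1 - 1 / \<alpha>) \<le> 1 / \<alpha> * y powr \<alpha> + (1 - 1 / \<alpha>) * m powr \<alpha>"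
    by (rule Youngs_inequality_0) (use assms False in auto)
  moreover have "(y powr \<alpha>) powr (1 / \<alpha>) = y" using assms False by (simp add: powr_powr)
  moreover have "\<alpha> * (1 - 1 / \<alpha>) = \<alpha> - 1" using assms by (simp add: field_simps)
  then have "(m powr \<alpha>) powr (1 - 1 / \<alpha>) = m powr (\<alpha> - 1)" by (simp add: powr_powr)
  ultimately show ?thesis by simp
qed

text \<open>Jensen's inequality on one cell: integrate the tangent inequality at the mean \<open>m\<close> of \<open>|f|\<close> over
  the cell.\<close>

lemma cell_jensen:
  fixes f :: "real ^ 'd::finite \<Rightarrow> real"
  assumes h: "0 < h" and f: "set_integrable lebesgue (cell h k) f" and \<alpha>: "1 \<le> \<alpha>"
    and [measurable]: "f \<in> borel_measurable lebesgue"
  shows "ennreal (\<bar>cell_avg h f k\<bar> powr \<alpha>) * ennreal (h ^ CARD('d))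
    \<le> (\<integral>\<^sup>+x\<in>cell h k. ennreal (\<bar>f x\<bar> powr \<alpha>) \<partial>lebesgue)"
proof (cases "(\<integral>\<^sup>+x\<in>cell h k. ennreal (\<bar>f x\<bar> powr \<alpha>) \<partial>lebesgue) < \<infinity>")
  case False
  then show ?thesis by (simp add: less_top[symmetric])
next
  case True
  let ?V = "h ^ CARD('d)"
  define m where "m = cell_avg h (\<lambda>x. \<bar>f x\<bar>) k"
  define I where "I = (LINT x:cell h k|lebesgue. \<bar>f x\<bar> powr \<alpha>)"
  have [measurable]: "cell h k \<in> sets lebesgue" using h by simp
  have si: "set_integrable lebesgue (cell h k) (\<lambda>x. \<bar>f x\<bar> powr \<alpha>)"
    unfolding set_integrable_def
  proof (subst integrable_iff_bounded, intro conjI)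
    have "(\<integral>\<^sup>+x. ennreal (norm (indicat_real (cell h k) x *\<^sub>R \<bar>f x\<bar> powr \<alpha>)) \<partial>lebesgue)
        = (\<integral>\<^sup>+x\<in>cell h k. ennreal (\<bar>f x\<bar> powr \<alpha>) \<partial>lebesgue)"
      by (intro nn_integral_cong) (auto split: split_indicator)
    with True show "(\<integral>\<^sup>+x. ennreal (norm (indicat_real (cell h k) x *\<^sub>R \<bar>f x\<bar> powr \<alpha>)) \<partial>lebesgue) < \<infinity>"
      by simp
  qed measurable
  have I: "(\<integral>\<^sup>+x\<in>cell h k. ennreal (\<bar>f x\<bar> powr \<alpha>) \<partial>lebesgue) = ennreal I"
    unfolding nn_integral_set_ennreal I_def set_lebesgue_integral_def
    using nn_integral_eq_integral[OF si[unfolded set_integrable_def]] by (simp add: mult.commute)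
  have fm: "\<bar>cell_avg h f k\<bar> \<le> m" unfolding m_def by (rule abs_cell_avg_le_avg[OF h f])
  have V: "0 < ?V" using h by simp
  have key: "m powr \<alpha> * ?V \<le> I"
  proof (cases "m = 0")
    case True
    then show ?thesis unfolding I_def by (simp add: set_lebesgue_integral_def)
  next
    case False
    with fm have m: "0 < m" by linarith
    have "(LINT x:cell h k|lebesgue. \<bar>f x\<bar> * m powr (\<alpha> - 1))
        \<le> (LINT x:cell h k|lebesgue. \<bar>f x\<bar> powr \<alpha> / \<alpha> + (1 - 1 / \<alpha>) * m powr \<alpha>)"
      using \<alpha> m
      by (intro set_integral_mono set_integral_add set_integrable_mult_left set_integrable_abs f
          set_integrable_divide si set_integrable_cell_bounded[OF h _ order_refl] powr_tangent_le) auto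
    also have "\<dots> = (LINT x:cell h k|lebesgue. \<bar>f x\<bar> powr \<alpha> / \<alpha>)
        + (LINT x:cell h k|lebesgue. (1 - 1 / \<alpha>) * m powr \<alpha>)"
      by (rule set_integral_add)
        (auto intro!: set_integrable_divide si set_integrable_cell_bounded[OF h _ order_refl])
    also have "\<dots> = I / \<alpha> + ?V * ((1 - 1 / \<alpha>) * m powr \<alpha>)"
      unfolding set_integral_cell_const[OF h] I_def by simp
    also have "(LINT x:cell h k|lebesgue. \<bar>f x\<bar> * m powr (\<alpha> - 1)) = m * ?V * m powr (\<alpha> - 1)"
      using V by (simp add: m_def cell_avg_def)
    also have "m * ?V * m powr (\<alpha> - 1) = m powr \<alpha> * ?V"
      using m powr_mult_base[of m "\<alpha> - 1"] by (simp add: mult_ac)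
    finally have "m powr \<alpha> * ?V / \<alpha> \<le> I / \<alpha>" by (simp add: algebra_simps)
    then show ?thesis using \<alpha> by (simp add: divide_le_cancel)
  qed
  have "ennreal (\<bar>cell_avg h f k\<bar> powr \<alpha>) * ennreal ?V = ennreal (\<bar>cell_avg h f k\<bar> powr \<alpha> * ?V)"
    using V by (simp add: ennreal_mult)
  also have "\<dots> \<le> ennreal I"
  proof (intro ennreal_leI order_trans[OF _ key] mult_right_mono)
    show "\<bar>cell_avg h f k\<bar> powr \<alpha> \<le> m powr \<alpha>" using fm \<alpha> by (intro powr_mono2) auto
  qed (use V in auto)
  finally show ?thesis using I by simp
qed

text \<open>Sums over cells do not depend on the enumeration; the estimates that do not mention one use an
  arbitrary enumeration.\<close>

lemma ex_enumeration: "\<exists>e :: nat \<Rightarrow> int ^ 'd::finite. bij e"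
proof -
  have "inj (\<lambda>n::int. (\<chi> i. n) :: int ^ 'd)" by (auto simp: inj_def vec_eq_iff)
  then have "infinite (UNIV :: (int ^ 'd) set)"
    using finite_imageD[of "\<lambda>n::int. (\<chi> i. n) :: int ^ 'd" UNIV] infinite_UNIV_int
    by (meson finite_subset subset_UNIV)
  then show ?thesis
    using bij_betw_from_nat_into[of "UNIV :: (int ^ 'd) set"] by auto
qed

lemma powr_mass_cell_step_le:
  fixes f :: "real ^ 'd::finite \<Rightarrow> real"
  assumes h: "0 < h" and f: "cell_integrable f" and \<alpha>: "1 \<le> \<alpha>"
    and [measurable]: "f \<in> borel_measurable lebesgue"
  shows "powr_mass \<alpha> (cell_step h f) \<le> powr_mass \<alpha> f"
proof -
  obtain e :: "nat \<Rightarrow> int ^ 'd" where e: "bij e" using ex_enumeration by blast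
  have "powr_mass \<alpha> (cell_step h f) = (\<Sum>n. ennreal (\<bar>cell_avg h f (e n)\<bar> powr \<alpha>) * ennreal (h ^ CARD('d)))"
    unfolding powr_mass_def cell_step_def by (rule nn_integral_step[OF h e])
  also have "\<dots> \<le> (\<Sum>n. \<integral>\<^sup>+x\<in>cell h (e n). ennreal (\<bar>f x\<bar> powr \<alpha>) \<partial>lebesgue)"
    by (intro suminf_le cell_jensen h \<alpha>) (use f h in \<open>auto simp: cell_integrable_def\<close>)
  also have "\<dots> = powr_mass \<alpha> f"
    unfolding powr_mass_def by (rule nn_integral_cells[symmetric, OF h e]) measurable
  finally show ?thesis .
qed

text \<open>A cell of side \<open>h\<close> has diameter at most \<open>d h\<close>, so \<open>g\<close> oscillates little on it by uniform
  continuity, and the difference is supported in a fixed ball.\<close>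

lemma cell_step_continuous_tendsto:
  fixes g :: "real ^ 'd::finite \<Rightarrow> real"
  assumes g: "continuous_on UNIV g" and supp: "\<And>x. R < norm x \<Longrightarrow> g x = 0" and ci: "cell_integrable g" and \<alpha>: "0 < \<alpha>"
  shows "((\<lambda>h. powr_mass \<alpha> (\<lambda>x. cell_step h g x - g x)) \<longlongrightarrow> 0) (at_right 0)"
proof (rule tendsto_ennreal_0I)
  fix e :: real assume e: "0 < e"
  define D where "D = real CARD('d)"
  have D: "1 \<le> D" by (simp add: D_def Suc_leI)
  define V where "V = measure lebesgue (cball (0 :: real ^ 'd) (R + D))"
  have V: "0 \<le> V" "emeasure lebesgue (cball (0 :: real ^ 'd) (R + D)) = ennreal V"
    using emeasure_lebesgue_cball_finite[of "0 :: real ^ 'd" "R + D"]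
    by (auto simp: V_def emeasure_eq_ennreal_measure less_top simp del: emeasure_completion)
  obtain \<eta> where \<eta>: "0 < \<eta>" and \<eta>V: "\<eta> powr \<alpha> * V \<le> e"
    using ex_powr_mult_le[OF V(1) e \<alpha>] by blast
  have "uniformly_continuous_on (cball 0 (R + 2 * D)) g"
    by (intro compact_uniformly_continuous continuous_on_subset[OF g]) auto
  then obtain \<delta> where \<delta>: "0 < \<delta>" "\<And>x y. norm x \<le> R + 2 * D \<Longrightarrow> norm y \<le> R + 2 * D \<Longrightarrow> norm (x - y) < \<delta> \<Longrightarrow> \<bar>g x - g y\<bar> < \<eta>"
    using \<eta> unfolding uniformly_continuous_on_def by (auto simp: dist_norm)
  have "\<forall>\<^sub>F h in at_right 0. 0 < h \<and> h < min 1 (\<delta> / D)"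
    using \<delta> D by (auto simp: eventually_at_right intro!: exI[of _ "min 1 (\<delta> / D)"])
  then show "\<forall>\<^sub>F h in at_right 0. powr_mass \<alpha> (\<lambda>x. cell_step h g x - g x) \<le> ennreal e"
  proof eventually_elim
    case (elim h)
    then have h: "0 < h" "h < 1" "D * h < \<delta>" using D by (auto simp: field_simps)
    have near: "norm (y - x) \<le> D * h" "D * h \<le> D" if "y \<in> cell h (cell_index h x)" for x y :: "real ^ 'd"
      using norm_cell_diff[OF h(1), of y "cell_index h x" x] that h D
      by (auto simp: mem_cell_iff_index D_def)
    have pw: "\<bar>cell_step h g x - g x\<bar> powr \<alpha> \<le> \<eta> powr \<alpha> * indicator (cball 0 (R + D)) x" for x
    proof (cases "norm x \<le> R + D")
      case True
      have si: "set_integrable lebesgue (cell h (cell_index h x)) (\<lambda>y. g y - g x)"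
        using ci h unfolding cell_integrable_def
        by (intro set_integral_diff set_integrable_cell_bounded[OF h(1) _ order_refl]) auto
      have "cell_step h g x - g x = cell_avg h (\<lambda>y. g y - g x) (cell_index h x)"
        using cell_avg_diff[OF h(1) ci cell_integrable_bounded[of "\<lambda>_. g x" "\<bar>g x\<bar>"]]
        by (simp add: cell_step_def cell_avg_const[OF h(1)])
      also have "\<bar>\<dots>\<bar> \<le> \<eta>"
      proof (rule abs_cell_avg_le[OF h(1) si])
        fix y assume "y \<in> cell h (cell_index h x)"
        note near[OF this]
        moreover have "norm y \<le> norm x + norm (y - x)" by (metis add.commute diff_add_cancel norm_triangle_ineq)
        ultimately show "\<bar>g y - g x\<bar> \<le> \<eta>" using True h D by - (rule less_imp_le, rule \<delta>(2), linarith+)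
      qed
      finally show ?thesis using True \<alpha> by (auto intro!: powr_mono2)
    next
      case False
      have "g y = 0" if "y \<in> cell h (cell_index h x)" for y
      proof (rule supp)
        have "norm x \<le> norm y + norm (y - x)" by (metis norm_minus_commute norm_triangle_sub)
        then show "R < norm y" using near[OF that] False by linarith
      qed
      then have "\<bar>cell_avg h g (cell_index h x)\<bar> \<le> 0"
        using ci h unfolding cell_integrable_def by (intro abs_cell_avg_le) auto
      moreover have "g x = 0" using False D by (intro supp) linarith
      ultimately show ?thesis by (simp add: cell_step_def)
    qed
    have "powr_mass \<alpha> (\<lambda>x. cell_step h g x - g x) \<le> (\<integral>\<^sup>+x. ennreal (\<eta> powr \<alpha>) * indicator (cball (0 :: real ^ 'd) (R + D)) x \<partial>lebesgue)"
      unfolding powr_mass_def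
    proof (rule nn_integral_mono)
      fix x show "ennreal (\<bar>cell_step h g x - g x\<bar> powr \<alpha>) \<le> ennreal (\<eta> powr \<alpha>) * indicator (cball 0 (R + D)) x"
        using ennreal_leI[OF pw[of x]] by (auto split: split_indicator)
    qed
    also have "\<dots> = ennreal (\<eta> powr \<alpha> * V)"
      using V by (subst nn_integral_cmult_indicator) (auto simp: ennreal_mult fmeasurableD simp del: emeasure_completion)
    also have "\<dots> \<le> ennreal e" using \<eta>V by (rule ennreal_leI)
    finally show ?case .
  qed
qed

lemma cell_integrable_L_space:
  fixes f :: "real ^ 'd::finite \<Rightarrow> real"
  assumes f: "f \<in> L_space \<alpha>" and \<alpha>: "1 \<le> \<alpha>"
  shows "cell_integrable f"
  unfolding cell_integrable_def
proof (intro allI impI)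
  fix h :: real and k :: "int ^ 'd" assume h: "0 < h"
  have [measurable]: "f \<in> borel_measurable lebesgue" and i: "integrable lebesgue (\<lambda>x. \<bar>f x\<bar> powr \<alpha>)"
    using f by (auto simp: L_space_def)
  have "set_integrable lebesgue (cell h k) (\<lambda>x. \<bar>f x\<bar> powr \<alpha>)"
    unfolding set_integrable_def by (rule integrable_mult_indicator) (use i h in auto)
  then have "set_integrable lebesgue (cell h k) (\<lambda>x. 1 + \<bar>f x\<bar> powr \<alpha>)"
    by (intro set_integral_add set_integrable_cell_bounded[OF h _ order_refl]) auto
  then show "set_integrable lebesgue (cell h k) f"
  proof (rule set_integrable_bound)
    show "set_borel_measurable lebesgue (cell h k) f"
      unfolding set_borel_measurable_def using h by measurable
    have "\<bar>f x\<bar> \<le> 1 + \<bar>f x\<bar> powr \<alpha>" for x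
    proof (cases "\<bar>f x\<bar> \<le> 1")
      case False
      then have "\<bar>f x\<bar> powr 1 \<le> \<bar>f x\<bar> powr \<alpha>" using \<alpha> by (intro powr_mono) auto
      with False show ?thesis by simp
    qed (simp add: add_increasing2)
    then show "AE x in lebesgue. x \<in> cell h k \<longrightarrow> norm (f x) \<le> norm (1 + \<bar>f x\<bar> powr \<alpha>)"
      by (intro AE_I2) (auto intro: order_trans)
  qed
qed

text \<open>Approximate \<open>f\<close> by a continuous \<open>g\<close>; since averaging is a contraction, the error \<open>f - g\<close> stays
  small after averaging, uniformly in \<open>h\<close>.\<close>

lemma cell_step_L_space_tendsto:
  fixes f :: "real ^ 'd::finite \<Rightarrow> real"
  assumes f: "f \<in> L_space \<alpha>" and \<alpha>: "1 \<le> \<alpha>"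
  shows "((\<lambda>h. powr_mass \<alpha> (\<lambda>x. cell_step h f x - f x)) \<longlongrightarrow> 0) (at_right 0)"
proof (rule tendsto_ennreal_0I)
  fix e :: real assume e: "0 < e"
  have [measurable]: "f \<in> borel_measurable lebesgue" and fin: "powr_mass \<alpha> f < \<infinity>"
    using f by (auto simp: L_space_iff)
  have fi: "cell_integrable f" by (rule cell_integrable_L_space[OF f \<alpha>])
  define K where "K = 2 powr \<alpha>"
  have K: "1 \<le> K" using \<alpha> by (simp add: K_def ge_one_powr_ge_zero)
  \<comment> \<open>The two applications of the quasi-triangle inequality multiply \<open>e'\<close> by this factor.\<close>
  define e' where "e' = e / (K * (1 + K * 2))"
  have e': "0 < e'" using e K by (simp add: e'_def)
  from powr_mass_approx_continuous[OF _ fin _ e'] \<alpha> obtain g B R where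
    g: "continuous_on UNIV g" "\<And>x. \<bar>g x\<bar> \<le> B" "\<And>x. R < norm x \<Longrightarrow> g x = 0"
    and fg: "powr_mass \<alpha> (\<lambda>x. f x - g x) \<le> ennreal e'" by auto
  have [measurable]: "g \<in> borel_measurable lebesgue"
    using borel_measurable_continuous_onI[OF g(1)] by (simp add: measurable_completion)
  have gi: "cell_integrable g" by (rule cell_integrable_bounded[OF _ g(2)]) simp
  have "\<forall>\<^sub>F h in at_right 0. powr_mass \<alpha> (\<lambda>x. cell_step h g x - g x) \<le> ennreal e'"
    using cell_step_continuous_tendsto[OF g(1,3) gi] \<alpha> e' by (intro tendsto_ennreal_0D) auto
  then show "\<forall>\<^sub>F h in at_right 0. powr_mass \<alpha> (\<lambda>x. cell_step h f x - f x) \<le> ennreal e"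
    using eventually_at_right_less[of 0]
  proof eventually_elim
    case (elim h)
    note h = \<open>0 < h\<close>
    have [measurable]: "cell_step h u \<in> borel_measurable lebesgue" for u :: "real ^ 'd \<Rightarrow> real"
      using h by (rule cell_step_measurable)
    have dm: "(\<lambda>x. f x - g x) \<in> borel_measurable lebesgue" by simp
    have "powr_mass \<alpha> (cell_step h (\<lambda>x. f x - g x)) \<le> powr_mass \<alpha> (\<lambda>x. f x - g x)"
      by (rule powr_mass_cell_step_le[OF h cell_integrable_diff[OF fi gi] \<alpha> dm])
    then have 1: "powr_mass \<alpha> (cell_step h (\<lambda>x. f x - g x)) \<le> ennreal e'" using fg by simp
    have "cell_step h f x - f x = cell_step h (\<lambda>x. f x - g x) x + ((cell_step h g x - g x) + (g x - f x))" for x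
      by (simp add: cell_step_def cell_avg_diff[OF h fi gi])
    then have "powr_mass \<alpha> (\<lambda>x. cell_step h f x - f x)
        = powr_mass \<alpha> (\<lambda>x. cell_step h (\<lambda>x. f x - g x) x + ((cell_step h g x - g x) + (g x - f x)))"
      by (intro arg_cong[where f = "powr_mass \<alpha>"] ext)
    also have "\<dots> \<le> ennreal K * (powr_mass \<alpha> (cell_step h (\<lambda>x. f x - g x))
        + powr_mass \<alpha> (\<lambda>x. (cell_step h g x - g x) + (g x - f x)))"
      unfolding K_def by (rule powr_mass_add_le) (use \<alpha> in auto)
    also have "\<dots> \<le> ennreal K * (ennreal e' + ennreal K * (ennreal e' + ennreal e'))"
    proof (intro mult_left_mono add_mono 1)
      have "powr_mass \<alpha> (\<lambda>x. (cell_step h g x - g x) + (g x - f x))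
          \<le> ennreal K * (powr_mass \<alpha> (\<lambda>x. cell_step h g x - g x) + powr_mass \<alpha> (\<lambda>x. g x - f x))"
        unfolding K_def by (rule powr_mass_add_le) (use \<alpha> in auto)
      also have "\<dots> \<le> ennreal K * (ennreal e' + ennreal e')"
        using elim(1) fg by (intro mult_left_mono add_mono) (auto simp: powr_mass_minus[of \<alpha> g f])
      finally show "powr_mass \<alpha> (\<lambda>x. (cell_step h g x - g x) + (g x - f x)) \<le> ennreal K * (ennreal e' + ennreal e')" .
    qed auto
    also have "\<dots> = ennreal (K * (e' + K * (e' + e')))"
      using K e' by (simp flip: ennreal_plus ennreal_mult)
    also have "K * (e' + K * (e' + e')) = e'* (K * (1 + K * 2))" by (simp add: algebra_simps)
    also have "\<dots> = e" using K by (simp add: e'_def)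
    finally show ?case .
  qed
qed

section \<open>Cell averages of decaying functions\<close>

text \<open>On the dyadic shell \<open>2\<^sup>n \<le> |x| < 2\<^sup>n\<^sup>+\<^sup>1\<close> the integrand is at most \<open>2\<close> to the power \<open>- n \<beta>\<close>,
  while the volume is of order \<open>2\<close> to the power \<open>n d\<close>; the resulting geometric series converges
  because \<open>\<beta> > d\<close>.\<close>

lemma nn_integral_tail_powr_finite:
  assumes \<beta>: "real DIM('a::euclidean_space) < \<beta>"
  shows "(\<integral>\<^sup>+x. ennreal (norm x powr (- \<beta>)) * indicator {x. 1 \<le> norm x} x \<partial>(lebesgue :: 'a measure)) < \<infinity>"
proof -
  let ?d = "DIM('a)"
  define V where "V = unit_ball_vol (real ?d)"
  have V: "0 \<le> V" by (simp add: V_def)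
  define q where "q = 2 powr (real ?d - \<beta>)"
  have q: "0 < q" "q < 1" using \<beta> by (auto simp: q_def powr_less_one)
  have pw: "ennreal (norm x powr (- \<beta>)) * indicator {x. 1 \<le> norm x} x
      \<le> (\<Sum>n. ennreal (2 powr (- real n * \<beta>)) * indicator (cball 0 (2 ^ Suc n)) x)" for x :: 'a
  proof (cases "1 \<le> norm x")
    case True
    define n where "n = nat \<lfloor>log 2 (norm x)\<rfloor>"
    have nx: "0 < norm x" using True by linarith
    have l0: "0 \<le> log 2 (norm x)" using True by (subst zero_le_log_cancel_iff) auto
    have "real n \<le> log 2 (norm x)" "log 2 (norm x) < real n + 1"
      using l0 unfolding n_def by linarith+
    then have "2 powr real n \<le> norm x" "norm x < 2 powr (real n + 1)"
      using le_log_iff[OF _ nx, of 2] log_less_iff[OF _ nx, of 2] by auto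
    then have n: "2 powr real n \<le> norm x" "norm x \<le> 2 ^ Suc n"
      by (auto simp: powr_add powr_realpow)
    have "norm x powr (- \<beta>) \<le> (2 powr real n) powr (- \<beta>)"
      using n \<beta> by (intro powr_mono2') auto
    then have "norm x powr (- \<beta>) \<le> 2 powr (- real n * \<beta>)" by (simp add: powr_powr)
    then have "ennreal (norm x powr (- \<beta>)) * indicator {x. 1 \<le> norm x} x
        \<le> ennreal (2 powr (- real n * \<beta>)) * indicator (cball 0 (2 ^ Suc n)) x"
      using n True by (auto intro: ennreal_leI)
    also have "\<dots> \<le> (\<Sum>n. ennreal (2 powr (- real n * \<beta>)) * indicator (cball 0 (2 ^ Suc n)) x)"
    proof -
      define t where "t m = (ennreal (2 powr (- real m * \<beta>)) * indicator (cball 0 (2 ^ Suc m)) x :: ennreal)" for m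
      have "sum t {n} \<le> suminf t" by (rule sum_le_suminf) auto
      then have "t n \<le> suminf t" by simp
      then show ?thesis by (simp only: t_def[abs_def])
    qed
    finally show ?thesis .
  qed auto
  have "(\<integral>\<^sup>+x. ennreal (norm x powr (- \<beta>)) * indicator {x. 1 \<le> norm x} x \<partial>(lebesgue :: 'a measure))
      \<le> (\<integral>\<^sup>+x. (\<Sum>n. ennreal (2 powr (- real n * \<beta>)) * indicator (cball 0 (2 ^ Suc n)) x) \<partial>(lebesgue :: 'a measure))"
    by (rule nn_integral_mono) (rule pw)
  also have "\<dots> = (\<Sum>n. \<integral>\<^sup>+x. ennreal (2 powr (- real n * \<beta>)) * indicator (cball 0 (2 ^ Suc n)) x \<partial>(lebesgue :: 'a measure))"
  proof (rule nn_integral_suminf)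
    show "(\<lambda>x. ennreal (2 powr (- real n * \<beta>)) * indicator (cball 0 (2 ^ Suc n)) x) \<in> borel_measurable (lebesgue :: 'a measure)" for n
      by measurable
  qed
  also have "\<dots> = (\<Sum>n. ennreal (V * 2 ^ ?d * q ^ n))"
  proof (rule suminf_cong)
    fix n
    have "(\<integral>\<^sup>+x. ennreal (2 powr (- real n * \<beta>)) * indicator (cball 0 (2 ^ Suc n)) x \<partial>(lebesgue :: 'a measure))
        = ennreal (2 powr (- real n * \<beta>)) * emeasure lebesgue (cball (0::'a) (2 ^ Suc n))"
      by (rule nn_integral_cmult_indicator) (rule fmeasurableD[OF lmeasurable_cball])
    also have "emeasure lebesgue (cball (0::'a) (2 ^ Suc n)) = ennreal (V * (2 ^ Suc n) ^ ?d)"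
      using fmeasurableD[OF lmeasurable_cball, of "0::'a" "2 ^ Suc n"]
      by (simp add: emeasure_cball V_def)
    also have "ennreal (2 powr (- real n * \<beta>)) * \<dots> = ennreal (2 powr (- real n * \<beta>) * (V * (2 ^ Suc n) ^ ?d))"
      using V by (simp add: ennreal_mult)
    also have "2 powr (- real n * \<beta>) * (V * (2 ^ Suc n) ^ ?d) = V * 2 ^ ?d * q ^ n"
    proof -
      have "((2::real) ^ Suc n) ^ ?d = 2 ^ ?d * 2 powr (real n * real ?d)"
        by (simp add: power_mult_distrib power_mult[symmetric] powr_realpow[symmetric] powr_powr mult.commute del: powr_realpow)
      moreover have "2 powr (- real n * \<beta>) * 2 powr (real n * real ?d) = q ^ n"
        by (simp add: q_def powr_realpow[symmetric] powr_powr algebra_simps flip: powr_add)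
      ultimately show ?thesis by (metis (no_types, lifting) mult.assoc mult.commute)
    qed
    finally show "(\<integral>\<^sup>+x. ennreal (2 powr (- real n * \<beta>)) * indicator (cball 0 (2 ^ Suc n)) x \<partial>(lebesgue :: 'a measure))
      = ennreal (V * 2 ^ ?d * q ^ n)" .
  qed
  also have "\<dots> < \<infinity>"
  proof -
    have "summable (\<lambda>n. V * 2 ^ ?d * q ^ n)" using q by (intro summable_mult summable_geometric) auto
    then have "(\<Sum>n. ennreal (V * 2 ^ ?d * q ^ n)) \<noteq> top"
      using V q by (intro ennreal_suminf_neq_top) auto
    then show ?thesis by (simp add: less_top)
  qed
  finally show ?thesis .
qed

lemma D_space_decay:
  fixes f :: "'a::euclidean_space \<Rightarrow> real"
  assumes "f \<in> D_space \<alpha>" and \<alpha>: "0 < \<alpha>"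
  obtains \<eta> R where "real DIM('a) < \<eta> * \<alpha>" "0 \<le> \<eta>" "1 \<le> R" "\<And>x. R \<le> norm x \<Longrightarrow> \<bar>f x\<bar> \<le> norm x powr (- \<eta>)"
proof -
  from assms obtain \<eta> where \<eta>: "real DIM('a) / \<alpha> < \<eta>" "f \<in> o[at_infinity](\<lambda>x. norm x powr (- \<eta>))"
    by (auto simp: D_space_def)
  from landau_o.smallD[OF \<eta>(2), of 1] obtain b where b: "\<And>x. b \<le> norm x \<Longrightarrow> \<bar>f x\<bar> \<le> norm x powr (- \<eta>)"
    by (auto simp: eventually_at_infinity)
  have "0 \<le> real DIM('a) / \<alpha>" using \<alpha> by simp
  then have "0 \<le> \<eta>" using \<eta>(1) by linarith
  moreover have "real DIM('a) < \<eta> * \<alpha>" using \<eta>(1) \<alpha> by (simp add: field_simps)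
  ultimately show ?thesis by (intro that[of \<eta> "max 1 b"]) (use b in auto)
qed

lemma powr_mass_decay_finite:
  fixes f :: "'a::euclidean_space \<Rightarrow> real"
  assumes \<gamma>: "0 < \<gamma>" and \<eta>: "real DIM('a) < \<eta> * \<gamma>" and C: "0 \<le> C" "1 \<le> R"
    and f [measurable]: "f \<in> borel_measurable lebesgue"
    and dec: "\<And>x. R \<le> norm x \<Longrightarrow> \<bar>f x\<bar> \<le> C * norm x powr (- \<eta>)"
    and loc: "(\<integral>\<^sup>+x. ennreal (\<bar>f x\<bar> powr \<gamma>) * indicator (cball 0 R) x \<partial>lebesgue) < \<infinity>"
  shows "powr_mass \<gamma> f < \<infinity>"
proof -
  have "powr_mass \<gamma> f \<le> (\<integral>\<^sup>+x. ennreal (\<bar>f x\<bar> powr \<gamma>) * indicator (cball 0 R) x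
      + ennreal (C powr \<gamma>) * (ennreal (norm x powr (- (\<eta> * \<gamma>))) * indicator {x. 1 \<le> norm x} x) \<partial>lebesgue)"
    unfolding powr_mass_def
  proof (rule nn_integral_mono)
    fix x :: 'a
    show "ennreal (\<bar>f x\<bar> powr \<gamma>) \<le> ennreal (\<bar>f x\<bar> powr \<gamma>) * indicator (cball 0 R) x
      + ennreal (C powr \<gamma>) * (ennreal (norm x powr (- (\<eta> * \<gamma>))) * indicator {x. 1 \<le> norm x} x)"
    proof (cases "norm x \<le> R")
      case False
      then have "\<bar>f x\<bar> powr \<gamma> \<le> (C * norm x powr (- \<eta>)) powr \<gamma>"
        using \<gamma> dec[of x] by (intro powr_mono2) auto
      also have "\<dots> = C powr \<gamma> * norm x powr (- (\<eta> * \<gamma>))"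
        using C by (simp add: powr_mult powr_powr)
      finally have "ennreal (\<bar>f x\<bar> powr \<gamma>) \<le> ennreal (C powr \<gamma>) * ennreal (norm x powr (- (\<eta> * \<gamma>)))"
        by (simp flip: ennreal_mult add: ennreal_leI)
      then show ?thesis using False C by simp
    qed simp
  qed
  also have "\<dots> = (\<integral>\<^sup>+x. ennreal (\<bar>f x\<bar> powr \<gamma>) * indicator (cball 0 R) x \<partial>lebesgue)
      + ennreal (C powr \<gamma>) * (\<integral>\<^sup>+x. ennreal (norm x powr (- (\<eta> * \<gamma>))) * indicator {x. 1 \<le> norm x} x \<partial>(lebesgue :: 'a measure))"
    by (simp add: nn_integral_add nn_integral_cmult)
  also have "\<dots> < \<infinity>"
    using loc nn_integral_tail_powr_finite[where 'a = 'a, OF \<eta>] by (simp add: ennreal_mult_less_top)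
  finally show ?thesis .
qed

lemma powr_le_one_plus:
  fixes y :: real
  assumes "0 \<le> y" "0 \<le> \<gamma>" "\<gamma> \<le> 1"
  shows "y powr \<gamma> \<le> 1 + y"
proof (cases "y \<le> 1")
  case True
  then have "y powr \<gamma> \<le> 1 powr \<gamma>" using assms by (intro powr_mono2) auto
  then show ?thesis using assms by simp
next
  case False
  then have "y powr \<gamma> \<le> y powr 1" using assms by (intro powr_mono) auto
  then show ?thesis using False by simp
qed

lemma nn_integral_cball_powr_finite:
  fixes f :: "'a::euclidean_space \<Rightarrow> real"
  assumes [measurable]: "f \<in> borel_measurable lebesgue" and \<gamma>: "0 \<le> \<gamma>" "\<gamma> \<le> 1"
    and fin: "(\<integral>\<^sup>+x. ennreal \<bar>f x\<bar> * indicator (cball 0 R) x \<partial>lebesgue) < \<infinity>"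
  shows "(\<integral>\<^sup>+x. ennreal (\<bar>f x\<bar> powr \<gamma>) * indicator (cball 0 R) x \<partial>lebesgue) < \<infinity>"
proof -
  have "(\<integral>\<^sup>+x. ennreal (\<bar>f x\<bar> powr \<gamma>) * indicator (cball 0 R) x \<partial>lebesgue)
      \<le> (\<integral>\<^sup>+x. indicator (cball 0 R) x + ennreal \<bar>f x\<bar> * indicator (cball 0 R) x \<partial>lebesgue)"
  proof (rule nn_integral_mono)
    fix x :: 'a
    have "ennreal (\<bar>f x\<bar> powr \<gamma>) \<le> 1 + ennreal \<bar>f x\<bar>"
      using ennreal_leI[OF powr_le_one_plus[of "\<bar>f x\<bar>" \<gamma>]] \<gamma> by (simp add: ennreal_plus)
    then show "ennreal (\<bar>f x\<bar> powr \<gamma>) * indicator (cball 0 R) x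
        \<le> indicator (cball 0 R) x + ennreal \<bar>f x\<bar> * indicator (cball 0 R) x"
      by (auto split: split_indicator)
  qed
  also have "\<dots> = emeasure lebesgue (cball (0::'a) R) + (\<integral>\<^sup>+x. ennreal \<bar>f x\<bar> * indicator (cball 0 R) x \<partial>lebesgue)"
    by (simp add: nn_integral_add del: emeasure_completion)
  also have "\<dots> < \<infinity>"
    using fin emeasure_lebesgue_cball_finite[of "0::'a" R] by simp
  finally show ?thesis .
qed

lemma D_space_measurable: "f \<in> D_space \<alpha> \<Longrightarrow> f \<in> borel_measurable lebesgue"
  by (simp add: D_space_def L1_loc_def)

lemma D_space_cball_finite:
  fixes f :: "'a::euclidean_space \<Rightarrow> real"
  assumes f: "f \<in> D_space \<alpha>"
  shows "(\<integral>\<^sup>+x. ennreal \<bar>f x\<bar> * indicator (cball 0 R) x \<partial>lebesgue) < \<infinity>"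
proof -
  have "set_integrable lebesgue (cball 0 R) f"
    using f by (auto simp: D_space_def L1_loc_def)
  then have "(\<integral>\<^sup>+x. ennreal (norm (indicat_real (cball 0 R) x *\<^sub>R f x)) \<partial>lebesgue) < \<infinity>"
    by (simp add: set_integrable_def integrable_iff_bounded)
  also have "(\<integral>\<^sup>+x. ennreal (norm (indicat_real (cball 0 R) x *\<^sub>R f x)) \<partial>lebesgue)
      = (\<integral>\<^sup>+x. ennreal \<bar>f x\<bar> * indicator (cball 0 R) x \<partial>lebesgue)"
    by (intro nn_integral_cong) (auto split: split_indicator)
  finally show ?thesis .
qed

text \<open>The decay makes \<open>|f|\<^sup>\<gamma>\<close> integrable at infinity for all \<open>\<gamma> \<ge> \<alpha>\<close>, and local integrability gives
  the rest for \<open>\<gamma> \<le> 1\<close>. The cases \<open>\<gamma> = \<alpha>\<close> and \<open>\<gamma> = 1\<close> are used.\<close>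

lemma D_space_powr_mass_finite:
  fixes f :: "'a::euclidean_space \<Rightarrow> real"
  assumes f: "f \<in> D_space \<alpha>" and \<alpha>: "0 < \<alpha>" "\<alpha> \<le> \<gamma>" "\<gamma> \<le> 1"
  shows "powr_mass \<gamma> f < \<infinity>"
proof -
  from D_space_decay[OF f \<alpha>(1)] obtain \<eta> R where \<eta>: "real DIM('a) < \<eta> * \<alpha>" "0 \<le> \<eta>" and R: "1 \<le> R"
    and dec: "\<And>x. R \<le> norm x \<Longrightarrow> \<bar>f x\<bar> \<le> norm x powr (- \<eta>)" by blast
  have "real DIM('a) < \<eta> * \<alpha>" by (rule \<eta>(1))
  also have "\<dots> \<le> \<eta> * \<gamma>"
    using \<alpha> \<eta>(2) by (intro mult_left_mono) auto
  finally have "real DIM('a) < \<eta> * \<gamma>" .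
  then show ?thesis
    by (rule powr_mass_decay_finite[where C = 1 and R = R, rotated])
      (use \<alpha> R dec D_space_measurable[OF f] D_space_cball_finite[OF f]
        nn_integral_cball_powr_finite[OF D_space_measurable[OF f]] in auto)
qed

lemma D_space_L_space:
  assumes "f \<in> D_space \<alpha>" "0 < \<alpha>" "\<alpha> < 1"
  shows "f \<in> L_space \<alpha>" "f \<in> L_space 1"
  using assms D_space_powr_mass_finite[OF assms(1)] D_space_measurable[OF assms(1)]
  by (auto simp: L_space_iff)

text \<open>If \<open>|x|\<close> is at least twice the diameter of its cell, then all points of the cell have norm at least
  \<open>|x| / 2\<close>, which costs the factor \<open>2\<close> to the power \<open>\<eta>\<close>.\<close>

lemma cell_step_decay:
  fixes f :: "real ^ 'd::finite \<Rightarrow> real"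
  assumes h: "0 < h" and f: "cell_integrable f" and \<eta>: "0 \<le> \<eta>" and R: "1 \<le> R"
    and dec: "\<And>x. R \<le> norm x \<Longrightarrow> \<bar>f x\<bar> \<le> norm x powr (- \<eta>)"
    and x: "2 * R \<le> norm x" "2 * (real CARD('d) * h) \<le> norm x"
  shows "\<bar>cell_step h f x\<bar> \<le> 2 powr \<eta> * norm x powr (- \<eta>)"
  unfolding cell_step_def
proof (rule abs_cell_avg_le[OF h])
  show "set_integrable lebesgue (cell h (cell_index h x)) f"
    using f h by (simp add: cell_integrable_def)
  fix y assume y: "y \<in> cell h (cell_index h x)"
  have "norm (y - x) \<le> real CARD('d) * h"
    using norm_cell_diff[OF h y, of x] by (simp add: mem_cell_iff_index[OF h])
  moreover have "norm x \<le> norm y + norm (y - x)" by (metis norm_minus_commute norm_triangle_sub)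
  ultimately have ny: "norm x / 2 \<le> norm y" using x by linarith
  then have "R \<le> norm y" using x by linarith
  then have "\<bar>f y\<bar> \<le> norm y powr (- \<eta>)" by (rule dec)
  also have "\<dots> \<le> (norm x / 2) powr (- \<eta>)"
    using ny x R \<eta> by (intro powr_mono2') auto
  also have "\<dots> = 2 powr \<eta> * norm x powr (- \<eta>)"
    by (simp add: powr_divide powr_minus field_simps)
  finally show "\<bar>f y\<bar> \<le> 2 powr \<eta> * norm x powr (- \<eta>)" .
qed

lemma D_space_cell_step_finite:
  fixes f :: "real ^ 'd::finite \<Rightarrow> real"
  assumes f: "f \<in> D_space \<alpha>" and \<alpha>: "0 < \<alpha>" "\<alpha> < 1" and h: "0 < h"
  shows "powr_mass \<alpha> (cell_step h f) < \<infinity>"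
proof -
  from D_space_decay[OF f \<alpha>(1)] obtain \<eta> R where \<beta>: "real DIM(real ^ 'd) < \<eta> * \<alpha>" and \<eta>0: "0 \<le> \<eta>" and R: "1 \<le> R"
    and dec: "\<And>x. R \<le> norm x \<Longrightarrow> \<bar>f x\<bar> \<le> norm x powr (- \<eta>)" by blast
  have ci: "cell_integrable f" by (rule cell_integrable_L_space[OF D_space_L_space(2)[OF f \<alpha>]]) simp
  have [measurable]: "cell_step h f \<in> borel_measurable lebesgue" "f \<in> borel_measurable lebesgue"
    using h D_space_measurable[OF f] by auto
  define R' where "R' = max (2 * R) (2 * (real CARD('d) * h))"
  have dec': "\<bar>cell_step h f x\<bar> \<le> 2 powr \<eta> * norm x powr (- \<eta>)" if "R' \<le> norm x" for x
    using that by (intro cell_step_decay[OF h ci \<eta>0 R dec]) (auto simp: R'_def)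
  have "powr_mass 1 (cell_step h f) \<le> powr_mass 1 f"
    by (rule powr_mass_cell_step_le[OF h ci]) auto
  also have "\<dots> < \<infinity>" using D_space_powr_mass_finite[OF f, of 1] \<alpha> by simp
  finally have fin: "(\<integral>\<^sup>+x. ennreal \<bar>cell_step h f x\<bar> \<partial>lebesgue) < \<infinity>"
    by (simp add: powr_mass_def)
  have "(\<integral>\<^sup>+x. ennreal \<bar>cell_step h f x\<bar> * indicator (cball 0 R') x \<partial>lebesgue)
      \<le> (\<integral>\<^sup>+x. ennreal \<bar>cell_step h f x\<bar> \<partial>lebesgue)"
    by (intro nn_integral_mono) (auto split: split_indicator)
  with fin have fin': "(\<integral>\<^sup>+x. ennreal \<bar>cell_step h f x\<bar> * indicator (cball 0 R') x \<partial>lebesgue) < \<infinity>"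
    by (rule order.strict_trans1[rotated])
  from \<beta> show ?thesis
  proof (rule powr_mass_decay_finite[OF \<alpha>(1) _ _ _ _ dec'])
    show "1 \<le> R'" using R by (simp add: R'_def)
    show "(\<integral>\<^sup>+x. ennreal (\<bar>cell_step h f x\<bar> powr \<alpha>) * indicator (cball 0 R') x \<partial>lebesgue) < \<infinity>"
      by (rule nn_integral_cball_powr_finite) (use fin' \<alpha> in auto)
  qed auto
qed

lemma nn_integral_tail_tendsto_0:
  assumes \<beta>: "real DIM('a::euclidean_space) < \<beta>"
  shows "(\<lambda>n. \<integral>\<^sup>+x. ennreal (norm x powr (- \<beta>)) * indicator {x. real (Suc n) \<le> norm x} x \<partial>(lebesgue :: 'a measure)) \<longlonglongrightarrow> 0"
proof -
  have "(\<lambda>n. \<integral>\<^sup>+x. ennreal (norm x powr (- \<beta>)) * indicator {x. real (Suc n) \<le> norm x} x \<partial>(lebesgue :: 'a measure))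
      \<longlonglongrightarrow> (\<integral>\<^sup>+x. 0 \<partial>(lebesgue :: 'a measure))"
  proof (rule nn_integral_dominated_convergence[where w = "\<lambda>x. ennreal (norm x powr (- \<beta>)) * indicator {x. 1 \<le> norm x} x"])
    show "(\<integral>\<^sup>+x. ennreal (norm x powr (- \<beta>)) * indicator {x. 1 \<le> norm x} x \<partial>(lebesgue :: 'a measure)) < \<infinity>"
      by (rule nn_integral_tail_powr_finite[OF \<beta>])
    show "AE x::'a in lebesgue. ennreal (norm x powr (- \<beta>)) * indicator {x. real (Suc n) \<le> norm x} x
      \<le> ennreal (norm x powr (- \<beta>)) * indicator {x. 1 \<le> norm x} x" for n
      by (intro AE_I2) (auto split: split_indicator)
    show "AE x::'a in lebesgue. (\<lambda>n. ennreal (norm x powr (- \<beta>)) * indicator {x. real (Suc n) \<le> norm x} x) \<longlonglongrightarrow> 0"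
    proof (rule AE_I2, rule tendsto_eventually)
      fix x :: 'a
      obtain m :: nat where "norm x \<le> real m" using real_arch_simple by blast
      then have "\<not> real (Suc n) \<le> norm x" if "m \<le> n" for n using that by simp
      then show "\<forall>\<^sub>F n in sequentially. ennreal (norm x powr (- \<beta>)) * indicator {x. real (Suc n) \<le> norm x} x = 0"
        unfolding eventually_sequentially by (intro exI[of _ m]) (simp add: indicator_def)
    qed
  qed measurable
  then show ?thesis by simp
qed

text \<open>Trades an exponent below \<open>1\<close> for the exponent \<open>1\<close>: where \<open>u \<le> \<delta>\<close> the first term suffices, where
  \<open>u > \<delta>\<close> the second.\<close>

lemma powr_le_split:
  fixes u \<delta> :: real
  assumes "0 \<le> u" "0 < \<delta>" "0 < \<alpha>" "\<alpha> < 1"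
  shows "u powr \<alpha> \<le> \<delta> powr \<alpha> + \<delta> powr (\<alpha> - 1) * u"
proof (cases "u \<le> \<delta>")
  case True
  then have "u powr \<alpha> \<le> \<delta> powr \<alpha>" using assms by (intro powr_mono2) auto
  then show ?thesis using assms by (simp add: add_increasing2)
next
  case False
  then have "u powr \<alpha> = u powr (\<alpha> - 1) * u" using powr_mult_base[of u "\<alpha> - 1"] assms by (simp add: mult.commute)
  also have "\<dots> \<le> \<delta> powr (\<alpha> - 1) * u"
    using assms False by (intro mult_right_mono powr_mono2') auto
  finally show ?thesis by (simp add: add_increasing)
qed

text \<open>Outside a large ball both \<open>f\<close> and its averages are dominated by the integrable tail; inside it
  \<open>powr_le_split\<close> reduces the claim to convergence in the mean, which is the case of exponent
  \<open>1\<close>.\<close>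

lemma cell_step_D_space_tendsto:
  fixes f :: "real ^ 'd::finite \<Rightarrow> real"
  assumes f: "f \<in> D_space \<alpha>" and \<alpha>: "0 < \<alpha>" "\<alpha> < 1"
  shows "((\<lambda>h. powr_mass \<alpha> (\<lambda>x. cell_step h f x - f x)) \<longlongrightarrow> 0) (at_right 0)"
proof (rule tendsto_ennreal_0I)
  fix e :: real assume e: "0 < e"
  from D_space_decay[OF f \<alpha>(1)] obtain \<eta> R where \<beta>: "real DIM(real ^ 'd) < \<eta> * \<alpha>" and \<eta>0: "0 \<le> \<eta>" and R: "1 \<le> R"
    and dec: "\<And>x. R \<le> norm x \<Longrightarrow> \<bar>f x\<bar> \<le> norm x powr (- \<eta>)" by blast
  have [measurable]: "f \<in> borel_measurable lebesgue" by (rule D_space_measurable[OF f])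
  have L1: "f \<in> L_space 1" by (rule D_space_L_space(2)[OF f \<alpha>])
  have ci: "cell_integrable f" by (rule cell_integrable_L_space[OF L1]) simp
  define D where "D = real CARD('d)"
  define C where "C = 1 + 2 powr \<eta>"
  have C: "1 \<le> C" by (simp add: C_def)
  let ?tail = "\<lambda>T. \<integral>\<^sup>+x. ennreal (norm x powr (- (\<eta> * \<alpha>))) * indicator {x. T \<le> norm x} x \<partial>(lebesgue :: (real ^ 'd) measure)"
  have e1: "0 < e / (3 * C powr \<alpha>)" using e C by simp
  have "\<forall>\<^sub>F n in sequentially. ?tail (real (Suc n)) \<le> ennreal (e / (3 * C powr \<alpha>)) \<and> max (2 * R) (2 * D) \<le> real (Suc n)"
  proof (rule eventually_conj)
    show "\<forall>\<^sub>F n in sequentially. ?tail (real (Suc n)) \<le> ennreal (e / (3 * C powr \<alpha>))"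
      by (rule tendsto_ennreal_0D[OF nn_integral_tail_tendsto_0[OF \<beta>] e1])
    obtain m :: nat where "max (2 * R) (2 * D) \<le> real m" using real_arch_simple by blast
    then have "max (2 * R) (2 * D) \<le> real (Suc n)" if "m \<le> n" for n using that by linarith
    then show "\<forall>\<^sub>F n in sequentially. max (2 * R) (2 * D) \<le> real (Suc n)"
      unfolding eventually_sequentially by blast
  qed
  \<comment> \<open>Beyond \<open>2 D\<close> the norm is at least twice the diameter of any cell of side below \<open>1\<close>.\<close>
  then obtain T where T: "?tail T \<le> ennreal (e / (3 * C powr \<alpha>))" "2 * R \<le> T" "2 * D \<le> T"
    using eventually_happens by fastforce
  define V where "V = measure lebesgue (cball (0 :: real ^ 'd) T)"
  have V: "0 \<le> V" "emeasure lebesgue (cball (0 :: real ^ 'd) T) = ennreal V"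
    using emeasure_lebesgue_cball_finite[of "0 :: real ^ 'd" T]
    by (auto simp: V_def emeasure_eq_ennreal_measure less_top simp del: emeasure_completion)
  have e3: "0 < e / 3" using e by simp
  obtain \<delta> where \<delta>: "0 < \<delta>" and \<delta>V: "\<delta> powr \<alpha> * V \<le> e / 3"
    using ex_powr_mult_le[OF V(1) e3 \<alpha>(1)] by blast
  have e2: "0 < e / (3 * \<delta> powr (\<alpha> - 1))" using e \<delta> by simp
  have "\<forall>\<^sub>F h in at_right 0. powr_mass 1 (\<lambda>x. cell_step h f x - f x) \<le> ennreal (e / (3 * \<delta> powr (\<alpha> - 1)))"
    by (rule tendsto_ennreal_0D[OF cell_step_L_space_tendsto[OF L1] e2]) simp
  moreover have "\<forall>\<^sub>F h in at_right 0. 0 < h \<and> h < (1::real)"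
    by (auto simp: eventually_at_right_field intro!: exI[of _ 1])
  ultimately show "\<forall>\<^sub>F h in at_right 0. powr_mass \<alpha> (\<lambda>x. cell_step h f x - f x) \<le> ennreal e"
  proof eventually_elim
    case (elim h)
    then have h: "0 < h" by simp
    define u where "u x = cell_step h f x - f x" for x
    have [measurable]: "u \<in> borel_measurable lebesgue" unfolding u_def using h by measurable
    have far: "\<bar>u x\<bar> \<le> C * norm x powr (- \<eta>)" if "T \<le> norm x" for x
    proof -
      have "2 * (real CARD('d) * h) \<le> 2 * D" using elim by (simp add: D_def mult_left_le)
      then have "\<bar>cell_step h f x\<bar> \<le> 2 powr \<eta> * norm x powr (- \<eta>)"
        using that T by (intro cell_step_decay[OF h ci \<eta>0 R dec]) linarith+
      moreover have "\<bar>f x\<bar> \<le> norm x powr (- \<eta>)" using that T R by (intro dec) linarith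
      ultimately show ?thesis by (simp add: u_def C_def algebra_simps)
    qed
    have "powr_mass \<alpha> u \<le> (\<integral>\<^sup>+x. (ennreal (\<delta> powr \<alpha>) * indicator (cball 0 T) x
        + ennreal (\<delta> powr (\<alpha> - 1)) * ennreal (\<bar>u x\<bar> powr 1))
        + ennreal (C powr \<alpha>) * (ennreal (norm x powr (- (\<eta> * \<alpha>))) * indicator {x. T \<le> norm x} x) \<partial>lebesgue)"
      unfolding powr_mass_def
    proof (rule nn_integral_mono)
      fix x :: "real ^ 'd"
      show "ennreal (\<bar>u x\<bar> powr \<alpha>) \<le> (ennreal (\<delta> powr \<alpha>) * indicator (cball 0 T) x
        + ennreal (\<delta> powr (\<alpha> - 1)) * ennreal (\<bar>u x\<bar> powr 1))
        + ennreal (C powr \<alpha>) * (ennreal (norm x powr (- (\<eta> * \<alpha>))) * indicator {x. T \<le> norm x} x)"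
      proof (cases "norm x \<le> T")
        case True
        have "ennreal (\<bar>u x\<bar> powr \<alpha>) \<le> ennreal (\<delta> powr \<alpha> + \<delta> powr (\<alpha> - 1) * \<bar>u x\<bar>)"
          by (intro ennreal_leI powr_le_split) (use \<delta> \<alpha> in auto)
        also have "\<dots> = ennreal (\<delta> powr \<alpha>) * indicator (cball 0 T) x
            + ennreal (\<delta> powr (\<alpha> - 1)) * ennreal (\<bar>u x\<bar> powr 1)"
          using True by (simp add: ennreal_plus ennreal_mult)
        finally show ?thesis by (rule order_trans) simp
      next
        case False
        then have "\<bar>u x\<bar> powr \<alpha> \<le> (C * norm x powr (- \<eta>)) powr \<alpha>"
          using \<alpha> far[of x] by (intro powr_mono2) auto
        also have "\<dots> = C powr \<alpha> * norm x powr (- (\<eta> * \<alpha>))"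
          using C by (simp add: powr_mult powr_powr)
        finally have "ennreal (\<bar>u x\<bar> powr \<alpha>) \<le> ennreal (C powr \<alpha>) * (ennreal (norm x powr (- (\<eta> * \<alpha>))) * indicator {x. T \<le> norm x} x)"
          using False by (simp flip: ennreal_mult add: ennreal_leI)
        then show ?thesis by (rule order_trans) simp
      qed
    qed
    also have "\<dots> = ennreal (\<delta> powr \<alpha>) * ennreal V + ennreal (\<delta> powr (\<alpha> - 1)) * powr_mass 1 u + ennreal (C powr \<alpha>) * ?tail T"
      by (simp add: nn_integral_add nn_integral_cmult nn_integral_cmult_indicator V powr_mass_def del: emeasure_completion)
    also have "\<dots> \<le> ennreal (e / 3) + ennreal (\<delta> powr (\<alpha> - 1)) * ennreal (e / (3 * \<delta> powr (\<alpha> - 1)))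
        + ennreal (C powr \<alpha>) * ennreal (e / (3 * C powr \<alpha>))"
    proof (intro add_mono mult_left_mono T(1))
      show "ennreal (\<delta> powr \<alpha>) * ennreal V \<le> ennreal (e / 3)"
        using \<delta>V V by (simp flip: ennreal_mult add: ennreal_leI)
      show "powr_mass 1 u \<le> ennreal (e / (3 * \<delta> powr (\<alpha> - 1)))"
        using elim(1) by (simp add: u_def[abs_def])
    qed auto
    also have "\<dots> = ennreal e"
    proof -
      have "ennreal (\<delta> powr (\<alpha> - 1)) * ennreal (e / (3 * \<delta> powr (\<alpha> - 1))) = ennreal (e / 3)"
        using \<delta> e by (simp flip: ennreal_mult)
      moreover have "ennreal (C powr \<alpha>) * ennreal (e / (3 * C powr \<alpha>)) = ennreal (e / 3)"
        using C e by (simp flip: ennreal_mult)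
      ultimately show ?thesis using e by (simp flip: ennreal_plus)
    qed
    finally show ?case by (simp add: u_def[abs_def])
  qed
qed

lemma F_space_L_space:
  assumes "f \<in> F_space \<alpha>" "0 < \<alpha>"
  shows "f \<in> L_space \<alpha>"
  using assms D_space_L_space(1)[of f \<alpha>] by (auto simp: F_space_def split: if_splits)

lemma F_space_measurable:
  "f \<in> F_space \<alpha> \<Longrightarrow> f \<in> borel_measurable lebesgue"
  by (auto simp: F_space_def L_space_def D_space_def L1_loc_def split: if_splits)

lemma F_space_cell_integrable:
  fixes f :: "real ^ 'd::finite \<Rightarrow> real"
  assumes "f \<in> F_space \<alpha>" "0 < \<alpha>"
  shows "cell_integrable f"
  using assms cell_integrable_L_space[of f \<alpha>] cell_integrable_L_space[OF D_space_L_space(2), of f \<alpha>]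
  by (auto simp: F_space_def split: if_splits)

lemma F_space_cell_step_finite:
  fixes f :: "real ^ 'd::finite \<Rightarrow> real"
  assumes f: "f \<in> F_space \<alpha>" "0 < \<alpha>" and h: "0 < h"
  shows "powr_mass \<alpha> (cell_step h f) < \<infinity>"
proof (cases "1 \<le> \<alpha>")
  case True
  have "powr_mass \<alpha> (cell_step h f) \<le> powr_mass \<alpha> f"
    by (rule powr_mass_cell_step_le[OF h F_space_cell_integrable[OF f] True F_space_measurable[OF f(1)]])
  also have "\<dots> < \<infinity>" using F_space_L_space[OF f] by (simp add: L_space_iff)
  finally show ?thesis .
next
  case False
  then show ?thesis using f h by (intro D_space_cell_step_finite) (auto simp: F_space_def)
qed

lemma F_space_cell_step_tendsto:
  fixes f :: "real ^ 'd::finite \<Rightarrow> real"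
  assumes "f \<in> F_space \<alpha>" "0 < \<alpha>"
  shows "((\<lambda>h. powr_mass \<alpha> (\<lambda>x. cell_step h f x - f x)) \<longlongrightarrow> 0) (at_right 0)"
  using assms cell_step_L_space_tendsto[of f \<alpha>] cell_step_D_space_tendsto[of f \<alpha>]
  by (auto simp: F_space_def split: if_splits)

lemma L_space_lincomb:
  assumes "f \<in> L_space \<alpha>" "g \<in> L_space \<alpha>" "0 < \<alpha>"
  shows "(\<lambda>x. a * f x + b * g x) \<in> L_space \<alpha>"
proof -
  have [measurable]: "f \<in> borel_measurable lebesgue" "g \<in> borel_measurable lebesgue"
    using assms by (auto simp: L_space_iff)
  have "powr_mass \<alpha> (\<lambda>x. a * f x + b * g x)
      \<le> ennreal (2 powr \<alpha>) * (powr_mass \<alpha> (\<lambda>x. a * f x) + powr_mass \<alpha> (\<lambda>x. b * g x))"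
    by (rule powr_mass_add_le) (use assms in auto)
  also have "\<dots> < \<infinity>"
    using assms by (auto simp: powr_mass_cmult L_space_iff ennreal_mult_less_top)
  finally show ?thesis by (simp add: L_space_iff)
qed

lemma D_space_lincomb:
  fixes f g :: "'a::euclidean_space \<Rightarrow> real"
  assumes "f \<in> D_space \<alpha>" "g \<in> D_space \<alpha>"
  shows "(\<lambda>x. a * f x + b * g x) \<in> D_space \<alpha>"
proof -
  from assms obtain \<eta>1 \<eta>2 where \<eta>: "real DIM('a) / \<alpha> < \<eta>1" "f \<in> o[at_infinity](\<lambda>x. norm x powr (- \<eta>1))"
    "real DIM('a) / \<alpha> < \<eta>2" "g \<in> o[at_infinity](\<lambda>x. norm x powr (- \<eta>2))"
    by (auto simp: D_space_def)
  define \<eta> where "\<eta> = min \<eta>1 \<eta>2"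
  have big: "(\<lambda>x::'a. norm x powr (- s)) \<in> O[at_infinity](\<lambda>x. norm x powr (- \<eta>))" if "\<eta> \<le> s" for s
  proof (rule bigoI[where c = 1])
    have "\<forall>\<^sub>F x::'a in at_infinity. 1 \<le> norm x" by (auto simp: eventually_at_infinity)
    then show "\<forall>\<^sub>F x::'a in at_infinity. norm (norm x powr (- s)) \<le> 1 * norm (norm x powr (- \<eta>))"
      by eventually_elim (use that in \<open>auto intro!: powr_mono\<close>)
  qed
  have "f \<in> o[at_infinity](\<lambda>x. norm x powr (- \<eta>))" "g \<in> o[at_infinity](\<lambda>x. norm x powr (- \<eta>))"
    using landau_o.small_big_trans[OF \<eta>(2) big] landau_o.small_big_trans[OF \<eta>(4) big] by (auto simp: \<eta>_def)
  then have "(\<lambda>x. a * f x + b * g x) \<in> o[at_infinity](\<lambda>x. norm x powr (- \<eta>))"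
    by (intro sum_in_smallo) (cases "a = 0"; cases "b = 0"; simp)+
  moreover have "(\<lambda>x. a * f x + b * g x) \<in> L1_loc"
    using assms unfolding D_space_def L1_loc_def
    by (auto intro!: set_integral_add set_integrable_mult_right)
  ultimately show ?thesis using \<eta> by (auto simp: D_space_def \<eta>_def intro!: exI[of _ "min \<eta>1 \<eta>2"])
qed

lemma F_space_lincomb:
  assumes "f \<in> F_space \<alpha>" "g \<in> F_space \<alpha>" "0 < \<alpha>"
  shows "(\<lambda>x. a * f x + b * g x) \<in> F_space \<alpha>"
  using assms L_space_lincomb[of f \<alpha> g a b] D_space_lincomb[of f \<alpha> g a b]
  by (auto simp: F_space_def split: if_splits)

section \<open>Characteristic functions in the normal domain of attraction\<close>

text \<open>The negative logarithm of the characteristic function of \<open>S\<^sub>\<alpha>(1, \<nu>)\<close>. It is homogeneous of degree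
  \<open>\<alpha>\<close> under positive scaling, which absorbs both \<open>\<sigma>\<close> and the scaling of the grid.\<close>

definition stable_exponent :: "real \<Rightarrow> real \<Rightarrow> real \<Rightarrow> complex" where
  "stable_exponent \<alpha> \<nu> y =
     of_real (\<bar>y\<bar> powr \<alpha>) * (1 - \<i> * of_real (\<nu> * sgn y * tan (pi * \<alpha> / 2)))"

lemma stable_exponent_scale:
  assumes "0 \<le> c"
  shows "stable_exponent \<alpha> \<nu> (c * y) = of_real (c powr \<alpha>) * stable_exponent \<alpha> \<nu> y"
  using assms by (cases "c = 0") (auto simp: stable_exponent_def abs_mult powr_mult sgn_mult)

lemma stable_exponent_0 [simp]: "stable_exponent \<alpha> \<nu> 0 = 0"
  by (simp add: stable_exponent_def)

lemma norm_stable_exponent_le: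
  "cmod (stable_exponent \<alpha> \<nu> y) \<le> (1 + \<bar>\<nu> * tan (pi * \<alpha> / 2)\<bar>) * \<bar>y\<bar> powr \<alpha>"
proof -
  have "cmod (1 - \<i> * of_real (\<nu> * sgn y * tan (pi * \<alpha> / 2))) \<le> 1 + \<bar>\<nu> * sgn y * tan (pi * \<alpha> / 2)\<bar>"
    by (rule order_trans[OF norm_triangle_ineq4]) (simp add: norm_mult abs_mult)
  also have "\<dots> \<le> 1 + \<bar>\<nu> * tan (pi * \<alpha> / 2)\<bar>"
    by (cases "y = 0") (auto simp: abs_mult sgn_if)
  finally have "\<bar>y\<bar> powr \<alpha> * cmod (1 - \<i> * of_real (\<nu> * sgn y * tan (pi * \<alpha> / 2)))
      \<le> \<bar>y\<bar> powr \<alpha> * (1 + \<bar>\<nu> * tan (pi * \<alpha> / 2)\<bar>)"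
    by (intro mult_left_mono) auto
  then show ?thesis
    by (simp add: stable_exponent_def norm_mult mult.commute)
qed

lemma Re_stable_exponent: "Re (stable_exponent \<alpha> \<nu> y) = \<bar>y\<bar> powr \<alpha>"
  by (simp add: stable_exponent_def)

text \<open>In this form the continuity at \<open>0\<close>, where \<open>sgn\<close> jumps, is visible.\<close>

lemma stable_exponent_alt:
  "stable_exponent \<alpha> \<nu> y =
     of_real (\<bar>y\<bar> powr \<alpha>) - \<i> * of_real (\<nu> * tan (pi * \<alpha> / 2) * (max 0 y powr \<alpha> - max 0 (- y) powr \<alpha>))"
  by (cases "y = 0"; cases "y > 0") (auto simp: stable_exponent_def max_def sgn_if algebra_simps)

lemma continuous_on_stable_exponent:
  assumes "0 < \<alpha>"
  shows "continuous_on A (stable_exponent \<alpha> \<nu>)"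
  unfolding stable_exponent_alt[abs_def]
  by (intro continuous_intros continuous_on_powr') (use assms in auto)

lemma borel_measurable_stable_exponent [measurable]:
  "stable_exponent \<alpha> \<nu> \<in> borel_measurable borel"
  unfolding stable_exponent_def[abs_def] by measurable

text \<open>Realise the weak convergence by variables that converge pointwise (Skorohod). The difference of
  the characteristic functions is then bounded, uniformly in \<open>|t| \<le> 1\<close>, by the expectation of
  \<open>min 2 |Y\<^sub>n - Y|\<close>, which tends to \<open>0\<close> by dominated convergence.\<close>

lemma char_uniform_limit:
  assumes \<rho>: "\<And>n. real_distribution (\<rho> n)" and S: "real_distribution S" and w: "weak_conv_m \<rho> S"
  shows "uniform_limit {-1..1} (\<lambda>n. char (\<rho> n)) (char S) sequentially"
proof -
  from Skorohod[OF \<rho> S w] obtain Om Ys and Y :: "real \<Rightarrow> real" where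
    Om: "prob_space Om" and Ys[measurable]: "\<And>n. Ys n \<in> borel_measurable Om"
    and dYs: "\<And>n. distr Om borel (Ys n) = \<rho> n" and Y[measurable]: "Y \<in> borel_measurable Om"
    and dY: "distr Om borel Y = S" and lim: "\<And>x. x \<in> space Om \<Longrightarrow> (\<lambda>n. Ys n x) \<longlonglongrightarrow> Y x"
    by force
  interpret prob_space Om by fact
  have "(\<lambda>n. LINT x|Om. min 2 \<bar>Ys n x - Y x\<bar>) \<longlonglongrightarrow> (LINT x|Om. 0)"
  proof (rule integral_dominated_convergence[where w = "\<lambda>_. 2"])
    show "AE x in Om. (\<lambda>n. min 2 \<bar>Ys n x - Y x\<bar>) \<longlonglongrightarrow> 0"
    proof (rule AE_I2)
      fix x assume "x \<in> space Om"
      from lim[OF this] have "(\<lambda>n. \<bar>Ys n x - Y x\<bar>) \<longlonglongrightarrow> 0"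
        by (simp add: LIM_zero_iff tendsto_rabs_zero)
      then have "(\<lambda>n. min 2 \<bar>Ys n x - Y x\<bar>) \<longlonglongrightarrow> min 2 0"
        by (intro tendsto_min tendsto_const)
      then show "(\<lambda>n. min 2 \<bar>Ys n x - Y x\<bar>) \<longlonglongrightarrow> 0" by simp
    qed
  qed auto
  then have D: "(\<lambda>n. LINT x|Om. min 2 \<bar>Ys n x - Y x\<bar>) \<longlonglongrightarrow> 0" by simp
  have le: "cmod (char (\<rho> n) t - char S t) \<le> (LINT x|Om. min 2 \<bar>Ys n x - Y x\<bar>)" if t: "t \<in> {-1..1}" for n t
  proof -
    have pw: "cmod (iexp (t * a) - iexp (t * b)) \<le> min 2 \<bar>a - b\<bar>" for a b
    proof -
      have "cmod (iexp (t * a) - iexp (t * b)) \<le> 2"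
        by (rule order_trans[OF norm_triangle_ineq4]) simp
      moreover have "cmod (iexp (t * a) - iexp (t * b)) \<le> \<bar>a - b\<bar>"
      proof -
        have "iexp (t * a) - iexp (t * b) = iexp (t * b) * (iexp (t * (a - b)) - 1)"
          by (simp add: right_diff_distrib exp_diff exp_minus field_simps)
        then have "cmod (iexp (t * a) - iexp (t * b)) = cmod (iexp (t * (a - b)) - 1)"
          by (simp add: norm_mult)
        also have "\<dots> \<le> \<bar>t * (a - b)\<bar>"
          using iexp_approx1[of "t * (a - b)" 0] by simp
        also have "\<dots> \<le> 1 * \<bar>a - b\<bar>"
          unfolding abs_mult using t by (intro mult_right_mono) auto
        finally show ?thesis by simp
      qed
      ultimately show ?thesis by simp
    qed
    have "char (\<rho> n) t - char S t = (CLINT x|Om. iexp (t * Ys n x) - iexp (t * Y x))"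
      unfolding char_def dYs[symmetric] dY[symmetric]
      by (subst (1 2) integral_distr) (auto intro!: Bochner_Integration.integral_diff[symmetric] integrable_iexp)
    also have "cmod \<dots> \<le> (LINT x|Om. min 2 \<bar>Ys n x - Y x\<bar>)"
    proof (rule order_trans[OF integral_norm_bound], rule integral_mono)
      show "integrable Om (\<lambda>x. cmod (iexp (t * Ys n x) - iexp (t * Y x)))"
        by (intro integrable_norm Bochner_Integration.integrable_diff integrable_iexp) auto
      show "integrable Om (\<lambda>x. min 2 \<bar>Ys n x - Y x\<bar>)"
        by (rule integrable_const_bound[where B = 2]) auto
    qed (use pw in auto)
    finally show ?thesis .
  qed
  show ?thesis
  proof (rule uniform_limitI)
    fix e :: real assume "0 < e"
    from order_tendstoD(2)[OF D this]
    show "\<forall>\<^sub>F n in sequentially. \<forall>t\<in>{-1..1}. dist (char (\<rho> n) t) (char S t) < e"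
      by eventually_elim (unfold dist_norm, blast intro: le_less_trans le)
  qed
qed

lemma char_normalized_sum:
  assumes "real_distribution P"
  shows "char (distr (Pi\<^sub>M UNIV (\<lambda>_::nat. P)) borel (\<lambda>y. c * (\<Sum>i<n. y i))) t = char P (c * t) ^ n"
proof -
  interpret P0: real_distribution P by fact
  interpret product_prob_space "\<lambda>_::nat. P" UNIV by unfold_locales
  let ?M = "Pi\<^sub>M UNIV (\<lambda>_::nat. P)"
  have co: "(\<lambda>y. y i) \<in> ?M \<rightarrow>\<^sub>M borel" for i :: nat
    using measurable_component_singleton[of i UNIV "\<lambda>_. P"] by (simp cong: measurable_cong_sets)
  have dc: "distr ?M borel (\<lambda>y. y i) = P" for i
    using PiM_component[of i] by (simp cong: distr_cong)
  have "indep_vars (\<lambda>_. borel) (\<lambda>i y. y i) (UNIV :: nat set)"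
  proof (subst indep_vars_iff_distr_eq_PiM)
    have "distr ?M (Pi\<^sub>M UNIV (\<lambda>_::nat. borel)) (\<lambda>x. \<lambda>i\<in>UNIV. x i) = distr ?M ?M (\<lambda>x. x)"
      by (intro distr_cong sets_PiM_cong) auto
    then show "distr ?M (Pi\<^sub>M UNIV (\<lambda>_::nat. borel)) (\<lambda>x. \<lambda>i\<in>UNIV. x i)
        = (\<Pi>\<^sub>M i\<in>UNIV. distr ?M borel (\<lambda>y. y i))"
      by (simp add: dc distr_id2)
  qed (use co in auto)
  then have "indep_vars (\<lambda>_. borel) (\<lambda>i y. c * y i) (UNIV :: nat set)"
    by (rule indep_vars_compose2) auto
  from char_distr_sum[OF indep_vars_subset[OF this, of "{..<n}"]]
  have "char (distr ?M borel (\<lambda>y. \<Sum>i<n. c * y i)) t = (\<Prod>i<n. char (distr ?M borel (\<lambda>y. c * y i)) t)"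
    by simp
  also have "(\<lambda>y. \<Sum>i<n. c * y i) = (\<lambda>y. c * (\<Sum>i<n. y i))"
    by (simp add: sum_distrib_left)
  also have "(\<Prod>i<n. char (distr ?M borel (\<lambda>y. c * y i)) t) = (\<Prod>i<n. char P (c * t))"
  proof (rule prod.cong)
    fix i
    have "char (distr ?M borel (\<lambda>y. c * y i)) t = (CLINT y|?M. iexp (c * t * y i))"
      unfolding char_def using co[of i] by (subst integral_distr) (auto simp: mult_ac)
    also have "\<dots> = (CLINT x|distr ?M borel (\<lambda>y. y i). iexp (c * t * x))"
      using co[of i] by (subst integral_distr) auto
    finally show "char (distr ?M borel (\<lambda>y. c * y i)) t = char P (c * t)" by (simp add: dc char_def)
  qed simp
  finally show ?thesis by simp
qed

text \<open>The branch of the logarithm: \<open>g - Ln (exp g)\<close> is continuous on a connected set with values in the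
  discrete set \<open>2\<pi>i\<int>\<close> and vanishes at one point, hence everywhere.\<close>

lemma continuous_eq_Ln_exp:
  assumes S: "connected S" and x0: "x0 \<in> S" "g x0 = 0" and g: "continuous_on S g"
    and k: "\<And>x. x \<in> S \<Longrightarrow> cmod (exp (g x) - 1) < 1" and x: "x \<in> S"
  shows "g x = Ln (exp (g x))"
proof -
  define D where "D x = g x - Ln (exp (g x))" for x
  have pos: "exp (g x) \<notin> \<real>\<^sub>\<le>\<^sub>0" if "x \<in> S" for x
  proof -
    have "\<bar>Re (exp (g x) - 1)\<bar> < 1"
      using abs_Re_le_cmod[of "exp (g x) - 1"] k[OF that] by linarith
    then show ?thesis
      unfolding complex_nonpos_Reals_iff by auto
  qed
  have cD: "continuous_on S D"
    unfolding D_def by (intro continuous_intros g pos)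
  have "exp (D x) = 1" for x
    by (simp add: D_def exp_diff)
  then have D: "\<exists>n::int. D x = \<i> * of_real (of_int (2 * n) * pi)" for x
    by (metis complex_eq exp_eq_1 add_0 of_real_0)
  have "D constant_on S"
  proof (rule continuous_discrete_range_constant[OF S cD])
    fix x assume "x \<in> S"
    obtain n :: int where n: "D x = \<i> * of_real (of_int (2 * n) * pi)" using D by blast
    show "\<exists>e>0. \<forall>y. y \<in> S \<and> D y \<noteq> D x \<longrightarrow> e \<le> norm (D y - D x)"
    proof (intro exI[of _ "2 * pi"] conjI allI impI)
      fix y assume y: "y \<in> S \<and> D y \<noteq> D x"
      obtain m :: int where m: "D y = \<i> * of_real (of_int (2 * m) * pi)" using D by blast
      with y n have "m \<noteq> n" by auto
      then have "1 \<le> \<bar>real_of_int (m - n)\<bar>" by linarith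
      moreover have "D y - D x = \<i> * of_real (2 * pi * of_int (m - n))"
        by (simp add: n m algebra_simps)
      then have "norm (D y - D x) = 2 * pi * \<bar>real_of_int (m - n)\<bar>"
        by (simp only: norm_mult norm_ii norm_of_real) (simp add: abs_mult)
      ultimately show "2 * pi \<le> norm (D y - D x)" by simp
    qed auto
  qed
  then have "D x = D x0" using x x0 by (auto simp: constant_on_def)
  also have "\<dots> = 0" using x0 by (simp add: D_def)
  finally show ?thesis by (simp add: D_def)
qed

text \<open>The \<open>n\<close>-th power of \<open>\<phi>\<close> at \<open>s\<close> times \<open>n\<close> to the power \<open>- 1/\<alpha>\<close> converges to
  \<open>exp (- G (\<sigma> s))\<close> uniformly for \<open>|s| \<le> 1\<close>. The uniformity is needed twice: it lets the integer
  multiples of \<open>2\<pi>i\<close> in the logarithm be excluded by connectedness, starting from \<open>s = 0\<close>; and it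
  covers all small \<open>t\<close>, since \<open>t\<close> is such a point for \<open>n\<close> the integer part of \<open>|t|\<close> to the power
  \<open>- \<alpha>\<close>.\<close>

lemma normal_domain_of_attraction_char:
  assumes P: "real_distribution P" and nd: "normal_domain_of_attraction \<alpha> \<sigma> \<nu> P"
    and \<alpha>: "0 < \<alpha>" and \<sigma>: "0 < \<sigma>" and \<epsilon>: "0 < \<epsilon>"
  shows "\<exists>\<delta>>0. \<forall>t. \<bar>t\<bar> \<le> \<delta> \<longrightarrow>
    (\<exists>r. cmod r \<le> \<epsilon> * \<bar>t\<bar> powr \<alpha> \<and> char P t = exp (- stable_exponent \<alpha> \<nu> (\<sigma> * t) + r))"
proof -
  interpret P: real_distribution P by fact
  let ?G = "\<lambda>t. stable_exponent \<alpha> \<nu> (\<sigma> * t)"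
  from nd obtain S where S: "stable_law \<alpha> \<sigma> \<nu> S" and
    w: "weak_conv_m (\<lambda>n. distr (Pi\<^sub>M UNIV (\<lambda>_::nat. P)) borel
                   (\<lambda>y. real n powr (- 1 / \<alpha>) * (\<Sum>i<n. y i))) S" (is "weak_conv_m ?\<rho> S")
    unfolding normal_domain_of_attraction_def by blast
  have Sd: "real_distribution S" and "char S t = exp (- ?G t)" for t
    using S \<sigma> by (auto simp: stable_law_def stable_exponent_def abs_mult sgn_mult powr_mult)
  then have cS: "char S = (\<lambda>t. exp (- ?G t))" by auto
  interpret PP: product_prob_space "\<lambda>_::nat. P" UNIV by unfold_locales
  have co: "(\<lambda>y. y i) \<in> Pi\<^sub>M UNIV (\<lambda>_::nat. P) \<rightarrow>\<^sub>M borel" for i :: nat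
    using measurable_component_singleton[of i UNIV "\<lambda>_. P"] by (simp cong: measurable_cong_sets)
  have rd: "real_distribution (?\<rho> n)" for n
    by (intro PP.real_distribution_distr borel_measurable_times borel_measurable_sum co) auto
  have UL: "uniform_limit {-1..1} (\<lambda>n t. char P (real n powr (- 1 / \<alpha>) * t) ^ n) (\<lambda>t. exp (- ?G t)) sequentially"
    using char_uniform_limit[OF rd Sd w] unfolding char_normalized_sum[OF P] cS .
  have contG: "continuous_on A ?G" for A
    by (rule continuous_on_compose2[OF continuous_on_stable_exponent[OF \<alpha>, of UNIV]]) (auto intro!: continuous_intros)
  \<comment> \<open>Dividing by \<open>exp (- G)\<close> costs at most this factor on the unit interval.\<close>
  define B where "B = exp (\<sigma> powr \<alpha>)"
  have ReG: "cmod (exp (?G t)) \<le> B" if "\<bar>t\<bar> \<le> 1" for t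
    using that \<sigma> \<alpha> by (auto simp: B_def norm_exp_eq_Re Re_stable_exponent abs_mult intro!: powr_mono2 mult_left_le)
  obtain \<kappa> where \<kappa>: "0 < \<kappa>" "\<kappa> < 1" "\<And>w. cmod (w - 1) < \<kappa> \<Longrightarrow> cmod (Ln w) < \<epsilon> / 2"
  proof -
    have "isCont Ln 1" by (intro continuous_intros) auto
    then have "(Ln \<longlongrightarrow> Ln 1) (nhds 1)" by (simp add: isCont_def tendsto_nhds_iff)
    then have "\<forall>\<^sub>F w in nhds 1. dist (Ln w) (Ln 1) < \<epsilon> / 2"
      using \<epsilon> by (intro tendstoD) auto
    then obtain d where "d > 0" "\<And>w. dist w 1 < d \<Longrightarrow> dist (Ln w) (Ln 1) < \<epsilon> / 2"
      unfolding eventually_nhds_metric by blast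
    then show ?thesis
      by (intro that[of "min d (1/2)"]) (auto simp: dist_norm)
  qed
  obtain \<delta>0 where \<delta>0: "0 < \<delta>0" "\<And>t. \<bar>t\<bar> < \<delta>0 \<Longrightarrow> cmod (char P t - 1) < 1"
    using P.isCont_char[of 0, unfolded continuous_at_eps_delta, rule_format, of 1]
    by (auto simp: P.char_zero dist_norm)
  have nn: "char P t \<notin> \<real>\<^sub>\<le>\<^sub>0" if "\<bar>t\<bar> < \<delta>0" for t
    using abs_Re_le_cmod[of "char P t - 1"] \<delta>0(2)[OF that]
    unfolding complex_nonpos_Reals_iff by auto
  have "(\<lambda>n. real n powr (- 1 / \<alpha>)) \<longlonglongrightarrow> 0"
    using \<alpha> by (intro tendsto_neg_powr filterlim_real_sequentially) auto
  then have ev1: "\<forall>\<^sub>F n in sequentially. real n powr (- 1 / \<alpha>) < \<delta>0"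
    using \<delta>0 order_tendstoD(2) by blast
  have "0 < \<kappa> / B" using \<kappa> by (simp add: B_def)
  from uniform_limitD[OF UL this] ev1 eventually_gt_at_top[of 0]
  have "\<forall>\<^sub>F n in sequentially. \<forall>t\<in>{-1..1}. \<exists>r. cmod r \<le> \<epsilon> / 2 / n \<and>
      char P (real n powr (- 1 / \<alpha>) * t) = exp (- ?G t / n + r)"
  proof eventually_elim
    case (elim n)
    define q where "q = real n powr (- 1 / \<alpha>)"
    \<comment> \<open>The logarithm of the quotient of the power of \<open>\<phi>\<close> by its limit.\<close>
    define g where "g t = of_nat n * Ln (char P (q * t)) + ?G t" for t
    have qt: "\<bar>q * t\<bar> < \<delta>0" if "t \<in> {-1..1}" for t
    proof -
      have "\<bar>q * t\<bar> \<le> q * 1" unfolding abs_mult using that by (intro mult_mono) (auto simp: q_def)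
      then show ?thesis using elim by (simp add: q_def)
    qed
    have nz: "char P (q * t) \<noteq> 0" if "t \<in> {-1..1}" for t
      using nn[OF qt[OF that]] by auto
    have eg: "exp (g t) = char P (q * t) ^ n * exp (?G t)" if "t \<in> {-1..1}" for t
      using nz[OF that] by (simp add: g_def exp_add exp_of_nat_mult)
    have sm: "cmod (exp (g t) - 1) < \<kappa>" if t: "t \<in> {-1..1}" for t
    proof -
      have "exp (g t) - 1 = (char P (q * t) ^ n - exp (- ?G t)) * exp (?G t)"
        by (simp add: eg[OF t] exp_minus field_simps)
      then have "cmod (exp (g t) - 1) = cmod (char P (q * t) ^ n - exp (- ?G t)) * cmod (exp (?G t))"
        by (simp add: norm_mult)
      also have "\<dots> \<le> cmod (char P (q * t) ^ n - exp (- ?G t)) * B"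
        using t by (intro mult_left_mono ReG) auto
      also have "\<dots> < \<kappa> / B * B"
        using elim(1) t by (intro mult_strict_right_mono) (auto simp: q_def B_def dist_norm)
      finally show ?thesis by (simp add: B_def)
    qed
    have cg: "continuous_on {-1..1} g"
    proof -
      have "continuous_on {-1..1} (\<lambda>t. char P (q * t))"
        by (rule continuous_on_compose2[of UNIV "char P"])
          (auto intro!: continuous_intros continuous_at_imp_continuous_on P.isCont_char)
      then show ?thesis
        unfolding g_def by (intro continuous_intros contG) (use nn qt in auto)
    qed
    show ?case
    proof
      fix t :: real assume t: "t \<in> {-1..1}"
      have "g t = Ln (exp (g t))"
        by (rule continuous_eq_Ln_exp[OF connected_Icc _ _ cg _ t, of 0])
          (use sm \<kappa>(2) P.char_zero in \<open>auto simp: g_def intro: less_trans\<close>)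
      then have "cmod (g t) < \<epsilon> / 2" using \<kappa>(3)[OF sm[OF t]] by simp
      then have "cmod (g t / n) \<le> \<epsilon> / 2 / n"
        using elim(3) by (simp add: norm_divide field_simps)
      moreover have "char P (q * t) = exp (- ?G t / n + g t / n)"
      proof -
        have "- ?G t / n + g t / n = Ln (char P (q * t))"
          using elim(3) by (simp add: g_def field_simps)
        then show ?thesis using nz[OF t] by simp
      qed
      ultimately show "\<exists>r. cmod r \<le> \<epsilon> / 2 / n \<and>
          char P (real n powr (- 1 / \<alpha>) * t) = exp (- ?G t / n + r)"
        unfolding q_def by blast
    qed
  qed
  then obtain N where N: "\<And>n t. n \<ge> N \<Longrightarrow> \<bar>t\<bar> \<le> 1 \<Longrightarrow> \<exists>r. cmod r \<le> \<epsilon> / 2 / real n \<and>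
      char P (real n powr (- 1 / \<alpha>) * t) = exp (- ?G t / of_nat n + r)"
    unfolding eventually_sequentially by (metis abs_le_iff atLeastAtMost_iff minus_le_iff of_real_of_nat_eq)
  define \<delta> where "\<delta> = (real N + 1) powr (- 1 / \<alpha>)"
  show ?thesis
  proof (intro exI[of _ \<delta>] conjI allI impI)
    show "0 < \<delta>" by (simp add: \<delta>_def)
    fix t :: real assume t: "\<bar>t\<bar> \<le> \<delta>"
    show "\<exists>r. cmod r \<le> \<epsilon> * \<bar>t\<bar> powr \<alpha> \<and> char P t = exp (- ?G t + r)"
    proof (cases "t = 0")
      case True
      then show ?thesis using P.char_zero by (intro exI[of _ 0]) auto
    next
      case False
      \<comment> \<open>With \<open>n\<close> the integer part of \<open>x\<close>, the point \<open>t\<close> is the scaled version of a point \<open>s\<close> of modulus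
        at most \<open>1\<close>, and \<open>1/n \<le> 2/x\<close> turns the error \<open>\<epsilon>/(2n)\<close> into the required one.\<close>
      define x where "x = \<bar>t\<bar> powr (- \<alpha>)"
      have x0: "0 < x" using False by (simp add: x_def)
      have "x \<ge> \<delta> powr (- \<alpha>)" unfolding x_def
        using t False \<alpha> by (intro powr_mono2') auto
      also have "\<delta> powr (- \<alpha>) = real N + 1" using \<alpha> by (simp add: \<delta>_def powr_powr)
      finally have xN: "real N + 1 \<le> x" .
      define n where "n = nat \<lfloor>x\<rfloor>"
      have nx: "real n \<le> x" "x < real n + 1" "n \<ge> N" "n > 0"
        using xN unfolding n_def by linarith+
      define s where "s = t * real n powr (1 / \<alpha>)"
      have "\<bar>s\<bar> \<le> \<bar>t\<bar> * x powr (1 / \<alpha>)"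
        unfolding s_def abs_mult using nx \<alpha> by (auto intro!: mult_left_mono powr_mono2)
      also have "x powr (1 / \<alpha>) = inverse \<bar>t\<bar>"
        using \<alpha> False powr_neg_one[of "\<bar>t\<bar>"] by (simp add: x_def powr_powr inverse_eq_divide)
      finally have s1: "\<bar>s\<bar> \<le> 1" using False by simp
      have "real n powr (1 / \<alpha>) * real n powr (- 1 / \<alpha>) = 1"
        using nx by (simp flip: powr_add)
      then have st: "real n powr (- 1 / \<alpha>) * s = t"
        unfolding s_def by (simp add: mult.assoc mult.commute)
      have "?G s = stable_exponent \<alpha> \<nu> (real n powr (1 / \<alpha>) * (\<sigma> * t))"
        by (simp add: s_def mult_ac)
      also have "\<dots> = of_real ((real n powr (1 / \<alpha>)) powr \<alpha>) * ?G t"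
        by (rule stable_exponent_scale) auto
      also have "(real n powr (1 / \<alpha>)) powr \<alpha> = real n"
        using \<alpha> nx by (simp add: powr_powr)
      finally have Gs: "?G s / of_nat n = ?G t" using nx by simp
      obtain r where r: "cmod r \<le> \<epsilon> / 2 / real n" "char P t = exp (- ?G t + r)"
        using N[OF nx(3) s1] unfolding st using Gs by (auto simp: minus_divide_left[symmetric])
      have "x \<le> 2 * real n" using nx by linarith
      then have "\<epsilon> / 2 / real n \<le> \<epsilon> / x"
        using nx x0 \<epsilon> by (simp add: field_simps)
      also have "\<epsilon> / x = \<epsilon> * \<bar>t\<bar> powr \<alpha>" by (simp add: x_def powr_minus field_simps)
      finally show ?thesis using r by force
    qed
  qed
qed

text \<open>Near \<open>0\<close> this follows from the expansion, and away from \<open>0\<close> the left-hand side is at most \<open>2\<close>.\<close>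

lemma char_minus_one_bound:
  assumes P: "real_distribution P" and nd: "normal_domain_of_attraction \<alpha> \<sigma> \<nu> P"
    and \<alpha>: "0 < \<alpha>" and \<sigma>: "0 < \<sigma>"
  shows "\<exists>C\<ge>0. \<forall>t. cmod (1 - char P t) \<le> C * \<bar>t\<bar> powr \<alpha>"
proof -
  interpret P: real_distribution P by fact
  from normal_domain_of_attraction_char[OF P nd \<alpha> \<sigma>, of 1] obtain \<delta> where \<delta>: "\<delta> > 0"
    "\<And>t. \<bar>t\<bar> \<le> \<delta> \<Longrightarrow> \<exists>r. cmod r \<le> \<bar>t\<bar> powr \<alpha> \<and> char P t = exp (- stable_exponent \<alpha> \<nu> (\<sigma> * t) + r)"
    by auto
  define D where "D = (1 + \<bar>\<nu> * tan (pi * \<alpha> / 2)\<bar>) * \<sigma> powr \<alpha> + 1"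
  define C where "C = max (D * exp (D * \<delta> powr \<alpha>)) (2 / \<delta> powr \<alpha>)"
  have D: "0 \<le> D" by (auto simp: D_def intro!: add_nonneg_nonneg mult_nonneg_nonneg)
  show ?thesis
  proof (intro exI[of _ C] conjI allI)
    show "0 \<le> C" using D by (auto simp: C_def le_max_iff_disj)
    fix t
    show "cmod (1 - char P t) \<le> C * \<bar>t\<bar> powr \<alpha>"
    proof (cases "\<bar>t\<bar> \<le> \<delta>")
      case True
      from \<delta>(2)[OF True] obtain r where r: "cmod r \<le> \<bar>t\<bar> powr \<alpha>"
        "char P t = exp (- stable_exponent \<alpha> \<nu> (\<sigma> * t) + r)" by blast
      define z where "z = - stable_exponent \<alpha> \<nu> (\<sigma> * t) + r"
      have "cmod z \<le> cmod (stable_exponent \<alpha> \<nu> (\<sigma> * t)) + cmod r"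
        unfolding z_def by (metis norm_minus_cancel norm_triangle_ineq)
      also have "\<dots> \<le> D * \<bar>t\<bar> powr \<alpha>"
        using norm_stable_exponent_le[of \<alpha> \<nu> "\<sigma> * t"] r(1) \<sigma>
        by (simp add: D_def abs_mult powr_mult algebra_simps)
      finally have z: "cmod z \<le> D * \<bar>t\<bar> powr \<alpha>" .
      have "cmod (exp z - 1) \<le> cmod z * exp (cmod z)"
      proof -
        have "cmod (exp z - (\<Sum>k\<le>0. z ^ k / fact k)) \<le> exp \<bar>Re z\<bar> * cmod z ^ Suc 0 / fact 0"
          by (rule Taylor_exp)
        also have "\<dots> \<le> exp (cmod z) * cmod z"
          using abs_Re_le_cmod by (auto intro!: mult_right_mono)
        finally show ?thesis by (simp add: mult.commute)
      qed
      also have "\<dots> \<le> (D * \<bar>t\<bar> powr \<alpha>) * exp (D * \<delta> powr \<alpha>)"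
      proof (intro mult_mono z)
        have "D * \<bar>t\<bar> powr \<alpha> \<le> D * \<delta> powr \<alpha>"
          using True D \<alpha> by (intro mult_left_mono powr_mono2) auto
        with z show "exp (cmod z) \<le> exp (D * \<delta> powr \<alpha>)" by simp
      qed (use D in auto)
      also have "\<dots> \<le> C * \<bar>t\<bar> powr \<alpha>"
        unfolding mult.assoc mult.commute[of "\<bar>t\<bar> powr \<alpha>" "exp _"]
        unfolding mult.assoc[symmetric] by (intro mult_right_mono) (auto simp: C_def)
      finally show ?thesis using r by (simp add: z_def norm_minus_commute)
    next
      case False
      have "cmod (1 - char P t) \<le> 1 + 1"
        by (rule order_trans[OF norm_triangle_ineq4]) (use P.cmod_char_le_1 in auto)
      also have "\<dots> \<le> 2 / \<delta> powr \<alpha> * \<bar>t\<bar> powr \<alpha>"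
      proof -
        have "\<delta> powr \<alpha> \<le> \<bar>t\<bar> powr \<alpha>" using False \<delta> \<alpha> by (intro powr_mono2) auto
        then show ?thesis using \<delta>(1) by (simp add: field_simps)
      qed
      also have "\<dots> \<le> C * \<bar>t\<bar> powr \<alpha>" by (intro mult_right_mono) (auto simp: C_def)
      finally show ?thesis .
    qed
  qed
qed

section \<open>The exponents of the approximating series\<close>

text \<open>By homogeneity it suffices to treat \<open>b = 0\<close> and \<open>|b| = 1\<close>. In the latter case continuity gives the
  bound for \<open>a\<close> near \<open>b\<close>, and for the other \<open>a\<close> both exponents are at most a multiple of
  \<open>|a - b|\<^sup>\<alpha>\<close>.\<close>

lemma stable_exponent_diff_le:
  assumes \<alpha>: "0 < \<alpha>" and \<epsilon>: "0 < \<epsilon>"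
  shows "\<exists>C\<ge>0. \<forall>a b. cmod (stable_exponent \<alpha> \<nu> a - stable_exponent \<alpha> \<nu> b)
    \<le> \<epsilon> * \<bar>b\<bar> powr \<alpha> + C * \<bar>a - b\<bar> powr \<alpha>"
proof -
  let ?G = "stable_exponent \<alpha> \<nu>"
  define K where "K = 1 + \<bar>\<nu> * tan (pi * \<alpha> / 2)\<bar>"
  have K: "1 \<le> K" by (simp add: K_def)
  have GK: "cmod (?G y) \<le> K * \<bar>y\<bar> powr \<alpha>" for y
    unfolding K_def by (rule norm_stable_exponent_le)
  have "isCont ?G t" for t
    using continuous_on_stable_exponent[OF \<alpha>, of UNIV \<nu>] by (simp add: continuous_on_eq_continuous_at)
  then have "\<exists>d>0. \<forall>s. dist s t < d \<longrightarrow> dist (?G s) (?G t) < \<epsilon>" for t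
    unfolding continuous_at_eps_delta using \<epsilon> by blast
  then obtain d1 d2 where d: "0 < d1" "0 < d2" "\<And>s. dist s 1 < d1 \<Longrightarrow> dist (?G s) (?G 1) < \<epsilon>"
    "\<And>s. dist s (- 1) < d2 \<Longrightarrow> dist (?G s) (?G (- 1)) < \<epsilon>" by metis
  define \<delta> where "\<delta> = min d1 d2"
  have \<delta>: "0 < \<delta>" using d by (simp add: \<delta>_def)
  define C where "C = K * ((1 + 1 / \<delta>) powr \<alpha> + (1 / \<delta>) powr \<alpha>)"
  have C: "K \<le> C"
  proof -
    have "1 powr \<alpha> \<le> (1 + 1 / \<delta>) powr \<alpha>" using \<delta> \<alpha> by (intro powr_mono2) auto
    then have "K * 1 \<le> K * ((1 + 1 / \<delta>) powr \<alpha> + (1 / \<delta>) powr \<alpha>)"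
      using K by (intro mult_left_mono add_increasing2) auto
    then show ?thesis by (simp add: C_def)
  qed
  have unit: "cmod (?G s - ?G t) \<le> \<epsilon> + C * \<bar>s - t\<bar> powr \<alpha>" if t: "t = 1 \<or> t = - 1" for s t
  proof (cases "\<bar>s - t\<bar> < \<delta>")
    case True
    then have "dist (?G s) (?G t) < \<epsilon>" using t d(3)[of s] d(4)[of s] by (auto simp: \<delta>_def dist_real_def)
    moreover have "0 \<le> C * \<bar>s - t\<bar> powr \<alpha>" using C K by (intro mult_nonneg_nonneg) auto
    ultimately show ?thesis by (simp add: dist_norm)
  next
    case False
    let ?r = "\<bar>s - t\<bar>"
    have r: "\<delta> \<le> ?r" "0 < ?r" using False \<delta> by auto
    have t1: "\<bar>t\<bar> = 1" using t by auto
    have one: "1 \<le> 1 / \<delta> * ?r" using r \<delta> by (simp add: field_simps)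
    have "\<bar>s\<bar> \<le> (1 + 1 / \<delta>) * ?r" using one t1 by (simp add: algebra_simps)
    then have s: "\<bar>s\<bar> powr \<alpha> \<le> (1 + 1 / \<delta>) powr \<alpha> * ?r powr \<alpha>"
      using \<alpha> \<delta> by (subst powr_mult[symmetric]) (auto intro!: powr_mono2)
    have "1 powr \<alpha> \<le> (1 / \<delta> * ?r) powr \<alpha>" using one \<alpha> by (intro powr_mono2) auto
    then have t2: "\<bar>t\<bar> powr \<alpha> \<le> (1 / \<delta>) powr \<alpha> * ?r powr \<alpha>"
      using \<delta> t1 by (subst powr_mult[symmetric]) auto
    have "cmod (?G s - ?G t) \<le> K * \<bar>s\<bar> powr \<alpha> + K * \<bar>t\<bar> powr \<alpha>"
      using norm_triangle_ineq4[of "?G s" "?G t"] GK[of s] GK[of t] by linarith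
    also have "\<dots> \<le> K * ((1 + 1 / \<delta>) powr \<alpha> * ?r powr \<alpha>) + K * ((1 / \<delta>) powr \<alpha> * ?r powr \<alpha>)"
      using s t2 K by (intro add_mono mult_left_mono) auto
    also have "\<dots> = C * ?r powr \<alpha>" by (simp add: C_def algebra_simps)
    finally show ?thesis using \<epsilon> by simp
  qed
  show ?thesis
  proof (intro exI[of _ C] conjI allI)
    show "0 \<le> C" using C K by linarith
    fix a b :: real
    show "cmod (?G a - ?G b) \<le> \<epsilon> * \<bar>b\<bar> powr \<alpha> + C * \<bar>a - b\<bar> powr \<alpha>"
    proof (cases "b = 0")
      case True
      have "cmod (?G a) \<le> C * \<bar>a\<bar> powr \<alpha>"
        using GK[of a] mult_right_mono[OF C, of "\<bar>a\<bar> powr \<alpha>"] by simp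
      then show ?thesis using True by simp
    next
      case False
      define s where "s = a / \<bar>b\<bar>"
      have ab: "a = \<bar>b\<bar> * s" "b = \<bar>b\<bar> * sgn b" using False by (auto simp: s_def sgn_if)
      have "?G a - ?G b = of_real (\<bar>b\<bar> powr \<alpha>) * (?G s - ?G (sgn b))"
        using stable_exponent_scale[of "\<bar>b\<bar>" \<alpha> \<nu> s] stable_exponent_scale[of "\<bar>b\<bar>" \<alpha> \<nu> "sgn b"]
        by (simp add: ab[symmetric] right_diff_distrib)
      then have "cmod (?G a - ?G b) = \<bar>b\<bar> powr \<alpha> * cmod (?G s - ?G (sgn b))" by (simp add: norm_mult)
      also have "\<dots> \<le> \<bar>b\<bar> powr \<alpha> * (\<epsilon> + C * \<bar>s - sgn b\<bar> powr \<alpha>)"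
        using False by (intro mult_left_mono unit) (auto simp: sgn_if)
      also have "\<dots> = \<epsilon> * \<bar>b\<bar> powr \<alpha> + C * (\<bar>b\<bar> * \<bar>s - sgn b\<bar>) powr \<alpha>"
        by (simp add: powr_mult algebra_simps)
      also have "\<bar>b\<bar> * \<bar>s - sgn b\<bar> = \<bar>a - b\<bar>"
      proof -
        have "a - b = \<bar>b\<bar> * (s - sgn b)" unfolding right_diff_distrib using ab by simp
        then show ?thesis by (simp add: abs_mult)
      qed
      finally show ?thesis .
    qed
  qed
qed

lemma powr_mass_finite_integrable:
  assumes [measurable]: "f \<in> borel_measurable lebesgue" and fin: "powr_mass \<alpha> f < \<infinity>"
  shows "integrable lebesgue (\<lambda>x. \<bar>f x\<bar> powr \<alpha>)"
    and "integrable lebesgue (\<lambda>x. stable_exponent \<alpha> \<nu> (f x))"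
proof -
  show 1: "integrable lebesgue (\<lambda>x. \<bar>f x\<bar> powr \<alpha>)"
    using fin by (simp add: integrable_iff_bounded powr_mass_def)
  show "integrable lebesgue (\<lambda>x. stable_exponent \<alpha> \<nu> (f x))"
  proof (rule Bochner_Integration.integrable_bound)
    show "integrable lebesgue (\<lambda>x. (1 + \<bar>\<nu> * tan (pi * \<alpha> / 2)\<bar>) * \<bar>f x\<bar> powr \<alpha>)"
      using 1 by simp
    show "AE x in lebesgue. norm (stable_exponent \<alpha> \<nu> (f x)) \<le> norm ((1 + \<bar>\<nu> * tan (pi * \<alpha> / 2)\<bar>) * \<bar>f x\<bar> powr \<alpha>)"
    proof (rule AE_I2)
      fix x
      have "0 \<le> (1 + \<bar>\<nu> * tan (pi * \<alpha> / 2)\<bar>) * \<bar>f x\<bar> powr \<alpha>" by (intro mult_nonneg_nonneg) auto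
      then show "norm (stable_exponent \<alpha> \<nu> (f x)) \<le> norm ((1 + \<bar>\<nu> * tan (pi * \<alpha> / 2)\<bar>) * \<bar>f x\<bar> powr \<alpha>)"
        using norm_stable_exponent_le[of \<alpha> \<nu> "f x"] by simp
    qed
  qed measurable
qed

text \<open>The functional \<open>f \<mapsto> \<integral> G f\<close> is continuous for convergence in the mean of order \<open>\<alpha>\<close>: integrate
  the pointwise bound \<open>stable_exponent_diff_le\<close>, in which the coefficient of \<open>|f|\<^sup>\<alpha>\<close> may be chosen
  as small as desired.\<close>

lemma integral_stable_exponent_tendsto:
  fixes f :: "'a::euclidean_space \<Rightarrow> real"
  assumes f: "f \<in> L_space \<alpha>" and \<alpha>: "0 < \<alpha>"
    and u: "\<And>h. 0 < h \<Longrightarrow> u h \<in> borel_measurable lebesgue"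
    and lim: "((\<lambda>h::real. powr_mass \<alpha> (\<lambda>x. u h x - f x)) \<longlongrightarrow> 0) (at_right 0)"
  shows "((\<lambda>h. LINT x|lebesgue. stable_exponent \<alpha> \<nu> (u h x))
    \<longlongrightarrow> (LINT x|lebesgue. stable_exponent \<alpha> \<nu> (f x))) (at_right 0)"
proof (rule tendstoI)
  fix e :: real assume e: "0 < e"
  let ?G = "stable_exponent \<alpha> \<nu>"
  have fm[measurable]: "f \<in> borel_measurable lebesgue" and ff: "powr_mass \<alpha> f < \<infinity>"
    using f by (auto simp: L_space_iff)
  note fi = powr_mass_finite_integrable[OF fm ff]
  define Mf where "Mf = (LINT x|lebesgue. \<bar>f x\<bar> powr \<alpha>)"
  have Mf: "0 \<le> Mf" by (simp add: Mf_def)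
  define \<epsilon> where "\<epsilon> = e / (3 * (Mf + 1))"
  have \<epsilon>: "0 < \<epsilon>" using e Mf by (simp add: \<epsilon>_def)
  have W: "e / (3 * w) * w = e / 3" if "0 < w" for w using that by simp
  from stable_exponent_diff_le[OF \<alpha> \<epsilon>] obtain C where C: "0 \<le> C"
    "\<And>a b. cmod (?G a - ?G b) \<le> \<epsilon> * \<bar>b\<bar> powr \<alpha> + C * \<bar>a - b\<bar> powr \<alpha>" by blast
  define \<eta> where "\<eta> = e / (3 * (C + 1))"
  have \<eta>: "0 < \<eta>" using e C by (simp add: \<eta>_def)
  show "\<forall>\<^sub>F h in at_right 0. dist (LINT x|lebesgue. ?G (u h x)) (LINT x|lebesgue. ?G (f x)) < e"
    using tendsto_ennreal_0D[OF lim \<eta>] eventually_at_right_less[of 0]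
  proof eventually_elim
    case (elim h)
    have [measurable]: "u h \<in> borel_measurable lebesgue" using elim u by blast
    have dm: "(\<lambda>x. u h x - f x) \<in> borel_measurable lebesgue" by simp
    have dfin: "powr_mass \<alpha> (\<lambda>x. u h x - f x) < \<infinity>" using elim(1) by (rule order.strict_trans1) simp
    have "powr_mass \<alpha> (u h) = powr_mass \<alpha> (\<lambda>x. (u h x - f x) + f x)" by simp
    also have "\<dots> \<le> ennreal (2 powr \<alpha>) * (powr_mass \<alpha> (\<lambda>x. u h x - f x) + powr_mass \<alpha> f)"
      by (rule powr_mass_add_le) (use \<alpha> in auto)
    also have "\<dots> < \<infinity>" using dfin ff by (simp add: ennreal_mult_less_top)
    finally have ufin: "powr_mass \<alpha> (u h) < \<infinity>" .
    have Iu: "integrable lebesgue (\<lambda>x. ?G (u h x))" by (rule powr_mass_finite_integrable(2)) (use ufin in auto)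
    have Id: "integrable lebesgue (\<lambda>x. \<bar>u h x - f x\<bar> powr \<alpha>)"
      by (rule powr_mass_finite_integrable(1)[OF dm dfin])
    have D: "(LINT x|lebesgue. \<bar>u h x - f x\<bar> powr \<alpha>) \<le> \<eta>"
      using elim(1) \<eta> by (intro integral_real_bounded) (auto simp: powr_mass_def)
    have "cmod ((LINT x|lebesgue. ?G (u h x)) - (LINT x|lebesgue. ?G (f x))) = cmod (LINT x|lebesgue. ?G (u h x) - ?G (f x))"
      using Iu fi(2) by simp
    also have "\<dots> \<le> (LINT x|lebesgue. cmod (?G (u h x) - ?G (f x)))" by (rule integral_norm_bound)
    also have "\<dots> \<le> (LINT x|lebesgue. \<epsilon> * \<bar>f x\<bar> powr \<alpha> + C * \<bar>u h x - f x\<bar> powr \<alpha>)"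
      by (rule integral_mono) (use Iu fi Id C(2) in auto)
    also have "\<dots> = \<epsilon> * Mf + C * (LINT x|lebesgue. \<bar>u h x - f x\<bar> powr \<alpha>)"
      using fi Id by (simp add: Mf_def)
    also have "\<dots> \<le> \<epsilon> * (Mf + 1) + (C + 1) * \<eta>"
      using \<epsilon> C D \<eta> Mf by (intro add_mono mult_mono) auto
    also have "\<dots> < e"
    proof -
      have "\<epsilon> * (Mf + 1) = e / 3" unfolding \<epsilon>_def by (rule W) (use Mf in linarith)
      moreover have "(C + 1) * \<eta> = e / 3" unfolding \<eta>_def mult.commute[of "C + 1"] by (rule W) (use C in linarith)
      ultimately show ?thesis using e by linarith
    qed
    finally show ?case by (simp add: dist_norm)
  qed
qed

definition mu_coef :: "real \<Rightarrow> real \<Rightarrow> real \<Rightarrow> (real ^ 'd::finite \<Rightarrow> real) \<Rightarrow> int ^ 'd \<Rightarrow> real" where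
  "mu_coef \<alpha> \<sigma> h f k = inverse \<sigma> * h powr ((1 / \<alpha> - 1) * real CARD('d)) * (LINT x:cell h k|lebesgue. f x)"

lemma mu_term_eq_coef: "mu_term \<alpha> \<sigma> \<xi> h f k \<omega> = mu_coef \<alpha> \<sigma> h f k * \<xi> k \<omega>"
  by (simp add: mu_term_def mu_coef_def)

text \<open>The normalisation of the noise turns the integral over a cell into the mean times \<open>h\<close> to the power
  \<open>d/\<alpha>\<close>.\<close>

lemma mu_coef_eq_avg:
  fixes f :: "real ^ 'd::finite \<Rightarrow> real" and k :: "int ^ 'd"
  assumes h: "0 < h" and \<sigma>: "0 < \<sigma>"
  shows "\<sigma> * mu_coef \<alpha> \<sigma> h f k = h powr (real CARD('d) / \<alpha>) * cell_avg h f k"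
proof -
  have "(LINT x:cell h k|lebesgue. f x) = h powr real CARD('d) * cell_avg h f k"
    using h by (simp add: cell_avg_def powr_realpow)
  then have "\<sigma> * mu_coef \<alpha> \<sigma> h f k = (h powr ((1 / \<alpha> - 1) * real CARD('d)) * h powr real CARD('d)) * cell_avg h f k"
    using \<sigma> by (simp add: mu_coef_def)
  also have "h powr ((1 / \<alpha> - 1) * real CARD('d)) * h powr real CARD('d) = h powr (real CARD('d) / \<alpha>)"
    by (simp add: algebra_simps flip: powr_add)
  finally show ?thesis .
qed

lemma powr_dim_alpha:
  assumes "0 < h" "0 < \<alpha>"
  shows "(h powr (real n / \<alpha>)) powr \<alpha> = h ^ n"
  using assms by (simp add: powr_powr powr_realpow)

lemma stable_exponent_coef:
  fixes f :: "real ^ 'd::finite \<Rightarrow> real" and k :: "int ^ 'd"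
  assumes h: "0 < h" and \<sigma>: "0 < \<sigma>" and \<alpha>: "0 < \<alpha>"
  shows "stable_exponent \<alpha> \<nu> (\<sigma> * mu_coef \<alpha> \<sigma> h f k) = h ^ CARD('d) *\<^sub>R stable_exponent \<alpha> \<nu> (cell_avg h f k)"
  unfolding mu_coef_eq_avg[OF h \<sigma>]
  using h stable_exponent_scale[of "h powr (real CARD('d) / \<alpha>)" \<alpha> \<nu> "cell_avg h f k"]
  by (simp add: powr_dim_alpha[OF h \<alpha>] scaleR_conv_of_real)

lemma mu_coef_powr:
  fixes f :: "real ^ 'd::finite \<Rightarrow> real" and k :: "int ^ 'd"
  assumes h: "0 < h" and \<sigma>: "0 < \<sigma>" and \<alpha>: "0 < \<alpha>"
  shows "\<bar>mu_coef \<alpha> \<sigma> h f k\<bar> powr \<alpha> = \<sigma> powr (- \<alpha>) * (h ^ CARD('d) * \<bar>cell_avg h f k\<bar> powr \<alpha>)"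
proof -
  have "mu_coef \<alpha> \<sigma> h f k = inverse \<sigma> * (\<sigma> * mu_coef \<alpha> \<sigma> h f k)" using \<sigma> by simp
  also have "\<dots> = inverse \<sigma> * (h powr (real CARD('d) / \<alpha>) * cell_avg h f k)"
    unfolding mu_coef_eq_avg[OF h \<sigma>] ..
  finally show ?thesis
    using h \<sigma> by (simp add: abs_mult powr_mult powr_dim_alpha[OF h \<alpha>] powr_minus inverse_powr)
qed

lemma mu_coef_sums:
  fixes f :: "real ^ 'd::finite \<Rightarrow> real" and e :: "nat \<Rightarrow> int ^ 'd"
  assumes f: "f \<in> F_space \<alpha>" and h: "0 < h" and \<sigma>: "0 < \<sigma>" and \<alpha>: "0 < \<alpha>" and e: "bij e"
  shows "(\<lambda>n. stable_exponent \<alpha> \<nu> (\<sigma> * mu_coef \<alpha> \<sigma> h f (e n))) sums (LINT x|lebesgue. stable_exponent \<alpha> \<nu> (cell_step h f x))"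
    and "(\<lambda>n. \<bar>mu_coef \<alpha> \<sigma> h f (e n)\<bar> powr \<alpha>) sums (\<sigma> powr (- \<alpha>) * Re (LINT x|lebesgue. stable_exponent \<alpha> \<nu> (cell_step h f x)))"
proof -
  have "integrable lebesgue (\<lambda>x. stable_exponent \<alpha> \<nu> (cell_step h f x))"
    by (rule powr_mass_finite_integrable(2)[OF cell_step_measurable[OF h] F_space_cell_step_finite[OF f \<alpha> h]])
  from integral_step_sums(2)[OF h e this[unfolded cell_step_def]]
  show 1: "(\<lambda>n. stable_exponent \<alpha> \<nu> (\<sigma> * mu_coef \<alpha> \<sigma> h f (e n))) sums (LINT x|lebesgue. stable_exponent \<alpha> \<nu> (cell_step h f x))"
    by (simp add: stable_exponent_coef[OF h \<sigma> \<alpha>] cell_step_def)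
  have "Re (stable_exponent \<alpha> \<nu> (\<sigma> * mu_coef \<alpha> \<sigma> h f k)) = \<sigma> powr \<alpha> * \<bar>mu_coef \<alpha> \<sigma> h f k\<bar> powr \<alpha>" for k
    using \<sigma> by (simp add: Re_stable_exponent abs_mult powr_mult)
  then have "\<sigma> powr (- \<alpha>) * Re (stable_exponent \<alpha> \<nu> (\<sigma> * mu_coef \<alpha> \<sigma> h f k)) = \<bar>mu_coef \<alpha> \<sigma> h f k\<bar> powr \<alpha>" for k
    using \<sigma> by (simp add: powr_minus)
  then show "(\<lambda>n. \<bar>mu_coef \<alpha> \<sigma> h f (e n)\<bar> powr \<alpha>) sums (\<sigma> powr (- \<alpha>) * Re (LINT x|lebesgue. stable_exponent \<alpha> \<nu> (cell_step h f x)))"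
    using sums_mult[OF sums_Re[OF 1], of "\<sigma> powr (- \<alpha>)"] by simp
qed

text \<open>The \<open>\<alpha>\<close>-th power of a coefficient is, up to \<open>\<sigma>\<^sup>\<alpha>\<close>, the integral of \<open>|f\<^sub>h|\<^sup>\<alpha>\<close> over one cell. Replace
  \<open>f\<^sub>h\<close> by \<open>f\<close> and \<open>f\<close> by a bounded function, at the cost of two globally small integrals; a bounded
  function contributes at most a multiple of the volume of the cell.\<close>

lemma mu_coef_uniformly_small:
  fixes f :: "real ^ 'd::finite \<Rightarrow> real"
  assumes f: "f \<in> F_space \<alpha>" and \<sigma>: "0 < \<sigma>" and \<alpha>: "0 < \<alpha>" and \<delta>: "0 < \<delta>"
  shows "\<forall>\<^sub>F h in at_right 0. \<forall>k. \<bar>mu_coef \<alpha> \<sigma> h f k\<bar> \<le> \<delta>"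
proof -
  define e0 where "e0 = (\<sigma> * \<delta>) powr \<alpha>"
  have e0: "0 < e0" using \<sigma> \<delta> by (simp add: e0_def)
  define K where "K = 2 powr \<alpha>"
  have K: "0 < K" by (simp add: K_def)
  have fm [measurable]: "f \<in> borel_measurable lebesgue" by (rule F_space_measurable[OF f])
  have ff: "powr_mass \<alpha> f < \<infinity>" using F_space_L_space[OF f \<alpha>] by (simp add: L_space_iff)
  have e1: "0 < e0 / (3 * K * K)" using e0 K by simp
  from powr_mass_approx_continuous[OF fm ff \<alpha> e1] obtain g B where
    g: "continuous_on UNIV g" "\<And>x. \<bar>g x\<bar> \<le> B" "0 < B" and fg: "powr_mass \<alpha> (\<lambda>x. f x - g x) \<le> ennreal (e0 / (3 * K * K))"
    by blast
  have [measurable]: "g \<in> borel_measurable lebesgue"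
    using borel_measurable_continuous_onI[OF g(1)] by (simp add: measurable_completion)
  have e2: "0 < e0 / (3 * K)" using e0 K by simp
  have "((\<lambda>h::real. K * (K * (B powr \<alpha> * h ^ CARD('d)))) \<longlongrightarrow> K * (K * (B powr \<alpha> * 0 ^ CARD('d)))) (at_right 0)"
    by (intro tendsto_intros)
  then have "((\<lambda>h::real. K * (K * (B powr \<alpha> * h ^ CARD('d)))) \<longlongrightarrow> 0) (at_right 0)"
    by (simp add: zero_power)
  then have ev: "\<forall>\<^sub>F h in at_right 0. K * (K * (B powr \<alpha> * h ^ CARD('d))) < e0 / 3"
    using e0 by (intro order_tendstoD(2)) auto
  show ?thesis
    using tendsto_ennreal_0D[OF F_space_cell_step_tendsto[OF f \<alpha>] e2] ev eventually_at_right_less[of 0]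
  proof eventually_elim
    case (elim h)
    note h = \<open>0 < h\<close>
    have [measurable]: "cell_step h f \<in> borel_measurable lebesgue" by (rule cell_step_measurable[OF h])
    show ?case
    proof
      fix k :: "int ^ 'd"
      have [measurable]: "cell h k \<in> sets lebesgue" using h by simp
      have "ennreal (\<bar>cell_avg h f k\<bar> powr \<alpha>) * ennreal (h ^ CARD('d))
          = (\<integral>\<^sup>+x\<in>cell h k. ennreal (\<bar>cell_step h f x\<bar> powr \<alpha>) \<partial>lebesgue)"
        unfolding cell_step_def by (rule nn_integral_step_cell[OF h, symmetric])
      \<comment> \<open>The indicator of the cell is dropped from the two terms that are globally small.\<close>
      also have "\<dots> \<le> (\<integral>\<^sup>+x. ennreal K * ennreal (\<bar>cell_step h f x - f x\<bar> powr \<alpha>)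
          + ennreal K * (ennreal K * ennreal (\<bar>f x - g x\<bar> powr \<alpha>))
          + ennreal (K * (K * B powr \<alpha>)) * indicator (cell h k) x \<partial>lebesgue)"
      proof (rule nn_integral_mono)
        fix x :: "real ^ 'd"
        have "\<bar>cell_step h f x\<bar> powr \<alpha> \<le> K * (\<bar>cell_step h f x - f x\<bar> powr \<alpha> + \<bar>f x\<bar> powr \<alpha>)"
          using abs_add_powr_le[of \<alpha> "cell_step h f x - f x" "f x"] \<alpha> by (simp add: K_def)
        also have "\<dots> \<le> K * (\<bar>cell_step h f x - f x\<bar> powr \<alpha> + K * (\<bar>f x - g x\<bar> powr \<alpha> + \<bar>g x\<bar> powr \<alpha>))"
          using abs_add_powr_le[of \<alpha> "f x - g x" "g x"] \<alpha> K
          by (intro mult_left_mono add_left_mono) (auto simp: K_def)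
        also have "\<dots> \<le> K * (\<bar>cell_step h f x - f x\<bar> powr \<alpha> + K * (\<bar>f x - g x\<bar> powr \<alpha> + B powr \<alpha>))"
          using g(2)[of x] \<alpha> K by (intro mult_left_mono add_left_mono powr_mono2) auto
        finally have "ennreal (\<bar>cell_step h f x\<bar> powr \<alpha>)
            \<le> ennreal (K * \<bar>cell_step h f x - f x\<bar> powr \<alpha> + K * (K * \<bar>f x - g x\<bar> powr \<alpha>) + K * (K * B powr \<alpha>))"
          by (intro ennreal_leI) (simp add: algebra_simps)
        also have "\<dots> = ennreal K * ennreal (\<bar>cell_step h f x - f x\<bar> powr \<alpha>)
          + ennreal K * (ennreal K * ennreal (\<bar>f x - g x\<bar> powr \<alpha>)) + ennreal (K * (K * B powr \<alpha>))"
          using K by (simp add: ennreal_plus ennreal_mult)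
        finally show "ennreal (\<bar>cell_step h f x\<bar> powr \<alpha>) * indicator (cell h k) x
          \<le> ennreal K * ennreal (\<bar>cell_step h f x - f x\<bar> powr \<alpha>)
          + ennreal K * (ennreal K * ennreal (\<bar>f x - g x\<bar> powr \<alpha>))
          + ennreal (K * (K * B powr \<alpha>)) * indicator (cell h k) x"
          by (auto split: split_indicator)
      qed
      also have "\<dots> = ennreal K * powr_mass \<alpha> (\<lambda>x. cell_step h f x - f x)
          + ennreal K * (ennreal K * powr_mass \<alpha> (\<lambda>x. f x - g x))
          + ennreal (K * (K * B powr \<alpha>)) * ennreal (h ^ CARD('d))"
        using h by (simp add: nn_integral_add nn_integral_cmult nn_integral_cmult_indicator powr_mass_def
            emeasure_cell del: emeasure_completion)
      also have "\<dots> \<le> ennreal K * ennreal (e0 / (3 * K)) + ennreal K * (ennreal K * ennreal (e0 / (3 * K * K)))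
          + ennreal (K * (K * B powr \<alpha>)) * ennreal (h ^ CARD('d))"
        using elim(1) fg by (intro add_mono mult_left_mono order_refl) auto
      also have "\<dots> = ennreal (K * (e0 / (3 * K)) + K * (K * (e0 / (3 * K * K))) + K * (K * B powr \<alpha>) * h ^ CARD('d))"
        using K e0 h by (simp flip: ennreal_plus ennreal_mult)
      also have "\<dots> \<le> ennreal e0"
      proof (rule ennreal_leI)
        have "K * (e0 / (3 * K)) = e0 / 3" "K * (K * (e0 / (3 * K * K))) = e0 / 3"
          using K by (simp_all add: field_simps)
        moreover have "K * (K * B powr \<alpha>) * h ^ CARD('d) < e0 / 3" using elim(2) by (simp add: mult_ac)
        ultimately show "K * (e0 / (3 * K)) + K * (K * (e0 / (3 * K * K))) + K * (K * B powr \<alpha>) * h ^ CARD('d) \<le> e0"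
          by linarith
      qed
      finally have "ennreal (\<bar>cell_avg h f k\<bar> powr \<alpha> * h ^ CARD('d)) \<le> ennreal e0"
        using h by (simp add: ennreal_mult)
      then have "\<bar>cell_avg h f k\<bar> powr \<alpha> * h ^ CARD('d) \<le> e0" using e0 by simp
      then have "\<bar>mu_coef \<alpha> \<sigma> h f k\<bar> powr \<alpha> \<le> \<sigma> powr (- \<alpha>) * e0"
        unfolding mu_coef_powr[OF h \<sigma> \<alpha>] by (intro mult_left_mono) (auto simp: mult.commute)
      also have "\<dots> = \<delta> powr \<alpha>" using \<sigma> \<delta> by (simp add: e0_def powr_mult powr_minus)
      finally show "\<bar>mu_coef \<alpha> \<sigma> h f k\<bar> \<le> \<delta>"
        using \<alpha> \<delta> by (metis abs_ge_zero linorder_not_le powr_less_mono2 less_imp_le)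
    qed
  qed
qed

section \<open>Almost sure convergence of series of independent variables\<close>

text \<open>Decompose according to the first \<open>k\<close> at which the partial sum exceeds \<open>2c\<close>. That event depends on
  the first variables only, so with conditional probability at least one half the remaining sum is at
  most \<open>c\<close>, and then the total sum still exceeds \<open>c\<close>.\<close>

lemma (in prob_space) ottaviani_inequality:
  fixes X :: "nat \<Rightarrow> 'a \<Rightarrow> real"
  assumes ind: "indep_vars (\<lambda>_. borel) X UNIV"
    and small: "\<And>k. m \<le> k \<Longrightarrow> k \<le> N \<Longrightarrow> prob {\<omega> \<in> space M. c < \<bar>\<Sum>i=k..<N. X i \<omega>\<bar>} \<le> 1 / 2"
  shows "prob {\<omega> \<in> space M. \<exists>k\<in>{m..N}. 2 * c < \<bar>\<Sum>i=m..<k. X i \<omega>\<bar>}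
    \<le> 2 * prob {\<omega> \<in> space M. c < \<bar>\<Sum>i=m..<N. X i \<omega>\<bar>}"
proof -
  have [measurable]: "X i \<in> borel_measurable M" for i
    using ind by (auto simp: indep_vars_def)
  \<comment> \<open>\<open>A k\<close>: the first passage above \<open>2c\<close> happens at \<open>k\<close>; \<open>B k\<close>: the sum after \<open>k\<close> is small.\<close>
  define A where "A k = {\<omega> \<in> space M. (\<forall>j\<in>{m..<k}. \<bar>\<Sum>i=m..<j. X i \<omega>\<bar> \<le> 2 * c) \<and>
    2 * c < \<bar>\<Sum>i=m..<k. X i \<omega>\<bar>}" for k
  define B where "B k = {\<omega> \<in> space M. \<bar>\<Sum>i=k..<N. X i \<omega>\<bar> \<le> c}" for k
  have [measurable]: "A k \<in> events" "B k \<in> events" for k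
    by (auto simp: A_def B_def)
  have "{\<omega> \<in> space M. \<exists>k\<in>{m..N}. 2 * c < \<bar>\<Sum>i=m..<k. X i \<omega>\<bar>} \<subseteq> (\<Union>k\<in>{m..N}. A k)"
  proof safe
    fix \<omega> k assume \<omega>: "\<omega> \<in> space M" and k: "k \<in> {m..N}" "2 * c < \<bar>\<Sum>i=m..<k. X i \<omega>\<bar>"
    define T where "T k \<longleftrightarrow> m \<le> k \<and> k \<le> N \<and> 2 * c < \<bar>\<Sum>i=m..<k. X i \<omega>\<bar>" for k
    have "T k" using k by (auto simp: T_def)
    then have "T (LEAST k. T k)" by (rule LeastI)
    moreover have "\<not> T j" if "j < (LEAST k. T k)" for j using that by (rule not_less_Least)
    ultimately obtain l where l: "T l" "\<And>j. j < l \<Longrightarrow> \<not> T j" by metis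
    have "\<bar>\<Sum>i=m..<j. X i \<omega>\<bar> \<le> 2 * c" if "j \<in> {m..<l}" for j
      using l(2)[of j] l(1) that by (simp add: T_def)
    with l(1) \<omega> have "\<omega> \<in> A l" "l \<in> {m..N}"
      unfolding A_def by (simp_all add: T_def)
    then show "\<omega> \<in> (\<Union>k\<in>{m..N}. A k)" by blast
  qed
  then have "prob {\<omega> \<in> space M. \<exists>k\<in>{m..N}. 2 * c < \<bar>\<Sum>i=m..<k. X i \<omega>\<bar>} \<le> prob (\<Union>k\<in>{m..N}. A k)"
    by (intro finite_measure_mono) auto
  also have "\<dots> \<le> (\<Sum>k\<in>{m..N}. prob (A k))"
    by (intro finite_measure_subadditive_finite) auto
  also have "\<dots> \<le> (\<Sum>k\<in>{m..N}. 2 * prob (A k \<inter> B k))"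
  proof (rule sum_mono)
    fix k assume k: "k \<in> {m..N}"
    have iv: "indep_var (Pi\<^sub>M {m..<k} (\<lambda>_. borel)) (\<lambda>\<omega>. restrict (\<lambda>i. X i \<omega>) {m..<k})
        (Pi\<^sub>M {k..<N} (\<lambda>_. borel)) (\<lambda>\<omega>. restrict (\<lambda>i. X i \<omega>) {k..<N})"
      by (rule indep_var_restrict[OF ind]) auto
    let ?U = "{y \<in> space (Pi\<^sub>M {m..<k} (\<lambda>_. borel)). (\<forall>j\<in>{m..<k}. \<bar>\<Sum>i=m..<j. y i\<bar> \<le> 2 * c) \<and>
      2 * c < \<bar>\<Sum>i=m..<k. (y i :: real)\<bar>}"
    let ?V = "{y \<in> space (Pi\<^sub>M {k..<N} (\<lambda>_. borel)). \<bar>\<Sum>i=k..<N. (y i :: real)\<bar> \<le> c}"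
    have U: "?U \<in> sets (Pi\<^sub>M {m..<k} (\<lambda>_. borel))"
    proof -
      have [measurable]: "(\<lambda>y. \<Sum>i=m..<j. (y i :: real)) \<in> borel_measurable (Pi\<^sub>M {m..<k} (\<lambda>_. borel))" if "j \<le> k" for j
        using that by (intro borel_measurable_sum measurable_component_singleton) auto
      have "(\<lambda>y. \<bar>\<Sum>i=m..<j. (y i :: real)\<bar>) \<in> borel_measurable (Pi\<^sub>M {m..<k} (\<lambda>_. borel))" if "j \<le> k" for j
        using that by measurable
      then show ?thesis
        by (intro sets.sets_Collect_conj sets.sets_Collect_finite_All borel_measurable_le borel_measurable_less) auto
    qed
    have V: "?V \<in> sets (Pi\<^sub>M {k..<N} (\<lambda>_. borel))"
    proof -
      have [measurable]: "(\<lambda>y. \<Sum>i=k..<N. (y i :: real)) \<in> borel_measurable (Pi\<^sub>M {k..<N} (\<lambda>_. borel))"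
        by (intro borel_measurable_sum measurable_component_singleton) auto
      show ?thesis by measurable
    qed
    have sp: "restrict (\<lambda>i. X i \<omega>) J \<in> space (Pi\<^sub>M J (\<lambda>_. borel))" for \<omega> J
      by (simp add: space_PiM)
    have s1: "(\<Sum>i=m..<j. restrict (\<lambda>i. X i \<omega>) {m..<k} i) = (\<Sum>i=m..<j. X i \<omega>)" if "j \<le> k" for j \<omega>
      using that by (intro sum.cong) auto
    have s2: "(\<Sum>i=k..<N. restrict (\<lambda>i. X i \<omega>) {k..<N} i) = (\<Sum>i=k..<N. X i \<omega>)" for \<omega>
      by (intro sum.cong) auto
    have Aeq: "A k = (\<lambda>\<omega>. restrict (\<lambda>i. X i \<omega>) {m..<k}) -` ?U \<inter> space M"
      unfolding A_def using sp s1 by auto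
    have Beq: "B k = (\<lambda>\<omega>. restrict (\<lambda>i. X i \<omega>) {k..<N}) -` ?V \<inter> space M"
      unfolding B_def using sp s2 by auto
    have AB: "prob (A k \<inter> B k) = prob (A k) * prob (B k)"
    proof -
      have "A k \<inter> B k = (\<lambda>\<omega>. (restrict (\<lambda>i. X i \<omega>) {m..<k}, restrict (\<lambda>i. X i \<omega>) {k..<N})) -` (?U \<times> ?V) \<inter> space M"
        unfolding Aeq Beq by blast
      then show ?thesis
        using indep_varD[OF iv U V] unfolding Aeq Beq by (simp only:)
    qed
    have "B k = space M - {\<omega> \<in> space M. c < \<bar>\<Sum>i=k..<N. X i \<omega>\<bar>}"
      by (auto simp: B_def not_less)
    then have "prob (B k) = 1 - prob {\<omega> \<in> space M. c < \<bar>\<Sum>i=k..<N. X i \<omega>\<bar>}"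
      by (simp add: prob_compl)
    then have "1 / 2 \<le> prob (B k)" using small[of k] k by auto
    from mult_left_mono[OF this, of "prob (A k)"] show "prob (A k) \<le> 2 * prob (A k \<inter> B k)"
      by (simp add: AB)
  qed
  also have "\<dots> = 2 * prob (\<Union>k\<in>{m..N}. A k \<inter> B k)"
  proof -
    have "A j \<inter> A k = {}" if "m \<le> j" "j < k" for j k
    proof safe
      fix \<omega> assume "\<omega> \<in> A j" "\<omega> \<in> A k"
      moreover have "j \<in> {m..<k}" using that by simp
      ultimately show "\<omega> \<in> {}" unfolding A_def by fastforce
    qed
    then have "disjoint_family_on A {m..N}"
      unfolding disjoint_family_on_def by (metis Int_commute atLeastAtMost_iff linorder_neqE_nat)
    then have "disjoint_family_on (\<lambda>k. A k \<inter> B k) {m..N}"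
      unfolding disjoint_family_on_def by blast
    then show ?thesis
      by (subst finite_measure_finite_Union) (auto simp: sum_distrib_left)
  qed
  also have "\<dots> \<le> 2 * prob {\<omega> \<in> space M. c < \<bar>\<Sum>i=m..<N. X i \<omega>\<bar>}"
  proof (intro mult_left_mono finite_measure_mono)
    show "(\<Union>k\<in>{m..N}. A k \<inter> B k) \<subseteq> {\<omega> \<in> space M. c < \<bar>\<Sum>i=m..<N. X i \<omega>\<bar>}"
    proof safe
      fix k \<omega> assume "k \<in> {m..N}" "\<omega> \<in> A k" "\<omega> \<in> B k"
      moreover from this have "(\<Sum>i=m..<N. X i \<omega>) = (\<Sum>i=m..<k. X i \<omega>) + (\<Sum>i=k..<N. X i \<omega>)"
        by (simp add: sum.atLeastLessThan_concat)
      ultimately show "c < \<bar>\<Sum>i=m..<N. X i \<omega>\<bar>"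
        unfolding A_def B_def by auto
    qed (auto simp: A_def)
  qed auto
  finally show ?thesis .
qed

text \<open>By Ottaviani's inequality the probability that the partial sums starting at \<open>m\<close> ever exceed \<open>2c\<close>
  is small for large \<open>m\<close>. Hence for each \<open>c\<close> almost every path stays within \<open>2c\<close> from some point on.\<close>

lemma (in prob_space) AE_summable_if_Cauchy_in_prob:
  fixes X :: "nat \<Rightarrow> 'a \<Rightarrow> real"
  assumes ind: "indep_vars (\<lambda>_. borel) X UNIV"
    and C: "\<And>c \<epsilon>. 0 < c \<Longrightarrow> 0 < \<epsilon> \<Longrightarrow>
      \<exists>m. \<forall>k\<ge>m. \<forall>n\<ge>k. prob {\<omega> \<in> space M. c < \<bar>\<Sum>i=k..<n. X i \<omega>\<bar>} \<le> \<epsilon>"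
  shows "AE \<omega> in M. summable (\<lambda>n. X n \<omega>)"
proof -
  have [measurable]: "X i \<in> borel_measurable M" for i
    using ind by (auto simp: indep_vars_def)
  have AE1: "AE \<omega> in M. \<exists>m. \<forall>k\<ge>m. \<bar>\<Sum>i=m..<k. X i \<omega>\<bar> \<le> 2 * c" if c: "0 < c" for c
  proof -
    define F where "F m = {\<omega> \<in> space M. \<exists>k\<ge>m. 2 * c < \<bar>\<Sum>i=m..<k. X i \<omega>\<bar>}" for m
    have [measurable]: "F m \<in> events" for m unfolding F_def by measurable
    have F: "\<exists>m. prob (F m) \<le> \<epsilon>" if \<epsilon>: "0 < \<epsilon>" for \<epsilon>
    proof -
      from C[OF c, of "min (\<epsilon> / 2) (1 / 2)"] \<epsilon> obtain m where m:
        "\<And>k n. m \<le> k \<Longrightarrow> k \<le> n \<Longrightarrow> prob {\<omega> \<in> space M. c < \<bar>\<Sum>i=k..<n. X i \<omega>\<bar>} \<le> min (\<epsilon> / 2) (1 / 2)"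
        by auto
      define E where "E N = {\<omega> \<in> space M. \<exists>k\<in>{m..N}. 2 * c < \<bar>\<Sum>i=m..<k. X i \<omega>\<bar>}" for N
      have [measurable]: "E N \<in> events" for N unfolding E_def by measurable
      have EN: "prob (E N) \<le> \<epsilon>" for N
      proof (cases "m \<le> N")
        case True
        have "prob (E N) \<le> 2 * prob {\<omega> \<in> space M. c < \<bar>\<Sum>i=m..<N. X i \<omega>\<bar>}"
          unfolding E_def by (rule ottaviani_inequality[OF ind]) (use m in force)
        also have "\<dots> \<le> \<epsilon>" using m[OF order_refl True] by auto
        finally show ?thesis .
      next
        case False
        then have "E N = {}" by (auto simp: E_def)
        then show ?thesis using \<epsilon> by simp
      qed
      have "(\<lambda>N. prob (E N)) \<longlonglongrightarrow> prob (\<Union>N. E N)"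
        by (rule finite_Lim_measure_incseq) (auto simp: E_def incseq_def)
      then have "prob (\<Union>N. E N) \<le> \<epsilon>" by (rule LIMSEQ_le_const2) (use EN in auto)
      moreover have "F m = (\<Union>N. E N)" by (force simp: F_def E_def)
      ultimately show ?thesis by metis
    qed
    have "prob (\<Inter>m. F m) \<le> 0"
    proof (rule field_le_epsilon)
      fix \<epsilon> :: real assume "0 < \<epsilon>"
      then obtain m where "prob (F m) \<le> \<epsilon>" using F by blast
      moreover have "prob (\<Inter>m. F m) \<le> prob (F m)"
        by (intro finite_measure_mono) auto
      ultimately show "prob (\<Inter>m. F m) \<le> 0 + \<epsilon>" by simp
    qed
    then have "prob (\<Inter>m. F m) = 0" by (simp add: measure_le_0_iff)
    then have "(\<Inter>m. F m) \<in> null_sets M"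
      by (intro null_setsI) (auto simp: emeasure_eq_measure)
    from AE_not_in[OF this] AE_space show ?thesis
      by eventually_elim (auto simp: F_def not_less)
  qed
  have "AE \<omega> in M. \<forall>j::nat. \<exists>m. \<forall>k\<ge>m. \<bar>\<Sum>i=m..<k. X i \<omega>\<bar> \<le> 2 * (1 / real (Suc j))"
    unfolding AE_all_countable by (intro allI AE1) simp
  then show ?thesis
  proof eventually_elim
    case (elim \<omega>)
    show ?case
      unfolding summable_Cauchy
    proof (intro allI impI)
      fix e :: real assume e: "0 < e"
      then obtain j where j: "inverse (real (Suc j)) < e / 4"
        using reals_Archimedean[of "e / 4"] by auto
      from elim obtain m where m: "\<And>k. k \<ge> m \<Longrightarrow> \<bar>\<Sum>i=m..<k. X i \<omega>\<bar> \<le> 2 * (1 / real (Suc j))" by blast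
      show "\<exists>N. \<forall>m\<ge>N. \<forall>n. norm (sum (\<lambda>n. X n \<omega>) {m..<n}) < e"
      proof (intro exI[of _ m] allI impI)
        fix k n assume k: "m \<le> k"
        show "norm (sum (\<lambda>n. X n \<omega>) {k..<n}) < e"
        proof (cases "k \<le> n")
          case True
          then have "(\<Sum>i=m..<n. X i \<omega>) = (\<Sum>i=m..<k. X i \<omega>) + (\<Sum>i=k..<n. X i \<omega>)"
            using k by (simp add: sum.atLeastLessThan_concat)
          then show ?thesis
            using m[of k] m[of n] k True j by (simp add: inverse_eq_divide)
        qed (use e in auto)
      qed
    qed
  qed
qed

text \<open>Were the partial sums not Cauchy in probability, there would be blocks of the series, arbitrarily
  far out, that exceed some \<open>c\<close> with probability bounded below. But the characteristic functions of
  the blocks tend to \<open>1\<close>, so that the blocks converge weakly to \<open>0\<close>; testing this with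
  \<open>min 1 (|x| / c)\<close>, which dominates the indicator of \<open>|x| > c\<close>, gives a contradiction.\<close>

lemma (in prob_space) AE_summable_if_char_bound:
  fixes X :: "nat \<Rightarrow> 'a \<Rightarrow> real"
  assumes ind: "indep_vars (\<lambda>_. borel) X UNIV"
    and b: "summable b" and bound: "\<And>n t. cmod (1 - char (distr M borel (X n)) t) \<le> C t * b n"
  shows "AE \<omega> in M. summable (\<lambda>n. X n \<omega>)"
proof (rule AE_summable_if_Cauchy_in_prob[OF ind], rule ccontr)
  have [measurable]: "X i \<in> borel_measurable M" for i
    using ind by (auto simp: indep_vars_def)
  fix c \<epsilon> :: real assume c: "0 < c" and \<epsilon>: "0 < \<epsilon>"
  assume "\<not> (\<exists>m. \<forall>k\<ge>m. \<forall>n\<ge>k. prob {\<omega> \<in> space M. c < \<bar>\<Sum>i=k..<n. X i \<omega>\<bar>} \<le> \<epsilon>)"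
  then have "\<forall>m. \<exists>k n. m \<le> k \<and> k \<le> n \<and> \<epsilon> < prob {\<omega> \<in> space M. c < \<bar>\<Sum>i=k..<n. X i \<omega>\<bar>}"
    by (simp add: not_le)
  then have "\<exists>k n. \<forall>m. m \<le> k m \<and> k m \<le> n m \<and> \<epsilon> < prob {\<omega> \<in> space M. c < \<bar>\<Sum>i=k m..<n m. X i \<omega>\<bar>}"
    by (simp only: choice_iff)
  then obtain k n where kn: "\<And>m. m \<le> k m" "\<And>m. k m \<le> n m"
    "\<And>m. \<epsilon> < prob {\<omega> \<in> space M. c < \<bar>\<Sum>i=k m..<n m. X i \<omega>\<bar>}"
    by blast
  define S where "S m \<omega> = (\<Sum>i=k m..<n m. X i \<omega>)" for m \<omega>
  have [measurable]: "S m \<in> borel_measurable M" for m unfolding S_def by measurable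
  interpret R: prob_space "return borel (0 :: real)"
    by (rule prob_space_return) auto
  have charR: "char (return borel 0) t = 1" for t
    by (simp add: char_def integral_return)
  have "weak_conv_m (\<lambda>m. distr M borel (S m)) (return borel 0)"
  proof (rule levy_continuity)
    show "real_distribution (distr M borel (S m))" for m by simp
    show "real_distribution (return borel (0::real))"
      by unfold_locales auto
    fix t :: real
    have le: "cmod (1 - char (distr M borel (S m)) t) \<le> \<bar>C t\<bar> * \<bar>\<Sum>i=k m..<n m. b i\<bar>" for m
    proof -
      have "char (distr M borel (S m)) t = (\<Prod>i=k m..<n m. char (distr M borel (X i)) t)"
        unfolding S_def by (rule char_distr_sum[OF indep_vars_subset[OF ind]]) auto
      then have "cmod (1 - char (distr M borel (S m)) t)
          = cmod ((\<Prod>i=k m..<n m. 1) - (\<Prod>i=k m..<n m. char (distr M borel (X i)) t))" by simp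
      also have "\<dots> \<le> (\<Sum>i=k m..<n m. cmod (1 - char (distr M borel (X i)) t))"
        by (rule norm_prod_diff) (auto intro!: real_distribution.cmod_char_le_1)
      also have "\<dots> \<le> (\<Sum>i=k m..<n m. C t * b i)" by (intro sum_mono bound)
      also have "\<dots> \<le> \<bar>C t\<bar> * \<bar>\<Sum>i=k m..<n m. b i\<bar>"
        by (simp flip: sum_distrib_left abs_mult)
      finally show ?thesis .
    qed
    have "(\<lambda>m. \<bar>C t\<bar> * \<bar>\<Sum>i=k m..<n m. b i\<bar>) \<longlonglongrightarrow> \<bar>C t\<bar> * 0"
    proof (intro tendsto_mult tendsto_const LIMSEQ_I)
      fix e :: real assume "0 < e"
      with b obtain N where "\<And>m n. m \<ge> N \<Longrightarrow> norm (sum b {m..<n}) < e"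
        unfolding summable_Cauchy by blast
      then show "\<exists>no. \<forall>m\<ge>no. norm (\<bar>\<Sum>i=k m..<n m. b i\<bar> - 0) < e"
        by (intro exI[of _ N]) (simp add: order_trans[OF _ kn(1)])
    qed
    then have T: "(\<lambda>m. \<bar>C t\<bar> * \<bar>\<Sum>i=k m..<n m. b i\<bar>) \<longlonglongrightarrow> 0"
      unfolding mult_zero_right .
    have "(\<lambda>m. 1 - char (distr M borel (S m)) t) \<longlonglongrightarrow> 0"
      by (rule Lim_null_comparison[OF always_eventually T], rule allI, rule le)
    then show "(\<lambda>m. char (distr M borel (S m)) t) \<longlonglongrightarrow> char (return borel 0) t"
      unfolding charR using tendsto_diff[OF tendsto_const[of 1], of "\<lambda>m. 1 - char (distr M borel (S m)) t" 0 sequentially]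
      by simp
  qed
  then have "(\<lambda>m. LINT x|distr M borel (S m). min 1 (\<bar>x\<bar> / c)) \<longlonglongrightarrow> (LINT x|return borel 0. min 1 (\<bar>x\<bar> / c))"
    by (rule weak_conv_imp_integral_bdd_continuous_conv[rotated 2, where B = 1])
      (use c in \<open>auto intro!: continuous_intros real_distribution.intro R.prob_space_axioms
        simp: real_distribution_axioms_def\<close>)
  then have "(\<lambda>m. LINT \<omega>|M. min 1 (\<bar>S m \<omega>\<bar> / c)) \<longlonglongrightarrow> 0"
    by (simp add: integral_return integral_distr)
  moreover have "\<epsilon> \<le> (LINT \<omega>|M. min 1 (\<bar>S m \<omega>\<bar> / c))" for m
  proof -
    have "\<epsilon> \<le> prob {\<omega> \<in> space M. c < \<bar>S m \<omega>\<bar>}"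
      using kn(3)[of m] by (simp add: S_def)
    also have "\<dots> = (LINT \<omega>|M. indicator {\<omega> \<in> space M. c < \<bar>S m \<omega>\<bar>} \<omega>)"
      by simp
    also have "\<dots> \<le> (LINT \<omega>|M. min 1 (\<bar>S m \<omega>\<bar> / c))"
      by (rule integral_mono)
        (use c in \<open>auto intro!: integrable_const_bound[where B = 1] split: split_indicator\<close>)
    finally show ?thesis .
  qed
  ultimately have "\<epsilon> \<le> 0" by (intro LIMSEQ_le_const) auto
  with \<epsilon> show False by simp
qed

section \<open>Continuity of characteristic functions on Euclidean spaces\<close>

text \<open>Finite sums of plane waves. The phase shift \<open>b\<close> makes sines and constants special cases and the
  product of two waves a sum of two waves.\<close>

inductive trigonometric :: "('b::euclidean_space \<Rightarrow> real) \<Rightarrow> bool" where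
  wave: "trigonometric (\<lambda>x. a * cos (\<theta> \<bullet> x + b))"
| add: "trigonometric F \<Longrightarrow> trigonometric G \<Longrightarrow> trigonometric (\<lambda>x. F x + G x)"

lemma trigonometric_const: "trigonometric (\<lambda>_. c)"
  using trigonometric.wave[of c 0 0] by simp

lemma trigonometric_mult:
  assumes "trigonometric F" "trigonometric G"
  shows "trigonometric (\<lambda>x. F x * G x)"
  using assms
proof (induction arbitrary: G)
  case (wave a \<theta> b)
  from wave.prems show ?case
  proof induction
    case (wave a' \<theta>' b')
    have "(\<lambda>x. (a * cos (\<theta> \<bullet> x + b)) * (a' * cos (\<theta>' \<bullet> x + b')))
        = (\<lambda>x. (a * a' / 2) * cos ((\<theta> - \<theta>') \<bullet> x + (b - b')) + (a * a' / 2) * cos ((\<theta> + \<theta>') \<bullet> x + (b + b')))"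
    proof
      fix x
      have "cos (\<theta> \<bullet> x + b) * cos (\<theta>' \<bullet> x + b')
          = (cos ((\<theta> - \<theta>') \<bullet> x + (b - b')) + cos ((\<theta> + \<theta>') \<bullet> x + (b + b'))) / 2"
      proof -
        have "(\<theta> - \<theta>') \<bullet> x + (b - b') = (\<theta> \<bullet> x + b) - (\<theta>' \<bullet> x + b')"
          "(\<theta> + \<theta>') \<bullet> x + (b + b') = (\<theta> \<bullet> x + b) + (\<theta>' \<bullet> x + b')"
          by (simp_all add: inner_diff_left inner_add_left)
        then show ?thesis by (simp only: cos_times_cos)
      qed
      then show "(a * cos (\<theta> \<bullet> x + b)) * (a' * cos (\<theta>' \<bullet> x + b'))
        = (a * a' / 2) * cos ((\<theta> - \<theta>') \<bullet> x + (b - b')) + (a * a' / 2) * cos ((\<theta> + \<theta>') \<bullet> x + (b + b'))"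
        by (simp add: field_simps)
    qed
    then show ?case by (simp only:) (intro trigonometric.intros)
  next
    case (add F G)
    then show ?case by (simp add: distrib_left trigonometric.add)
  qed
next
  case (add F G' G)
  then show ?case by (simp add: distrib_right trigonometric.add)
qed

lemma trigonometric_continuous: "trigonometric F \<Longrightarrow> continuous_on A F"
  by (induction rule: trigonometric.induct) (auto intro!: continuous_intros)

lemma trigonometric_bounded: "trigonometric F \<Longrightarrow> \<exists>B>0. \<forall>x. \<bar>F x\<bar> \<le> B"
proof (induction rule: trigonometric.induct)
  case (wave a \<theta> b)
  have "\<bar>a * cos (\<theta> \<bullet> x + b)\<bar> \<le> \<bar>a\<bar> + 1" for x
    using mult_left_mono[OF abs_cos_le_one[of "\<theta> \<bullet> x + b"], of "\<bar>a\<bar>"] by (simp add: abs_mult)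
  then show ?case by (intro exI[of _ "\<bar>a\<bar> + 1"]) auto
next
  case (add F G)
  then obtain B C where "0 < B" "0 < C" "\<And>x. \<bar>F x\<bar> \<le> B" "\<And>x. \<bar>G x\<bar> \<le> C" by blast
  then show ?case
    by (intro exI[of _ "B + C"] conjI allI) (auto intro: order_trans[OF abs_triangle_ineq add_mono])
qed

lemma trigonometric_polynomial:
  assumes "real_polynomial_function Q" "trigonometric F"
  shows "trigonometric (\<lambda>x. Q (F x :: real))"
  using assms
proof induction
  case (linear h)
  have h: "h y = h 1 * y" for y
    using linear_scale[OF bounded_linear.linear[OF linear(1)], of y 1] by (simp add: mult.commute)
  have "(\<lambda>x. h (F x)) = (\<lambda>x. h 1 * F x)" by (rule ext) (rule h)
  then show ?case by (simp add: trigonometric_mult[OF trigonometric_const linear(2)])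
next
  case (const c)
  show ?case by (rule trigonometric_const)
next
  case (add Q R)
  then show ?case by (intro trigonometric.add) simp_all
next
  case (mult Q R)
  then show ?case by (intro trigonometric_mult) simp_all
qed

lemma trigonometric_separates:
  assumes "x \<noteq> y"
  shows "\<exists>F. trigonometric F \<and> F x \<noteq> F y"
proof -
  define \<theta> where "\<theta> = (x - y) /\<^sub>R ((x - y) \<bullet> (x - y))"
  have "(x - y) \<bullet> (x - y) \<noteq> 0" using assms by simp
  then have 1: "\<theta> \<bullet> x - \<theta> \<bullet> y = 1"
    unfolding inner_diff_right[symmetric] by (simp add: \<theta>_def)
  have "cos (\<theta> \<bullet> y - \<theta> \<bullet> x) \<noteq> (1 :: real)"
  proof -
    have "\<theta> \<bullet> y - \<theta> \<bullet> x = - 1" using 1 by simp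
    moreover have "cos 1 < cos (0 :: real)"
      by (rule cos_monotone_0_pi) (use pi_gt3 in auto)
    ultimately show ?thesis by simp
  qed
  then have "1 * cos (\<theta> \<bullet> x + - (\<theta> \<bullet> x)) \<noteq> 1 * cos (\<theta> \<bullet> y + - (\<theta> \<bullet> x))" by simp
  then show ?thesis using trigonometric.wave[of 1 \<theta> "- (\<theta> \<bullet> x)"] by blast
qed

text \<open>Stone--Weierstrass gives an approximation on \<open>K\<close> that may be large elsewhere. It is clipped by a
  polynomial that approximates the clipping function on the range of the approximation; the
  composition is again trigonometric, and its bound now holds on the whole space.\<close>

lemma trigonometric_approx:
  fixes g :: "'b::euclidean_space \<Rightarrow> real"
  assumes K: "compact K" and g: "continuous_on UNIV g" and C: "0 < C" "\<And>x. \<bar>g x\<bar> \<le> C" and \<epsilon>: "0 < \<epsilon>"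
  shows "\<exists>F. trigonometric F \<and> (\<forall>x\<in>K. \<bar>g x - F x\<bar> \<le> \<epsilon>) \<and> (\<forall>x. \<bar>F x\<bar> \<le> C + \<epsilon>)"
proof -
  have "\<exists>p. trigonometric p \<and> (\<forall>x\<in>K. \<bar>g x - p x\<bar> < \<epsilon> / 2)"
  proof (rule Stone_Weierstrass_HOL[OF K])
    show "trigonometric (\<lambda>x. c)" for c by (rule trigonometric_const)
    show "continuous_on K F" if "trigonometric F" for F using that by (rule trigonometric_continuous)
    show "trigonometric (\<lambda>x. F x + G x)" if "trigonometric F \<and> trigonometric G" for F G
      using that by (blast intro: trigonometric.add)
    show "trigonometric (\<lambda>x. F x * G x)" if "trigonometric F \<and> trigonometric G" for F G
      using that by (blast intro: trigonometric_mult)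
    show "\<exists>F. trigonometric F \<and> F x \<noteq> F y" if "x \<in> K \<and> y \<in> K \<and> x \<noteq> y" for x y
      using that by (intro trigonometric_separates) simp
    show "continuous_on K g" using g by (rule continuous_on_subset) simp
    show "0 < \<epsilon> / 2" using \<epsilon> by simp
  qed
  then obtain p where p: "trigonometric p" "\<And>x. x \<in> K \<Longrightarrow> \<bar>g x - p x\<bar> < \<epsilon> / 2" by blast
  from trigonometric_bounded[OF p(1)] obtain B where B: "\<And>x. \<bar>p x\<bar> \<le> B" by blast
  let ?c = "\<lambda>y. max (- C) (min C y)"
  have "continuous_on {-B..B} ?c" by (intro continuous_intros)
  from Stone_Weierstrass_real_polynomial_function[OF compact_Icc this, of "\<epsilon> / 2"] \<epsilon>
  obtain Q where Q: "real_polynomial_function Q" "\<And>y. y \<in> {-B..B} \<Longrightarrow> \<bar>?c y - Q y\<bar> < \<epsilon> / 2" by auto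
  have Qp: "\<bar>?c (p x) - Q (p x)\<bar> < \<epsilon> / 2" for x
    using Q(2)[of "p x"] B[of x] by (simp add: abs_le_iff minus_le_iff)
  show ?thesis
  proof (intro exI[of _ "\<lambda>x. Q (p x)"] conjI ballI allI)
    show "trigonometric (\<lambda>x. Q (p x))" by (rule trigonometric_polynomial[OF Q(1) p(1)])
    show "\<bar>g x - Q (p x)\<bar> \<le> \<epsilon>" if "x \<in> K" for x
    proof -
      have "\<bar>g x - ?c (p x)\<bar> \<le> \<bar>g x - p x\<bar>" using C(2)[of x] by (auto simp: max_def min_def)
      then show ?thesis using p(2)[OF that] Qp[of x] by linarith
    qed
    show "\<bar>Q (p x)\<bar> \<le> C + \<epsilon>" for x
    proof -
      have "\<bar>?c (p x)\<bar> \<le> C" using C(1) by auto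
      then show ?thesis using Qp[of x] \<epsilon> by linarith
    qed
  qed
qed

text \<open>The expectations of trigonometric functions converge by hypothesis. A bounded continuous \<open>g\<close> is
  close to a trigonometric \<open>F\<close> on a cube, and outside the cube both are bounded by essentially the
  same constant. The mass outside the cube is controlled by the marginals, to which the
  one-dimensional continuity theorem applies.\<close>

theorem levy_continuity_euclidean:
  fixes \<mu> :: "nat \<Rightarrow> 'b::euclidean_space measure" and P :: "'b measure" and g :: "'b \<Rightarrow> real"
  assumes \<mu>: "\<And>n. prob_space (\<mu> n)" "\<And>n. sets (\<mu> n) = sets borel"
    and P: "prob_space P" "sets P = sets borel"
    and char: "\<And>\<theta>. (\<lambda>n. CLINT x|\<mu> n. iexp (\<theta> \<bullet> x)) \<longlonglongrightarrow> (CLINT x|P. iexp (\<theta> \<bullet> x))"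
    and g: "continuous_on UNIV g" "bounded (range g)"
  shows "(\<lambda>n. LINT x|\<mu> n. g x) \<longlonglongrightarrow> (LINT x|P. g x)"
proof -
  interpret m: prob_space "\<mu> n" for n by fact
  interpret P: prob_space P by fact
  have [measurable_cong, simp]: "sets (\<mu> n) = sets borel" "sets P = sets borel" for n by fact+
  have int: "integrable (\<mu> n) f" "integrable P f" if "continuous_on UNIV f" "\<And>x. \<bar>f x\<bar> \<le> B"
    for n B and f :: "'b \<Rightarrow> real"
  proof -
    have [measurable]: "f \<in> borel_measurable borel"
      using that(1) by (rule borel_measurable_continuous_onI)
    show "integrable (\<mu> n) f" by (rule m.integrable_const_bound[where B = B]) (use that(2) in auto)
    show "integrable P f" by (rule P.integrable_const_bound[where B = B]) (use that(2) in auto)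
  qed
  have trig: "(\<lambda>n. LINT x|\<mu> n. F x) \<longlonglongrightarrow> (LINT x|P. F x)" if "trigonometric F" for F
    using that
  proof induction
    case (wave a \<theta> b)
    have *: "(LINT x|Q. a * cos (\<theta> \<bullet> x + b)) = Re (of_real a * iexp b * (CLINT x|Q. iexp (\<theta> \<bullet> x)))"
      if Q: "prob_space Q" and s: "sets Q = sets borel" for Q
    proof -
      interpret Q: prob_space Q by fact
      note [measurable_cong] = s
      have "(\<lambda>x. iexp (\<theta> \<bullet> x)) \<in> borel_measurable borel" by measurable
      then have I: "integrable Q (\<lambda>x. iexp (\<theta> \<bullet> x))"
        by (intro Q.integrable_const_bound[where B = 1]) (auto simp: measurable_cong_sets[OF s refl])
      have "of_real a * iexp b * (CLINT x|Q. iexp (\<theta> \<bullet> x)) = (CLINT x|Q. of_real a * iexp b * iexp (\<theta> \<bullet> x))"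
        by simp
      also have "Re \<dots> = (LINT x|Q. Re (of_real a * iexp b * iexp (\<theta> \<bullet> x)))"
        by (rule integral_Re[symmetric]) (use I in auto)
      also have "\<dots> = (LINT x|Q. a * cos (\<theta> \<bullet> x + b))"
      proof (rule Bochner_Integration.integral_cong)
        fix x
        have "iexp b * iexp (\<theta> \<bullet> x) = iexp (\<theta> \<bullet> x + b)"
          by (simp add: exp_add[symmetric] algebra_simps)
        moreover have "Re (of_real a * iexp y) = a * cos y" for y
          by (simp add: Re_exp)
        ultimately show "Re (of_real a * iexp b * iexp (\<theta> \<bullet> x)) = a * cos (\<theta> \<bullet> x + b)"
          by (simp only: mult.assoc)
      qed simp
      finally show ?thesis by simp
    qed
    show ?case
      unfolding *[OF \<mu>] *[OF P] by (intro tendsto_intros char)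
  next
    case (add F G)
    from trigonometric_bounded[OF add(1)] trigonometric_bounded[OF add(2)] obtain B C where
      "\<And>x. \<bar>F x\<bar> \<le> B" "\<And>x. \<bar>G x\<bar> \<le> C" by blast
    with add(1,2) have "integrable (\<mu> n) F" "integrable (\<mu> n) G" "integrable P F" "integrable P G" for n
      by (auto intro!: int trigonometric_continuous)
    then show ?case using tendsto_add[OF add.IH] by simp
  qed
  \<comment> \<open>A continuous substitute for the indicator of \<open>|y| > R\<close>; it equals \<open>1\<close> only from \<open>R + 1\<close> on.\<close>
  define f where "f R y = min 1 (max 0 (\<bar>y\<bar> - R))" for R y :: real
  have f01: "0 \<le> f R y" "f R y \<le> 1" for R y by (auto simp: f_def)
  have f1: "\<bar>f R y\<bar> \<le> 1" for R y by (auto simp: f_def)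
  have fc: "continuous_on A (f R)" for A R unfolding f_def by (intro continuous_intros)
  have fbc: "continuous_on A (\<lambda>x. f R (x \<bullet> b))" for A R and b :: 'b
    by (rule continuous_on_compose2[OF fc]) (auto intro!: continuous_intros)
  have coord: "(\<lambda>n. LINT x|\<mu> n. f R (x \<bullet> b)) \<longlonglongrightarrow> (LINT x|P. f R (x \<bullet> b))" for R and b :: 'b
  proof -
    have ch: "char (distr Q borel (\<lambda>x. x \<bullet> b)) t = (CLINT x|Q. iexp ((t *\<^sub>R b) \<bullet> x))"
      if "sets Q = sets borel" for Q t
      unfolding char_def
      by (subst integral_distr) (auto simp: measurable_cong_sets[OF that refl] inner_commute)
    have "weak_conv_m (\<lambda>n. distr (\<mu> n) borel (\<lambda>x. x \<bullet> b)) (distr P borel (\<lambda>x. x \<bullet> b))"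
    proof (rule levy_continuity)
      show "(\<lambda>n. char (distr (\<mu> n) borel (\<lambda>x. x \<bullet> b)) t) \<longlonglongrightarrow> char (distr P borel (\<lambda>x. x \<bullet> b)) t" for t
        unfolding ch[OF \<mu>(2)] ch[OF P(2)] by (rule char)
    qed auto
    then have "(\<lambda>n. LINT y|distr (\<mu> n) borel (\<lambda>x. x \<bullet> b). f R y) \<longlonglongrightarrow> (LINT y|distr P borel (\<lambda>x. x \<bullet> b). f R y)"
      using fc[of UNIV R] f01
      by (intro weak_conv_imp_integral_bdd_continuous_conv[where B = 1])
        (auto simp: continuous_on_eq_continuous_at)
    moreover have "f R \<in> borel_measurable borel" by (rule borel_measurable_continuous_onI[OF fc])
    ultimately show ?thesis
      by (subst (asm) (1 2) integral_distr) auto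
  qed
  from g(2) obtain C0 where C0: "\<And>x. \<bar>g x\<bar> \<le> C0" by (auto simp: bounded_iff)
  define C where "C = max C0 1"
  have C: "0 < C" "\<And>x. \<bar>g x\<bar> \<le> C" using C0 by (auto simp: C_def le_max_iff_disj)
  show ?thesis
  proof (rule LIMSEQ_I)
    fix e :: real assume e: "0 < e"
    define \<epsilon> where "\<epsilon> = min 1 (e / 6)"
    define \<epsilon>' where "\<epsilon>' = e / (6 * (2 * C + 1))"
    have \<epsilon>: "0 < \<epsilon>" "\<epsilon> \<le> 1" "\<epsilon> \<le> e / 6" "0 < \<epsilon>'" using e C by (auto simp: \<epsilon>_def \<epsilon>'_def)
    have e6: "0 < e / 6" using e by simp
    define H where "H R x = (\<Sum>b\<in>Basis. f R (x \<bullet> b))" for R and x :: 'b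
    have H0: "0 \<le> H R x" for R x unfolding H_def by (intro sum_nonneg f01)
    have Hc: "continuous_on A (H R)" for A R unfolding H_def by (intro continuous_intros fbc)
    have Hb: "\<bar>H R x\<bar> \<le> real DIM('b)" for R x
      using H0[of R x] sum_mono[of Basis "\<lambda>b. f R (x \<bullet> b)" "\<lambda>_. 1"] f01 by (auto simp: H_def)
    note Hint = int[OF Hc Hb]
    have HL: "(\<lambda>n. LINT x|\<mu> n. H R x) \<longlonglongrightarrow> (LINT x|P. H R x)" for R
    proof -
      have "(LINT x|\<mu> n. H R x) = (\<Sum>b\<in>Basis. LINT x|\<mu> n. f R (x \<bullet> b))" for n
        unfolding H_def by (intro Bochner_Integration.integral_sum int[OF fbc f1])
      moreover have "(LINT x|P. H R x) = (\<Sum>b\<in>Basis. LINT x|P. f R (x \<bullet> b))"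
        unfolding H_def by (intro Bochner_Integration.integral_sum int[OF fbc f1])
      ultimately show ?thesis by (simp add: tendsto_sum coord)
    qed
    have "(\<lambda>R. LINT x|P. H (real R) x) \<longlonglongrightarrow> (LINT x|P. 0)"
    proof (rule integral_dominated_convergence[where w = "\<lambda>_. real DIM('b)"])
      have "(\<lambda>R. H (real R) x) \<longlonglongrightarrow> 0" for x
      proof (rule tendsto_eventually)
        obtain R0 :: nat where R0: "norm x \<le> real R0" using real_arch_simple by blast
        show "\<forall>\<^sub>F R in sequentially. H (real R) x = 0"
          using eventually_ge_at_top[of R0]
        proof eventually_elim
          case (elim R)
          have "f (real R) (x \<bullet> b) = 0" if "b \<in> Basis" for b
            using Basis_le_norm[OF that, of x] R0 elim by (auto simp: f_def)
          then show ?case by (simp add: H_def)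
        qed
      qed
      then show "AE x in P. (\<lambda>R. H (real R) x) \<longlonglongrightarrow> 0" by simp
      show "AE x in P. norm (H (real R) x) \<le> real DIM('b)" for R using Hb by simp
      show "H (real R) \<in> borel_measurable P" for R using Hint(2) by blast
    qed auto
    then have "(\<lambda>R. LINT x|P. H (real R) x) \<longlonglongrightarrow> 0" by simp
    from eventually_happens[OF order_tendstoD(2)[OF this \<epsilon>(4)]]
    obtain R :: nat where R: "(LINT x|P. H (real R) x) < \<epsilon>'" by auto
    \<comment> \<open>Outside this cube some coordinate exceeds \<open>R + 1\<close> in modulus, so that \<open>H\<close> is at least \<open>1\<close> there.\<close>
    define K :: "'b set" where "K = cbox (- (real R + 1) *\<^sub>R One) ((real R + 1) *\<^sub>R One)"
    have H1: "1 \<le> H (real R) x" if "x \<notin> K" for x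
    proof -
      from that obtain b where b: "b \<in> Basis" "\<not> (\<bar>x \<bullet> b\<bar> \<le> real R + 1)"
        by (auto simp: K_def mem_box abs_le_iff)
      then have "f (real R) (x \<bullet> b) = 1" by (auto simp: f_def)
      moreover have "f (real R) (x \<bullet> b) \<le> H (real R) x"
        unfolding H_def by (rule member_le_sum) (use b f01 in auto)
      ultimately show ?thesis by simp
    qed
    have "compact K" by (simp add: K_def compact_cbox)
    from trigonometric_approx[OF this g(1) C \<epsilon>(1)] obtain F where
      F: "trigonometric F" "\<And>x. x \<in> K \<Longrightarrow> \<bar>g x - F x\<bar> \<le> \<epsilon>" "\<And>x. \<bar>F x\<bar> \<le> C + \<epsilon>" by blast
    have gF: "\<bar>g x - F x\<bar> \<le> \<epsilon> + (2 * C + 1) * H (real R) x" for x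
    proof (cases "x \<in> K")
      case True
      have "0 \<le> (2 * C + 1) * H (real R) x"
        using H0[of "real R" x] C(1) by (intro mult_nonneg_nonneg) auto
      then show ?thesis using F(2)[OF True] by linarith
    next
      case False
      have "\<bar>g x - F x\<bar> \<le> (2 * C + 1) * 1" 
        using abs_triangle_ineq4[of "g x" "F x"] C(2)[of x] F(3)[of x] \<epsilon>(2) by simp
      also have "\<dots> \<le> (2 * C + 1) * H (real R) x" using H1[OF False] C by (intro mult_left_mono) auto
      finally show ?thesis using \<epsilon> by linarith
    qed
    have diff: "\<bar>(LINT x|Q. g x) - (LINT x|Q. F x)\<bar> \<le> \<epsilon> + (2 * C + 1) * (LINT x|Q. H (real R) x)"
      if Q: "prob_space Q" and i: "integrable Q g" "integrable Q F" "integrable Q (H (real R))" for Q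
    proof -
      interpret Q: prob_space Q by fact
      have "\<bar>(LINT x|Q. g x) - (LINT x|Q. F x)\<bar> = \<bar>LINT x|Q. g x - F x\<bar>" using i by simp
      also have "\<dots> \<le> (LINT x|Q. \<bar>g x - F x\<bar>)" by (rule integral_abs_bound)
      also have "\<dots> \<le> (LINT x|Q. \<epsilon> + (2 * C + 1) * H (real R) x)"
        by (intro integral_mono) (use i gF in auto)
      also have "\<dots> = \<epsilon> + (2 * C + 1) * (LINT x|Q. H (real R) x)"
        using i by (simp add: Q.prob_space)
      finally show ?thesis .
    qed
    have dn: "\<bar>(LINT x|\<mu> n. g x) - (LINT x|\<mu> n. F x)\<bar> \<le> \<epsilon> + (2 * C + 1) * (LINT x|\<mu> n. H (real R) x)" for n
      by (intro diff \<mu> int[OF g(1) C(2)] int[OF trigonometric_continuous[OF F(1)] F(3)] Hint)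
    have dP: "\<bar>(LINT x|P. g x) - (LINT x|P. F x)\<bar> \<le> \<epsilon> + (2 * C + 1) * (LINT x|P. H (real R) x)"
      by (intro diff P int[OF g(1) C(2)] int[OF trigonometric_continuous[OF F(1)] F(3)] Hint)
    have small: "(2 * C + 1) * s < e / 6" if "s < \<epsilon>'" for s
    proof -
      have "(2 * C + 1) * s < (2 * C + 1) * \<epsilon>'" using that C by (intro mult_strict_left_mono) auto
      also have "\<dots> = e / 6" using C by (simp add: \<epsilon>'_def field_simps)
      finally show ?thesis .
    qed
    have "\<forall>\<^sub>F n in sequentially. norm ((LINT x|\<mu> n. g x) - (LINT x|P. g x)) < e"
      using order_tendstoD(2)[OF HL R] tendstoD[OF trig[OF F(1)] e6]
    proof eventually_elim
      case (elim n)
      then show ?case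
        using dn[of n] dP small[OF R] small[OF elim(1)] \<epsilon>(3) unfolding dist_real_def real_norm_def
        by linarith
    qed
    then show "\<exists>no. \<forall>n\<ge>no. norm ((LINT x|\<mu> n. g x) - (LINT x|P. g x)) < e"
      by (simp add: eventually_sequentially)
  qed
qed

section \<open>Weak convergence to the stable noise\<close>

lemma (in prob_space) char_scaled:
  assumes [measurable]: "X \<in> borel_measurable M"
  shows "char (distr M borel (\<lambda>\<omega>. a * X \<omega>)) t = char (distr M borel X) (a * t)"
  unfolding char_def by (subst (1 2) integral_distr) (auto simp: mult_ac)

lemma (in prob_space) stable_series_summable:
  fixes X :: "nat \<Rightarrow> 'a \<Rightarrow> real"
  assumes ind: "indep_vars (\<lambda>_. borel) X UNIV" and law: "\<And>n. distr M borel (X n) = P"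
    and nd: "normal_domain_of_attraction \<alpha> \<sigma> \<nu> P" and \<alpha>: "0 < \<alpha>" and \<sigma>: "0 < \<sigma>"
    and a: "summable (\<lambda>n. \<bar>a n\<bar> powr \<alpha>)"
  shows "AE \<omega> in M. summable (\<lambda>n. a n * X n \<omega>)"
proof -
  have X [measurable]: "X n \<in> borel_measurable M" for n using ind by (auto simp: indep_vars_def)
  have P: "real_distribution P" using real_distribution_distr[OF X[of 0]] by (simp add: law)
  from char_minus_one_bound[OF P nd \<alpha> \<sigma>] obtain C where
    C: "\<And>t. cmod (1 - char P t) \<le> C * \<bar>t\<bar> powr \<alpha>" by blast
  show ?thesis
  proof (rule AE_summable_if_char_bound[OF _ a])
    show "indep_vars (\<lambda>_. borel) (\<lambda>n \<omega>. a n * X n \<omega>) UNIV"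
      by (rule indep_vars_compose2[OF ind]) auto
    fix n t
    show "cmod (1 - char (distr M borel (\<lambda>\<omega>. a n * X n \<omega>)) t) \<le> (C * \<bar>t\<bar> powr \<alpha>) * \<bar>a n\<bar> powr \<alpha>"
      using C[of "a n * t"] by (simp add: char_scaled law abs_mult powr_mult mult_ac)
  qed
qed

text \<open>The characteristic function of the sum is the limit of the finite products of the
  \<open>\<phi> (a\<^sub>n) = exp (- G (\<sigma> a\<^sub>n) + r\<^sub>n)\<close>.\<close>

lemma (in prob_space) stable_series_char:
  fixes X :: "nat \<Rightarrow> 'a \<Rightarrow> real"
  assumes ind: "indep_vars (\<lambda>_. borel) X UNIV" and law: "\<And>n. distr M borel (X n) = P"
    and nd: "normal_domain_of_attraction \<alpha> \<sigma> \<nu> P" and \<alpha>: "0 < \<alpha>" and \<sigma>: "0 < \<sigma>"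
    and expansion: "\<And>t. \<bar>t\<bar> \<le> \<delta> \<Longrightarrow> \<exists>r. cmod r \<le> \<epsilon> * \<bar>t\<bar> powr \<alpha> \<and> char P t = exp (- stable_exponent \<alpha> \<nu> (\<sigma> * t) + r)"
    and small: "\<And>n. \<bar>a n\<bar> \<le> \<delta>"
    and A: "(\<lambda>n. \<bar>a n\<bar> powr \<alpha>) sums A"
    and J: "(\<lambda>n. stable_exponent \<alpha> \<nu> (\<sigma> * a n)) sums J"
  shows "\<exists>\<rho>. cmod \<rho> \<le> \<epsilon> * A \<and> (CLINT \<omega>|M. iexp (\<Sum>n. a n * X n \<omega>)) = exp (- J + \<rho>)"
proof -
  have X [measurable]: "X n \<in> borel_measurable M" for n using ind by (auto simp: indep_vars_def)
  from expansion[OF small] obtain r where r: "\<And>n. cmod (r n) \<le> \<epsilon> * \<bar>a n\<bar> powr \<alpha>"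
    "\<And>n. char P (a n) = exp (- stable_exponent \<alpha> \<nu> (\<sigma> * a n) + r n)" by metis
  have sA: "(\<lambda>n. \<epsilon> * \<bar>a n\<bar> powr \<alpha>) sums (\<epsilon> * A)" by (rule sums_mult[OF A])
  have sr: "summable (\<lambda>n. cmod (r n))"
    by (rule summable_comparison_test'[OF sums_summable[OF sA], of 0]) (use r(1) in auto)
  define \<rho> where "\<rho> = suminf r"
  have "cmod \<rho> \<le> (\<Sum>n. cmod (r n))" unfolding \<rho>_def by (rule summable_norm[OF sr])
  also have "\<dots> \<le> (\<Sum>n. \<epsilon> * \<bar>a n\<bar> powr \<alpha>)" by (rule suminf_le[OF r(1) sr sums_summable[OF sA]])
  also have "\<dots> = \<epsilon> * A" by (rule sums_unique[OF sA, symmetric])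
  finally have \<rho>: "cmod \<rho> \<le> \<epsilon> * A" .
  have r\<rho>: "r sums \<rho>" unfolding \<rho>_def by (intro summable_sums summable_norm_cancel[OF sr])
  define S where "S n \<omega> = (\<Sum>i<n. a i * X i \<omega>)" for n \<omega>
  have [measurable]: "S n \<in> borel_measurable M" for n unfolding S_def by measurable
  have Sn: "(CLINT \<omega>|M. iexp (S n \<omega>)) = exp (\<Sum>i<n. - stable_exponent \<alpha> \<nu> (\<sigma> * a i) + r i)" for n
  proof -
    have ind': "indep_vars (\<lambda>_. borel) (\<lambda>i \<omega>. a i * X i \<omega>) {..<n}"
      by (rule indep_vars_subset[OF indep_vars_compose2[OF ind]]) auto
    have "(CLINT \<omega>|M. iexp (S n \<omega>)) = char (distr M borel (\<lambda>\<omega>. \<Sum>i<n. a i * X i \<omega>)) 1"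
      unfolding char_def S_def by (subst integral_distr) auto
    also have "\<dots> = (\<Prod>i<n. char (distr M borel (\<lambda>\<omega>. a i * X i \<omega>)) 1)"
      by (rule char_distr_sum[OF ind'])
    also have "\<dots> = (\<Prod>i<n. exp (- stable_exponent \<alpha> \<nu> (\<sigma> * a i) + r i))"
      by (intro prod.cong refl) (simp only: char_scaled[OF X] law mult_1_right r(2))
    finally show ?thesis by (simp add: exp_sum)
  qed
  have "(\<lambda>n. CLINT \<omega>|M. iexp (S n \<omega>)) \<longlonglongrightarrow> (CLINT \<omega>|M. iexp (\<Sum>n. a n * X n \<omega>))"
  proof (rule integral_dominated_convergence[where w = "\<lambda>_. 1"])
    show "AE \<omega> in M. (\<lambda>n. iexp (S n \<omega>)) \<longlonglongrightarrow> iexp (\<Sum>n. a n * X n \<omega>)"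
      using stable_series_summable[OF ind law nd \<alpha> \<sigma> sums_summable[OF A]]
    proof eventually_elim
      case (elim \<omega>)
      then have "(\<lambda>n. S n \<omega>) \<longlonglongrightarrow> (\<Sum>n. a n * X n \<omega>)" unfolding S_def by (rule summable_LIMSEQ)
      then show ?case by (intro tendsto_intros)
    qed
  qed auto
  moreover have "(\<lambda>n. CLINT \<omega>|M. iexp (S n \<omega>)) \<longlonglongrightarrow> exp (- J + \<rho>)"
    unfolding Sn using sums_add[OF sums_minus[OF J] r\<rho>] by (intro tendsto_exp) (simp add: sums_def)
  ultimately show ?thesis using \<rho> LIMSEQ_unique by blast
qed

text \<open>The sequence reads off disjoint singletons of indices, one for each \<open>n\<close>.\<close>

lemma (in prob_space) indep_vars_bij_sequence:
  assumes ind: "indep_vars (\<lambda>_. borel) \<xi> UNIV" and e: "bij e"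
  shows "indep_vars (\<lambda>_. borel) (\<lambda>n::nat. \<xi> (e n) :: 'a \<Rightarrow> real) UNIV"
proof -
  have "indep_vars (\<lambda>n. Pi\<^sub>M {e n} (\<lambda>_. borel)) (\<lambda>n \<omega>. restrict (\<lambda>i. \<xi> i \<omega>) {e n}) UNIV"
    by (rule indep_vars_restrict[OF ind])
      (use bij_is_inj[OF e] in \<open>auto simp: disjoint_family_on_def dest: injD\<close>)
  then have "indep_vars (\<lambda>_. borel) (\<lambda>n \<omega>. (\<lambda>y. y (e n)) (restrict (\<lambda>i. \<xi> i \<omega>) {e n})) UNIV"
    by (rule indep_vars_compose2) (auto intro: measurable_component_singleton)
  then show ?thesis by simp
qed

lemma (in prob_space) mu_summable:
  fixes \<xi> :: "int ^ 'd::finite \<Rightarrow> 'a \<Rightarrow> real" and f :: "real ^ 'd \<Rightarrow> real"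
  assumes ind: "indep_vars (\<lambda>_. borel) \<xi> UNIV" and law: "\<And>k. distr M borel (\<xi> k) = P"
    and nd: "normal_domain_of_attraction \<alpha> \<sigma> \<nu> P" and \<alpha>: "0 < \<alpha>" and \<sigma>: "0 < \<sigma>" and e: "bij e"
    and f: "f \<in> F_space \<alpha>" and h: "0 < h"
  shows "AE \<omega> in M. summable (\<lambda>n. mu_term \<alpha> \<sigma> \<xi> h f (e n) \<omega>)"
  unfolding mu_term_eq_coef
  by (rule stable_series_summable[OF indep_vars_bij_sequence[OF ind e] law nd \<alpha> \<sigma>
      sums_summable[OF mu_coef_sums(2)[OF f h \<sigma> \<alpha> e]]])

text \<open>The tolerance in the expansion of \<open>\<phi>\<close> is chosen after the limit: \<open>\<Sum>\<^sub>k |a\<^sub>k|\<^sup>\<alpha>\<close> is \<open>\<sigma>\<close> to the power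
  \<open>- \<alpha>\<close> times the real part of \<open>\<integral> G (f\<^sub>h)\<close>, hence eventually bounded by a constant that depends
  only on \<open>f\<close>.\<close>

lemma (in prob_space) mu_char_tendsto:
  fixes \<xi> :: "int ^ 'd::finite \<Rightarrow> 'a \<Rightarrow> real" and f :: "real ^ 'd \<Rightarrow> real"
  assumes ind: "indep_vars (\<lambda>_. borel) \<xi> UNIV" and law: "\<And>k. distr M borel (\<xi> k) = P"
    and nd: "normal_domain_of_attraction \<alpha> \<sigma> \<nu> P" and \<alpha>: "0 < \<alpha>" and \<sigma>: "0 < \<sigma>" and e: "bij e"
    and f: "f \<in> F_space \<alpha>"
  shows "((\<lambda>h. CLINT \<omega>|M. iexp (mu \<alpha> \<sigma> \<xi> e h f \<omega>))
    \<longlongrightarrow> exp (- (LINT x|lebesgue. stable_exponent \<alpha> \<nu> (f x)))) (at_right 0)"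
proof (rule tendstoI)
  fix \<epsilon>0 :: real assume \<epsilon>0: "0 < \<epsilon>0"
  have "random_variable borel (\<xi> k)" for k using ind by (auto simp: indep_vars_def)
  then have P: "real_distribution P" using real_distribution_distr[of "\<xi> undefined"] by (simp add: law)
  define J where "J h = (LINT x|lebesgue. stable_exponent \<alpha> \<nu> (cell_step h f x))" for h
  define J0 where "J0 = (LINT x|lebesgue. stable_exponent \<alpha> \<nu> (f x))"
  have JJ: "(J \<longlongrightarrow> J0) (at_right 0)"
    unfolding J_def J0_def
    by (rule integral_stable_exponent_tendsto[OF F_space_L_space[OF f \<alpha>] \<alpha> _ F_space_cell_step_tendsto[OF f \<alpha>]])
      (rule cell_step_measurable)
  have "isCont exp (- J0)" by simp
  then obtain \<eta> where \<eta>: "0 < \<eta>" "\<And>z. dist z (- J0) < \<eta> \<Longrightarrow> dist (exp z) (exp (- J0)) < \<epsilon>0"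
    unfolding continuous_at_eps_delta using \<epsilon>0 by metis
  \<comment> \<open>An eventual upper bound for \<open>\<Sum>\<^sub>k |a\<^sub>k|\<^sup>\<alpha>\<close>.\<close>
  define A where "A = \<sigma> powr (- \<alpha>) * (\<bar>Re J0\<bar> + 1)"
  have A: "0 < A" using \<sigma> by (auto simp: A_def intro!: mult_pos_pos)
  define \<epsilon> where "\<epsilon> = \<eta> / 2 / A"
  have \<epsilon>: "0 < \<epsilon>" "\<epsilon> * A = \<eta> / 2" using \<eta> A by (auto simp: \<epsilon>_def)
  from normal_domain_of_attraction_char[OF P nd \<alpha> \<sigma> \<epsilon>(1)] obtain \<delta> where \<delta>: "0 < \<delta>"
    "\<And>t. \<bar>t\<bar> \<le> \<delta> \<Longrightarrow> \<exists>r. cmod r \<le> \<epsilon> * \<bar>t\<bar> powr \<alpha> \<and> char P t = exp (- stable_exponent \<alpha> \<nu> (\<sigma> * t) + r)"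
    by blast
  have m: "0 < min 1 (\<eta> / 2)" using \<eta> by simp
  show "\<forall>\<^sub>F h in at_right 0. dist (CLINT \<omega>|M. iexp (mu \<alpha> \<sigma> \<xi> e h f \<omega>))
      (exp (- (LINT x|lebesgue. stable_exponent \<alpha> \<nu> (f x)))) < \<epsilon>0"
    using tendstoD[OF JJ m] mu_coef_uniformly_small[OF f \<sigma> \<alpha> \<delta>(1)] eventually_at_right_less[of 0]
  proof eventually_elim
    case (elim h)
    then have h: "0 < h" and small: "\<bar>mu_coef \<alpha> \<sigma> h f (e n)\<bar> \<le> \<delta>" for n by auto
    have "\<exists>\<rho>. cmod \<rho> \<le> \<epsilon> * (\<sigma> powr (- \<alpha>) * Re (J h)) \<and>
        (CLINT \<omega>|M. iexp (\<Sum>n. mu_coef \<alpha> \<sigma> h f (e n) * \<xi> (e n) \<omega>)) = exp (- J h + \<rho>)"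
      unfolding J_def
      by (rule stable_series_char[OF indep_vars_bij_sequence[OF ind e] law nd \<alpha> \<sigma> _ small
          mu_coef_sums(2)[OF f h \<sigma> \<alpha> e] mu_coef_sums(1)[OF f h \<sigma> \<alpha> e]]) (rule \<delta>(2))
    then obtain \<rho> where \<rho>: "cmod \<rho> \<le> \<epsilon> * (\<sigma> powr (- \<alpha>) * Re (J h))"
      "(CLINT \<omega>|M. iexp (mu \<alpha> \<sigma> \<xi> e h f \<omega>)) = exp (- J h + \<rho>)"
      unfolding mu_def mu_term_eq_coef by blast
    have d: "cmod (J h - J0) < 1" "cmod (J h - J0) < \<eta> / 2" using elim(1) by (auto simp: dist_norm)
    have "Re (J h) \<le> \<bar>Re J0\<bar> + 1"
      using abs_Re_le_cmod[of "J h - J0"] d(1) by simp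
    then have "\<sigma> powr (- \<alpha>) * Re (J h) \<le> A" unfolding A_def by (intro mult_left_mono) auto
    then have "\<epsilon> * (\<sigma> powr (- \<alpha>) * Re (J h)) \<le> \<eta> / 2"
      unfolding \<epsilon>(2)[symmetric] using \<epsilon>(1) by (intro mult_left_mono) auto
    then have r2: "cmod \<rho> \<le> \<eta> / 2" using \<rho>(1) by linarith
    have "dist (- J h + \<rho>) (- J0) = cmod (\<rho> - (J h - J0))" by (simp add: dist_norm algebra_simps)
    also have "\<dots> \<le> cmod \<rho> + cmod (J h - J0)" by (rule norm_triangle_ineq4)
    also have "\<dots> < \<eta>" using r2 d(2) by linarith
    finally show ?case unfolding \<rho>(2) J0_def[symmetric] by (rule \<eta>(2))
  qed
qed

text \<open>The element \<open>f0\<close> witnesses that the space contains \<open>0\<close>, which covers the empty sum.\<close>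

lemma F_space_sum:
  fixes fs :: "'m \<Rightarrow> 'a::euclidean_space \<Rightarrow> real" and f0 :: "'a \<Rightarrow> real"
  assumes "finite A" "\<And>i. i \<in> A \<Longrightarrow> fs i \<in> F_space \<alpha>" "f0 \<in> F_space \<alpha>" "0 < \<alpha>"
  shows "(\<lambda>x. \<Sum>i\<in>A. c i * fs i x) \<in> F_space \<alpha>"
  using assms(1,2)
proof (induction A rule: finite_induct)
  case empty
  show ?case using F_space_lincomb[OF assms(3) assms(3) assms(4), of 0 0] by simp
next
  case (insert i A)
  then show ?case
    using F_space_lincomb[OF _ _ assms(4), of "fs i" "\<lambda>x. \<Sum>i\<in>A. c i * fs i x" "c i" 1] by simp
qed

lemma random_noise_sum:
  fixes fs :: "'m \<Rightarrow> 'a::euclidean_space \<Rightarrow> real" and f0 :: "'a \<Rightarrow> real"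
  assumes W: "random_noise N (L_space \<alpha>) W" and A: "finite A" "\<And>i. i \<in> A \<Longrightarrow> fs i \<in> F_space \<alpha>"
    and f0: "f0 \<in> F_space \<alpha>" and \<alpha>: "0 < \<alpha>"
  shows "AE \<omega> in N. W (\<lambda>x. \<Sum>i\<in>A. c i * fs i x) \<omega> = (\<Sum>i\<in>A. c i * W (fs i) \<omega>)"
proof -
  have lin: "AE \<omega> in N. W (\<lambda>x. a * f x + b * g x) \<omega> = a * W f \<omega> + b * W g \<omega>"
    if "f \<in> F_space \<alpha>" "g \<in> F_space \<alpha>" for f g a b
    using W F_space_L_space[OF _ \<alpha>] that unfolding random_noise_def by blast
  show ?thesis
    using A
  proof (induction A rule: finite_induct)
    case empty
    show ?case using lin[OF f0 f0, of 0 0] by simp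
  next
    case (insert i A)
    have "(\<lambda>x. \<Sum>i\<in>A. c i * fs i x) \<in> F_space \<alpha>"
      by (rule F_space_sum[OF insert(1) _ f0 \<alpha>]) (use insert in auto)
    then have "AE \<omega> in N. W (\<lambda>x. c i * fs i x + 1 * (\<Sum>i\<in>A. c i * fs i x)) \<omega>
        = c i * W (fs i) \<omega> + 1 * W (\<lambda>x. \<Sum>i\<in>A. c i * fs i x) \<omega>"
      using insert by (intro lin) auto
    moreover have "AE \<omega> in N. W (\<lambda>x. \<Sum>i\<in>A. c i * fs i x) \<omega> = (\<Sum>i\<in>A. c i * W (fs i) \<omega>)"
      using insert by auto
    ultimately show ?case
      by eventually_elim (use insert in simp)
  qed
qed

lemma mu_coef_sum:
  fixes fs :: "'m \<Rightarrow> real ^ 'd::finite \<Rightarrow> real"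
  assumes h: "0 < h" and fs: "\<And>i. i \<in> A \<Longrightarrow> cell_integrable (fs i)"
  shows "mu_coef \<alpha> \<sigma> h (\<lambda>x. \<Sum>i\<in>A. c i * fs i x) k = (\<Sum>i\<in>A. c i * mu_coef \<alpha> \<sigma> h (fs i) k)"
proof -
  have "(LINT x:cell h k|lebesgue. (\<Sum>i\<in>A. c i * fs i x)) = (LINT x|lebesgue. (\<Sum>i\<in>A. c i * (indicat_real (cell h k) x *\<^sub>R fs i x)))"
    by (simp add: set_lebesgue_integral_def sum_distrib_left mult_ac)
  also have "\<dots> = (\<Sum>i\<in>A. c i * (LINT x:cell h k|lebesgue. fs i x))"
    using fs h unfolding set_lebesgue_integral_def
    by (subst Bochner_Integration.integral_sum) (auto simp: cell_integrable_def set_integrable_def)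
  finally show ?thesis by (simp add: mu_coef_def sum_distrib_left mult_ac)
qed

lemma mu_sum:
  fixes fs :: "'m::finite \<Rightarrow> real ^ 'd::finite \<Rightarrow> real"
  assumes h: "0 < h" and fs: "\<And>i. cell_integrable (fs i)"
    and sm: "\<And>i. summable (\<lambda>n. mu_term \<alpha> \<sigma> \<xi> h (fs i) (e n) \<omega>)"
  shows "mu \<alpha> \<sigma> \<xi> e h (\<lambda>x. \<Sum>i\<in>UNIV. c i * fs i x) \<omega> = (\<Sum>i\<in>UNIV. c i * mu \<alpha> \<sigma> \<xi> e h (fs i) \<omega>)"
proof -
  have "mu \<alpha> \<sigma> \<xi> e h (\<lambda>x. \<Sum>i\<in>UNIV. c i * fs i x) \<omega> = (\<Sum>n. \<Sum>i\<in>UNIV. c i * mu_term \<alpha> \<sigma> \<xi> h (fs i) (e n) \<omega>)"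
    unfolding mu_def mu_term_eq_coef mu_coef_sum[OF h fs] by (simp add: sum_distrib_right mult.assoc)
  also have "\<dots> = (\<Sum>i\<in>UNIV. \<Sum>n. c i * mu_term \<alpha> \<sigma> \<xi> h (fs i) (e n) \<omega>)"
    by (rule suminf_sum) (intro summable_mult sm)
  also have "\<dots> = (\<Sum>i\<in>UNIV. c i * mu \<alpha> \<sigma> \<xi> e h (fs i) \<omega>)"
    unfolding mu_def by (intro sum.cong refl suminf_mult sm)
  finally show ?thesis .
qed

text \<open>Unfolding scale and skewness; when the scale vanishes, so does the integral that defines the
  skewness.\<close>

lemma stable_noise_char:
  fixes f :: "'a::euclidean_space \<Rightarrow> real"
  assumes W: "stable_noise N \<alpha> \<nu> W" and f: "f \<in> L_space \<alpha>" and \<alpha>: "0 < \<alpha>"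
  shows "(CLINT \<omega>|N. iexp (W f \<omega>)) = exp (- (LINT x|lebesgue. stable_exponent \<alpha> \<nu> (f x)))"
proof -
  have [measurable]: "W f \<in> borel_measurable N" and st: "stable_law \<alpha> (noise_scale \<alpha> f) (noise_skewness \<alpha> \<nu> f) (distr N borel (W f))"
    using W f by (auto simp: stable_noise_def random_noise_def)
  have fm [measurable]: "f \<in> borel_measurable lebesgue" and ff: "powr_mass \<alpha> f < \<infinity>"
    using f by (auto simp: L_space_iff)
  define I where "I = (LINT x|lebesgue. \<bar>f x\<bar> powr \<alpha>)"
  define S where "S = (LINT x|lebesgue. \<nu> * sgn (f x) * \<bar>f x\<bar> powr \<alpha>)"
  define T where "T = tan (pi * \<alpha> / 2)"
  have I0: "0 \<le> I" by (simp add: I_def)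
  have i1: "integrable lebesgue (\<lambda>x. \<bar>f x\<bar> powr \<alpha>)" by (rule powr_mass_finite_integrable(1)[OF fm ff])
  have le: "\<bar>\<nu> * sgn (f x) * \<bar>f x\<bar> powr \<alpha>\<bar> \<le> \<bar>\<nu>\<bar> * \<bar>f x\<bar> powr \<alpha>" for x
    by (auto simp: abs_mult abs_sgn_eq)
  have i2: "integrable lebesgue (\<lambda>x. \<nu> * sgn (f x) * \<bar>f x\<bar> powr \<alpha>)"
    by (rule Bochner_Integration.integrable_bound[of lebesgue "\<lambda>x. \<bar>\<nu>\<bar> * \<bar>f x\<bar> powr \<alpha>"]) (use i1 le in auto)
  have "\<bar>S\<bar> \<le> (LINT x|lebesgue. \<bar>\<nu> * sgn (f x) * \<bar>f x\<bar> powr \<alpha>\<bar>)" unfolding S_def by (rule integral_abs_bound)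
  also have "\<dots> \<le> (LINT x|lebesgue. \<bar>\<nu>\<bar> * \<bar>f x\<bar> powr \<alpha>)"
    by (rule integral_mono) (use i1 i2 le in auto)
  also have "\<dots> = \<bar>\<nu>\<bar> * I" by (simp add: I_def)
  finally have S0: "\<bar>S\<bar> \<le> \<bar>\<nu>\<bar> * I" .
  have sc: "noise_scale \<alpha> f powr \<alpha> = I" using I0 \<alpha> by (simp add: noise_scale_def I_def[symmetric] powr_powr)
  have sk: "I * noise_skewness \<alpha> \<nu> f = S"
    using S0 by (auto simp: noise_skewness_def S_def[symmetric] sc)
  have "(CLINT \<omega>|N. iexp (W f \<omega>)) = char (distr N borel (W f)) 1"
    unfolding char_def by (subst integral_distr) auto
  also have "\<dots> = exp (- (of_real I * (1 - \<i> * of_real (noise_skewness \<alpha> \<nu> f * T))))"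
    using st by (simp add: stable_law_def sc T_def)
  also have "of_real I * (1 - \<i> * of_real (noise_skewness \<alpha> \<nu> f * T)) = of_real I - \<i> * of_real (T * S)"
    unfolding sk[symmetric] by (simp add: algebra_simps)
  also have "\<dots> = (LINT x|lebesgue. stable_exponent \<alpha> \<nu> (f x))"
  proof -
    have "stable_exponent \<alpha> \<nu> (f x) = of_real (\<bar>f x\<bar> powr \<alpha>) - \<i> * of_real (T * (\<nu> * sgn (f x) * \<bar>f x\<bar> powr \<alpha>))" for x
      by (simp add: stable_exponent_def T_def algebra_simps)
    then have "(LINT x|lebesgue. stable_exponent \<alpha> \<nu> (f x))
        = (CLINT x|lebesgue. of_real (\<bar>f x\<bar> powr \<alpha>) - \<i> * of_real (T * (\<nu> * sgn (f x) * \<bar>f x\<bar> powr \<alpha>)))"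
      by (simp only:)
    also have "\<dots> = (CLINT x|lebesgue. of_real (\<bar>f x\<bar> powr \<alpha>)) - (CLINT x|lebesgue. \<i> * of_real (T * (\<nu> * sgn (f x) * \<bar>f x\<bar> powr \<alpha>)))"
    proof (rule Bochner_Integration.integral_diff)
      show "integrable lebesgue (\<lambda>x. complex_of_real (\<bar>f x\<bar> powr \<alpha>))"
        using i1 by (rule integrable_of_real)
      have "integrable lebesgue (\<lambda>x. complex_of_real (T * (\<nu> * sgn (f x) * \<bar>f x\<bar> powr \<alpha>)))"
        using i2 by (intro integrable_of_real integrable_mult_right)
      then show "integrable lebesgue (\<lambda>x. \<i> * complex_of_real (T * (\<nu> * sgn (f x) * \<bar>f x\<bar> powr \<alpha>)))"
        by (rule integrable_mult_right)
    qed
    also have "(CLINT x|lebesgue. of_real (\<bar>f x\<bar> powr \<alpha>)) = of_real I" unfolding I_def by (rule integral_complex_of_real)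
    also have "(CLINT x|lebesgue. \<i> * of_real (T * (\<nu> * sgn (f x) * \<bar>f x\<bar> powr \<alpha>))) = \<i> * of_real (T * S)"
      unfolding S_def by (simp only: integral_mult_right_zero integral_complex_of_real)
    finally show ?thesis ..
  qed
  finally show ?thesis .
qed

lemma borel_measurable_vec_lambda:
  assumes "\<And>i. f i \<in> borel_measurable M"
  shows "(\<lambda>\<omega>. (\<chi> i. f i \<omega>) :: real ^ 'm::finite) \<in> borel_measurable M"
  by (subst borel_measurable_euclidean_space) (use assms in \<open>auto simp: Basis_vec_def inner_axis\<close>)

lemma (in prob_space) mu_measurable:
  fixes \<xi> :: "int ^ 'd::finite \<Rightarrow> 'a \<Rightarrow> real"
  assumes "indep_vars (\<lambda>_. borel) \<xi> UNIV"
  shows "mu \<alpha> \<sigma> \<xi> e h f \<in> borel_measurable M"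
proof -
  have [measurable]: "\<xi> k \<in> borel_measurable M" for k using assms by (auto simp: indep_vars_def)
  show ?thesis unfolding mu_def[abs_def] mu_term_def by measurable
qed

theorem theorem3p1:
  fixes \<alpha> \<sigma> \<nu> :: real
    and M :: "'w measure" and N :: "'v measure"
    and \<xi> :: "int ^ 'd::finite \<Rightarrow> 'w \<Rightarrow> real"
    and e :: "nat \<Rightarrow> int ^ 'd"
    and W :: "(real ^ 'd \<Rightarrow> real) \<Rightarrow> 'v \<Rightarrow> real"
  assumes "0 < \<alpha>" and "\<alpha> \<le> 2" and "0 < \<sigma>" and "-1 \<le> \<nu>" and "\<nu> \<le> 1"
    and "\<alpha> = 1 \<longrightarrow> \<nu> = 0"
    and "prob_space M"
    and "prob_space.indep_vars M (\<lambda>_. borel) \<xi> UNIV"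
    and "\<forall>k l. distr M borel (\<xi> k) = distr M borel (\<xi> l)"
    and "\<forall>k. normal_domain_of_attraction \<alpha> \<sigma> \<nu> (distr M borel (\<xi> k))"
    and "bij e"
    and "stable_noise N \<alpha> \<nu> W"
  shows "(\<forall>h>0. \<forall>f \<in> F_space \<alpha>. AE \<omega> in M. summable (\<lambda>n. mu_term \<alpha> \<sigma> \<xi> h f (e n) \<omega>)) \<and>
    (\<forall>fs :: 'm::finite \<Rightarrow> real ^ 'd \<Rightarrow> real. range fs \<subseteq> F_space \<alpha> \<longrightarrow>
       weak_conv_along
         (\<lambda>h. distr M borel (\<lambda>\<omega>. \<chi> i. mu \<alpha> \<sigma> \<xi> e h (fs i) \<omega>))
         (distr N borel (\<lambda>\<omega>. \<chi> i. W (fs i) \<omega>))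
         (at_right 0))"
proof -
  interpret M: prob_space M by fact
  interpret N: prob_space N using assms(12) by (simp add: stable_noise_def random_noise_def)
  note \<alpha> = assms(1) and \<sigma> = assms(3) and ind = assms(8) and e = assms(11) and W = assms(12)
  define P where "P = distr M borel (\<xi> undefined)"
  have law: "distr M borel (\<xi> k) = P" for k using assms(9) by (simp add: P_def)
  have nd: "normal_domain_of_attraction \<alpha> \<sigma> \<nu> P" using assms(10) by (simp add: P_def)
  note summ = M.mu_summable[OF ind law nd \<alpha> \<sigma> e]
  have Wm: "W f \<in> borel_measurable N" if "f \<in> F_space \<alpha>" for f
    using W F_space_L_space[OF that \<alpha>] by (simp add: stable_noise_def random_noise_def)
  have conv: "weak_conv_along (\<lambda>h. distr M borel (\<lambda>\<omega>. \<chi> i. mu \<alpha> \<sigma> \<xi> e h (fs i) \<omega>))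
         (distr N borel (\<lambda>\<omega>. \<chi> i. W (fs i) \<omega>)) (at_right 0)"
    if fs: "range fs \<subseteq> F_space \<alpha>" for fs :: "'m \<Rightarrow> real ^ 'd \<Rightarrow> real"
  proof -
    have fsF: "fs i \<in> F_space \<alpha>" for i using fs by auto
    define X where "X h \<omega> = (\<chi> i. mu \<alpha> \<sigma> \<xi> e h (fs i) \<omega>)" for h \<omega>
    define Y where "Y \<omega> = (\<chi> i. W (fs i) \<omega>)" for \<omega>
    have Xm [measurable]: "X h \<in> borel_measurable M" for h
      unfolding X_def by (intro borel_measurable_vec_lambda M.mu_measurable[OF ind])
    have Ym [measurable]: "Y \<in> borel_measurable N"
      unfolding Y_def by (intro borel_measurable_vec_lambda Wm fsF)
    define F where "F \<theta> = (\<lambda>x. \<Sum>i\<in>UNIV. \<theta> $ i * fs i x)" for \<theta> :: "real ^ 'm"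
    have FF: "F \<theta> \<in> F_space \<alpha>" for \<theta>
      unfolding F_def by (rule F_space_sum[OF _ _ fsF[of undefined] \<alpha>]) (use fsF in auto)
    have charX: "(CLINT x|distr M borel (X h). iexp (\<theta> \<bullet> x)) = (CLINT \<omega>|M. iexp (mu \<alpha> \<sigma> \<xi> e h (F \<theta>) \<omega>))"
      if h: "0 < h" for h \<theta>
    proof -
      have "(CLINT x|distr M borel (X h). iexp (\<theta> \<bullet> x)) = (CLINT \<omega>|M. iexp (\<theta> \<bullet> X h \<omega>))"
        by (subst integral_distr) auto
      also have "\<dots> = (CLINT \<omega>|M. iexp (mu \<alpha> \<sigma> \<xi> e h (F \<theta>) \<omega>))"
      proof (rule integral_cong_AE)
        have [measurable]: "mu \<alpha> \<sigma> \<xi> e h (F \<theta>) \<in> borel_measurable M" by (rule M.mu_measurable[OF ind])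
        show "(\<lambda>\<omega>. iexp (mu \<alpha> \<sigma> \<xi> e h (F \<theta>) \<omega>)) \<in> borel_measurable M" by measurable
        show "(\<lambda>\<omega>. iexp (\<theta> \<bullet> X h \<omega>)) \<in> borel_measurable M" by measurable
        have "AE \<omega> in M. \<forall>i\<in>UNIV. summable (\<lambda>n. mu_term \<alpha> \<sigma> \<xi> h (fs i) (e n) \<omega>)"
          by (intro AE_finite_allI summ[OF fsF h]) auto
        then show "AE \<omega> in M. iexp (\<theta> \<bullet> X h \<omega>) = iexp (mu \<alpha> \<sigma> \<xi> e h (F \<theta>) \<omega>)"
        proof eventually_elim
          case (elim \<omega>)
          have "mu \<alpha> \<sigma> \<xi> e h (F \<theta>) \<omega> = \<theta> \<bullet> X h \<omega>"
            unfolding F_def X_def inner_vec_def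
            by (subst mu_sum[OF h F_space_cell_integrable[OF fsF \<alpha>]]) (use elim in auto)
          then show ?case by simp
        qed
      qed
      finally show ?thesis .
    qed
    have charY: "(CLINT x|distr N borel Y. iexp (\<theta> \<bullet> x)) = exp (- (LINT x|lebesgue. stable_exponent \<alpha> \<nu> (F \<theta> x)))" for \<theta>
    proof -
      have "(CLINT x|distr N borel Y. iexp (\<theta> \<bullet> x)) = (CLINT \<omega>|N. iexp (\<theta> \<bullet> Y \<omega>))"
        by (subst integral_distr) auto
      also have "\<dots> = (CLINT \<omega>|N. iexp (W (F \<theta>) \<omega>))"
      proof (rule integral_cong_AE)
        have [measurable]: "W (F \<theta>) \<in> borel_measurable N" by (rule Wm[OF FF])
        show "(\<lambda>\<omega>. iexp (W (F \<theta>) \<omega>)) \<in> borel_measurable N" by measurable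
        show "(\<lambda>\<omega>. iexp (\<theta> \<bullet> Y \<omega>)) \<in> borel_measurable N" by measurable
        have "random_noise N (L_space \<alpha>) W" using W by (simp add: stable_noise_def)
        then have "AE \<omega> in N. W (F \<theta>) \<omega> = (\<Sum>i\<in>UNIV. \<theta> $ i * W (fs i) \<omega>)"
          unfolding F_def by (rule random_noise_sum[OF _ _ _ fsF[of undefined] \<alpha>]) (use fsF in auto)
        then show "AE \<omega> in N. iexp (\<theta> \<bullet> Y \<omega>) = iexp (W (F \<theta>) \<omega>)"
          by eventually_elim (simp add: Y_def inner_vec_def)
      qed
      also have "\<dots> = exp (- (LINT x|lebesgue. stable_exponent \<alpha> \<nu> (F \<theta> x)))"
        by (rule stable_noise_char[OF W F_space_L_space[OF FF \<alpha>] \<alpha>])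
      finally show ?thesis .
    qed
    show ?thesis
      unfolding weak_conv_along_def X_def[symmetric] Y_def[symmetric]
    proof (intro allI impI)
      fix g :: "real ^ 'm \<Rightarrow> real" assume g: "continuous_on UNIV g \<and> bounded (range g)"
      show "((\<lambda>h. LINT x|distr M borel (X h). g x) \<longlongrightarrow> (LINT x|distr N borel Y. g x)) (at_right 0)"
        unfolding tendsto_at_iff_sequentially comp_def
      proof (intro allI impI)
        fix H :: "nat \<Rightarrow> real" assume H: "\<forall>n. H n \<in> {0<..} - {0}" "H \<longlonglongrightarrow> 0"
        then have H0: "0 < H n" for n by auto
        show "(\<lambda>n. LINT x|distr M borel (X (H n)). g x) \<longlonglongrightarrow> (LINT x|distr N borel Y. g x)"
        proof (rule levy_continuity_euclidean)
          fix \<theta> :: "real ^ 'm"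
          have "(\<lambda>n. CLINT \<omega>|M. iexp (mu \<alpha> \<sigma> \<xi> e (H n) (F \<theta>) \<omega>))
              \<longlonglongrightarrow> exp (- (LINT x|lebesgue. stable_exponent \<alpha> \<nu> (F \<theta> x)))"
            using M.mu_char_tendsto[OF ind law nd \<alpha> \<sigma> e FF, unfolded tendsto_at_iff_sequentially comp_def] H
            by blast
          then show "(\<lambda>n. CLINT x|distr M borel (X (H n)). iexp (\<theta> \<bullet> x)) \<longlonglongrightarrow> (CLINT x|distr N borel Y. iexp (\<theta> \<bullet> x))"
            by (simp only: charX[OF H0] charY)
        qed (use g in \<open>auto intro: M.prob_space_distr N.prob_space_distr\<close>)
      qed
    qed
  qed
  show ?thesis using summ conv by blast
qed

end
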